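(* Let $T[1..n]$ be any text over an integer alphabet $\Sigma$ (terminated by the end-marker $\$$), and let $e$ be the size of the CDAWG of $T$. Given a self-index version of the CDAWG of $T$ (without access to the text $T$), the run-length encoded BWT of $T$, which has $r \le e$ runs, can be constructed in $O(e)$ worst-case time using $O(e)$ words of working space.
   Context: $T=T[1..n]$ is a text over an integer alphabet $\Sigma$ with total order $\le_\Sigma$, whose last symbol $T[n]=\$$ occurs nowhere else in $T$ and is smaller than every other symbol. $T_p=T[p..n]$ denotes the $p$-th suffix. The suffix array $SA[1..n]$ lists the starting positions of the suffixes of $T$ in increasing lexicographic order. The BWT of $T$ is the string $BWT[1..n]$ with $BWT[k]=T[n]$ if $SA[k]=1$ and $BWT[k]=T[SA[k]-1]$ otherwise; the run-length BWT (RLBWT) is the run-length encoding of $BWT$, and $r$ denotes its number of runs (maximal equal-symbol blocks). The CDAWG (compact directed acyclic word graph) $G$ of $T$ is the edge-labeled DAG obtained from the suffix tree of $T$ by merging all isomorphic subtrees; it has a source (root) and a sink, each edge is labeled by a nonempty string, and the root-to-sink paths spell exactly the $n$ suffixes of $T$, bijectively. Its size $e$ is the number of its edges plus the number of its suffix links. The self-index version of the CDAWG is a representation of $G$ in $O(e)$ words from which the edge labels can be recovered without storing or accessing $T$ (as in Belazzougui–Cunial 2017 and Takagi et al. 2017). Word-RAM model. *)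

theory Defs
  imports Complex_Main "HOL-Library.Sublist" "HOL-Library.List_Lexorder"
begin

section \<open>Texts, suffix array, BWT\<close>

text \<open>Symbols are natural numbers (an integer alphabet with its usual order). Positions are
  0-based, so the suffix with 1-based number \<open>p + 1\<close> is \<open>drop p T\<close>.
  List comparison is lexicographic.\<close>

type_synonym str = "nat list"

definition terminated :: "str \<Rightarrow> bool" where
  "terminated T \<longleftrightarrow> T \<noteq> [] \<and> (\<forall>a \<in> set (butlast T). last T < a)"

definition suffix_array :: "str \<Rightarrow> nat list" where
  "suffix_array T = sort_key (\<lambda>p. drop p T) [0..<length T]"

definition bwt :: "str \<Rightarrow> str" where
  "bwt T = map (\<lambda>p. if p = 0 then last T else T ! (p - 1)) (suffix_array T)"

fun run_length_encode :: "'a list \<Rightarrow> ('a \<times> nat) list" where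
  "run_length_encode [] = []"
| "run_length_encode (x # xs) =
    (case run_length_encode xs of
       [] \<Rightarrow> [(x, 1)]
     | (y, k) # rs \<Rightarrow> if x = y then (y, Suc k) # rs else (x, 1) # (y, k) # rs)"

definition rlbwt :: "str \<Rightarrow> (nat \<times> nat) list" where
  "rlbwt T = run_length_encode (bwt T)"

definition bwt_runs :: "str \<Rightarrow> nat" where
  "bwt_runs T = length (rlbwt T)"


section \<open>Suffix tree\<close>

text \<open>A node of the suffix tree is identified with the string spelled from the root to it.
  The root is \<open>[]\<close>, the leaves are the nonempty suffixes of \<open>T\<close>, and the remaining nodes are the
  branching factors of \<open>T\<close>.\<close>

definition st_nodes :: "str \<Rightarrow> str set" where
  "st_nodes T = {[]} \<union> {x. x \<noteq> [] \<and> suffix x T}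
     \<union> {x. \<exists>a b. a \<noteq> b \<and> sublist (x @ [a]) T \<and> sublist (x @ [b]) T}"

definition st_edges :: "str \<Rightarrow> (str \<times> str \<times> str) set" where
  "st_edges T = {(x, l, y). x \<in> st_nodes T \<and> y \<in> st_nodes T \<and> l \<noteq> [] \<and> y = x @ l \<and>
     \<not> (\<exists>z \<in> st_nodes T. strict_prefix x z \<and> strict_prefix z y)}"

definition st_subtree :: "str \<Rightarrow> str \<Rightarrow> str set" where
  "st_subtree T x = {y \<in> st_nodes T. prefix x y}"

definition st_iso :: "str \<Rightarrow> (str \<times> str) set" where
  "st_iso T = {(x, y). x \<in> st_nodes T \<and> y \<in> st_nodes T \<and>
     (\<exists>f. bij_betw f (st_subtree T x) (st_subtree T y) \<and> f x = y \<and>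
        (\<forall>u \<in> st_subtree T x. \<forall>v \<in> st_subtree T x. \<forall>l.
           (u, l, v) \<in> st_edges T \<longleftrightarrow> (f u, l, f v) \<in> st_edges T))}"


section \<open>CDAWG\<close>

text \<open>A node of the CDAWG is a class of suffix tree nodes with isomorphic subtrees.\<close>

definition cdawg_nodes :: "str \<Rightarrow> str set set" where
  "cdawg_nodes T = st_nodes T // st_iso T"

definition cdawg_edges :: "str \<Rightarrow> (str set \<times> str \<times> str set) set" where
  "cdawg_edges T = {(U, l, V). U \<in> cdawg_nodes T \<and> V \<in> cdawg_nodes T \<and>
     (\<exists>u \<in> U. \<exists>v \<in> V. (u, l, v) \<in> st_edges T)}"

definition cdawg_root :: "str \<Rightarrow> str set" where
  "cdawg_root T = st_iso T `` {[]}"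

definition cdawg_sink :: "str \<Rightarrow> str set" where
  "cdawg_sink T = st_iso T `` {T}"

text \<open>The suffix links \<open>a # x \<rightarrow> x\<close> of the suffix tree, without those that become loops
  when isomorphic subtrees are merged. Every node but the root has exactly one: it leads to the
  node of the longest suffix of the strings in \<open>U\<close> that is not itself in \<open>U\<close>.\<close>

definition cdawg_suffix_links :: "str \<Rightarrow> (str set \<times> str set) set" where
  "cdawg_suffix_links T = {(U, V). U \<in> cdawg_nodes T \<and> V \<in> cdawg_nodes T \<and> U \<noteq> V \<and>
     (\<exists>a x. a # x \<in> U \<and> x \<in> V)}"

definition cdawg_size :: "str \<Rightarrow> nat" where
  "cdawg_size T = card (cdawg_edges T) + card (cdawg_suffix_links T)"

text \<open>The length of the longest string spelled by a path from the root to \<open>U\<close>.\<close>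

definition node_length :: "str set \<Rightarrow> nat" where
  "node_length U = Max (length ` U)"


section \<open>Self-index version of the CDAWG\<close>

text \<open>The text-free representation of Belazzougui and Cunial, as a sequence of words.
  \<^item> \<open>ns\<close> is an arbitrary numbering of the nodes; \<open>rt\<close> and \<open>sk\<close> are the numbers of the root
    and the sink; \<open>sl\<close> holds the suffix links (the root points to itself).
  \<^item> \<open>es\<close> lists the edges grouped by source, the edges leaving a node in lexicographic order.
    Of a label only the first symbol and the length are stored.
  \<^item> \<open>ins\<close> lists the indices (in \<open>es\<close>) of the edges grouped by target, the edges entering a node
    by decreasing length of the longest string spelled by a path from the root that ends with
    that edge.
  \<^item> The groups of node \<open>k\<close> in \<open>es\<close> and \<open>ins\<close> are delimited by the entries \<open>k\<close> and \<open>k + 1\<close>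
    of two offset tables.

  The lists of entering edges are the productions of a grammar that replaces the text. Let \<open>F v\<close>
  consist of the first symbols of the strings in the class \<open>v\<close>, from the longest string to the
  shortest. Then \<open>F v\<close> is the concatenation, over the edges entering \<open>v\<close> in the stored order, of
  \<open>F u\<close> for the source \<open>u\<close> of the edge, or of the first symbol of the edge if \<open>u\<close> is the root.
  The longest string of \<open>v\<close> is \<open>F v\<close> followed by the longest string of the suffix link target of
  \<open>v\<close>, and the label of an edge entering \<open>v\<close> is a suffix of the longest string of \<open>v\<close>, of the
  stored length.\<close>

definition cdawg_self_index :: "str \<Rightarrow> nat list \<Rightarrow> bool" where
  "cdawg_self_index T xs \<longleftrightarrow> (\<exists>ns rt sk sl es ins.
     distinct ns \<and> set ns = cdawg_nodes T \<and>
     rt < length ns \<and> ns ! rt = cdawg_root T \<and>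
     sk < length ns \<and> ns ! sk = cdawg_sink T \<and>
     length sl = length ns \<and>
     (\<forall>i < length ns. if i = rt then sl ! i = i
        else sl ! i < length ns \<and> (ns ! i, ns ! (sl ! i)) \<in> cdawg_suffix_links T) \<and>
     distinct es \<and>
     set es = {(i, l, j). i < length ns \<and> j < length ns \<and> (ns ! i, l, ns ! j) \<in> cdawg_edges T} \<and>
     sorted_wrt (\<lambda>(i, l, j) (i', l', j'). i < i' \<or> i = i' \<and> hd l < hd l') es \<and>
     distinct ins \<and> set ins = {..<length es} \<and>
     sorted_wrt (\<lambda>f g. case (es ! f, es ! g) of ((i, l, j), (i', l', j')) \<Rightarrow>
        j < j' \<or>
        j = j' \<and> node_length (ns ! i) + length l > node_length (ns ! i') + length l') ins \<and>
     xs = [length ns, length es, rt, sk] @ sl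
        @ map (\<lambda>k. length (filter (\<lambda>(i, l, j). i < k) es)) [0..<Suc (length ns)]
        @ map (\<lambda>k. length (filter (\<lambda>(i, l, j). j < k) es)) [0..<Suc (length ns)]
        @ concat (map (\<lambda>(i, l, j). [i, hd l, length l, j]) es)
        @ ins)"


section \<open>Word RAM\<close>

text \<open>Words are the natural numbers below \<open>2 ^ w\<close>. A program is a fixed finite list of
  instructions over finitely many registers, independent of the input and of \<open>w\<close>. The memory is
  a finite array of words; an access outside of it is an error. Each instruction takes one unit
  of time.\<close>

datatype binop = Add | Sub | Mul | Div | Mod | And | Or | Xor | Shl | Shr

datatype instr =
    Const nat nat            \<comment> \<open>register, constant\<close>
  | Op binop nat nat nat     \<comment> \<open>destination and operand registers\<close>
  | Load nat nat             \<comment> \<open>destination register, register holding the address\<close>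
  | Store nat nat            \<comment> \<open>register holding the address, source register\<close>
  | Jump nat
  | Jump_eq nat nat nat      \<comment> \<open>compared registers, jump target\<close>
  | Jump_less nat nat nat    \<comment> \<open>compared registers, jump target\<close>
  | Halt

fun eval_op :: "nat \<Rightarrow> binop \<Rightarrow> nat \<Rightarrow> nat \<Rightarrow> nat" where
  "eval_op w Add x y = (x + y) mod 2 ^ w"
| "eval_op w Sub x y = (x + 2 ^ w - y) mod 2 ^ w"
| "eval_op w Mul x y = (x * y) mod 2 ^ w"
| "eval_op w Div x y = x div y"
| "eval_op w Mod x y = x mod y"
| "eval_op w And x y = Bit_Operations.and x y"
| "eval_op w Or x y = Bit_Operations.or x y"
| "eval_op w Xor x y = Bit_Operations.xor x y"
| "eval_op w Shl x y = push_bit y x mod 2 ^ w"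
| "eval_op w Shr x y = drop_bit y x"

text \<open>Program counter, registers, memory.\<close>

type_synonym state = "nat \<times> (nat \<Rightarrow> nat) \<times> nat list"

fun step :: "nat \<Rightarrow> instr list \<Rightarrow> state \<Rightarrow> state option" where
  "step w P (pc, R, M) =
    (if pc < length P then
       (case P ! pc of
          Const d k \<Rightarrow> Some (Suc pc, R(d := k mod 2 ^ w), M)
        | Op f d a b \<Rightarrow> Some (Suc pc, R(d := eval_op w f (R a) (R b)), M)
        | Load d a \<Rightarrow>
            if R a < length M then Some (Suc pc, R(d := M ! R a), M) else None
        | Store a s \<Rightarrow>
            if R a < length M then Some (Suc pc, R, M[R a := R s]) else None
        | Jump l \<Rightarrow> Some (l, R, M)
        | Jump_eq a b l \<Rightarrow> Some (if R a = R b then l else Suc pc, R, M)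
        | Jump_less a b l \<Rightarrow> Some (if R a < R b then l else Suc pc, R, M)
        | Halt \<Rightarrow> None)
     else None)"

primrec steps :: "nat \<Rightarrow> instr list \<Rightarrow> nat \<Rightarrow> state \<Rightarrow> state option" where
  "steps w P 0 s = Some s"
| "steps w P (Suc t) s = Option.bind (step w P s) (steps w P t)"

definition halts_in :: "nat \<Rightarrow> instr list \<Rightarrow> nat \<Rightarrow> nat list \<Rightarrow> (nat \<Rightarrow> nat) \<Rightarrow> nat list \<Rightarrow> bool" where
  "halts_in w P t M R' M' \<longleftrightarrow>
     (\<exists>pc. steps w P t (0, \<lambda>_. 0, M) = Some (pc, R', M') \<and> pc < length P \<and> P ! pc = Halt)"

text \<open>On halting, register 0 holds the address and register 1 the number of the pairs.\<close>

definition outputs_pairs :: "(nat \<Rightarrow> nat) \<Rightarrow> nat list \<Rightarrow> (nat \<times> nat) list \<Rightarrow> bool" where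
  "outputs_pairs R M ps \<longleftrightarrow> R 1 = length ps \<and>
     take (2 * length ps) (drop (R 0) M) = concat (map (\<lambda>(c, k). [c, k]) ps)"

text \<open>Started on the words \<open>xs\<close> followed by \<open>s\<close> words of working space with arbitrary contents,
  \<open>P\<close> outputs \<open>ps\<close> after at most \<open>t\<close> steps.\<close>

definition ram_computes ::
    "nat \<Rightarrow> instr list \<Rightarrow> nat list \<Rightarrow> (nat \<times> nat) list \<Rightarrow> nat \<Rightarrow> nat \<Rightarrow> bool" where
  "ram_computes w P xs ps t s \<longleftrightarrow>
     (\<forall>work. length work = s \<and> (\<forall>x \<in> set work. x < 2 ^ w) \<longrightarrow>
        (\<exists>t' \<le> t. \<exists>R' M'. halts_in w P t' (xs @ work) R' M' \<and> outputs_pairs R' M' ps))"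

text \<open>The word size must accommodate the length of the text, the input words and the addresses of
  the memory, which consists of the input and \<open>s\<close> words of working space.\<close>

definition word_size_ok :: "nat \<Rightarrow> str \<Rightarrow> nat list \<Rightarrow> nat \<Rightarrow> bool" where
  "word_size_ok w T xs s \<longleftrightarrow>
     length T < 2 ^ w \<and> (\<forall>x \<in> set xs. x < 2 ^ w) \<and> length xs + s \<le> 2 ^ w"

end

theory Submission imports Defs begin

text \<open>
  Two nodes of the suffix tree have isomorphic subtrees iff the same strings extend them to suffixes of \<open>T\<close>.
  Hence a CDAWG node consists of suffixes of its longest string \<open>x\<close> whose lengths form an interval, and every
  string of the node other than \<open>x\<close> is always preceded in \<open>T\<close> by the same symbol. The BWT of the suffixes
  below such a shorter string is therefore a single run.

  Traverse the suffix tree in lexicographic order but descend only into longest strings, that is along the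
  primary edges of the CDAWG, those that come first among the edges entering their target. Since each node has
  exactly one primary edge, this visits each edge of the CDAWG once. A secondary edge contributes one run. Its
  length is the number of paths from the target to the sink, which a topological traversal computes for all
  nodes. Its symbol is the first symbol of the shortest string passing through the preceding edge into the same
  target, which is found by following the last edge into a node backwards. The primary edge into the sink stands
  for \<open>T\<close> itself and contributes the end-marker, which is the first symbol of the first edge of the root.

  The word RAM program is obtained by compiling a small structured language with arrays, whose weakest
  preconditions keep track of the time.
\<close>

section \<open>Right contexts and CDAWG nodes\<close>

text \<open>The symbol of a secondary edge can be read off its neighbour for the following reason.
  Ordered by length, consecutive strings of a node differ by one symbol on the left, and each
  entering edge contributes a contiguous block of them. If \<open>x\<close> is the longest string of
  the block of a secondary edge, then some \<open>a # x\<close> is the shortest string of the block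
  of the preceding edge. Both lie in one node, so \<open>a\<close> precedes every suffix below
  \<open>x\<close>, and it is the first symbol of the shortest string of that edge's source, or of
  the label if the source is the root. All that the program relies on is collected in
  \<open>edge_graph\<close>, which mentions neither texts nor trees. No addition overflows because
  every count is a number of suffixes, hence at most the length of the text; node-wise work is
  linear in the number of edges because only the root has no entering edge. The bound on the number
  of runs concerns texts for which neither an index nor a word size is given. This is why an index
  is shown to exist and why the language is parametrised by an arbitrary bound \<open>W\<close> on
  its numbers.\<close>

definition right_contexts :: "str \<Rightarrow> str \<Rightarrow> str set" where
  "right_contexts T x = {z. x @ z \<noteq> [] \<and> suffix (x @ z) T}"

locale terminated_text =
  fixes T :: str
  assumes terminated_T: "terminated T"
begin

abbreviation "rx \<equiv> right_contexts T"

lemma T_nonempty: "T \<noteq> []"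
  using terminated_T by (simp add: terminated_def)

lemma end_marker_last:
  assumes "T = p @ last T # q"
  shows "q = []"
proof (rule ccontr)
  assume "q \<noteq> []"
  then have "last T \<in> set (butlast T)"
    by (subst (2) assms) (simp add: butlast_append)
  then show False
    using terminated_T by (auto simp: terminated_def)
qed

text \<open>A nonempty suffix ends with the end-marker, and nothing can follow the end-marker in
  \<open>T\<close>. This makes the suffixes leaves.\<close>

lemma suffix_not_extendable:
  assumes "s \<noteq> []" "suffix s T" "suffix (s @ z) T"
  shows "z = []"
proof -
  have l: "last s = last T"
    using assms(1,2) by (metis last_appendR suffix_def)
  obtain p where p: "T = p @ s @ z"
    using assms(3) by (auto simp: suffix_def)
  have "s = butlast s @ [last T]"
    using assms(1) l by (metis append_butlast_last_id)
  then have "T = (p @ butlast s) @ last T # z"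
    using p by (metis append.assoc append_Cons append_Nil)
  then show ?thesis
    by (rule end_marker_last)
qed

lemma rx_append: "z' \<in> rx (x @ z) \<longleftrightarrow> z @ z' \<in> rx x"
  by (auto simp: right_contexts_def)

lemma Nil_in_rx: "[] \<in> rx x \<longleftrightarrow> x \<noteq> [] \<and> suffix x T"
  by (simp add: right_contexts_def)

lemma rx_leaf: "[] \<in> rx x \<Longrightarrow> z \<in> rx x \<Longrightarrow> z = []"
  using suffix_not_extendable by (auto simp: right_contexts_def)

text \<open>For reasons of length, \<open>T\<close> continues only the empty string to a suffix of
  \<open>T\<close>. So the root is merged with no other node.\<close>

lemma rx_eqI_Nil:
  assumes "rx x = rx []"
  shows "x = []"
proof -
  have "T \<in> rx []"
    by (simp add: right_contexts_def T_nonempty)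
  then have "T \<in> rx x"
    using assms by simp
  then have "suffix (x @ T) T"
    by (simp add: right_contexts_def)
  then have "length (x @ T) \<le> length T"
    by (rule suffix_length_le)
  then show ?thesis
    by simp
qed

lemma sublist_snoc_rx: "sublist (x @ [a]) T \<longleftrightarrow> (\<exists>z. a # z \<in> rx x)"
  by (auto simp: right_contexts_def sublist_def suffix_def) 

text \<open>This form makes nodehood of a nonempty string a matter of its right contexts alone, so
  strings with equal right contexts have the same tree below them.\<close>

lemma st_nodes_iff:
  "x \<in> st_nodes T \<longleftrightarrow> x = [] \<or> [] \<in> rx x \<or>
     (\<exists>a b y z. a \<noteq> b \<and> a # y \<in> rx x \<and> b # z \<in> rx x)"
  unfolding st_nodes_def sublist_snoc_rx Nil_in_rx by blast

lemma Nil_node: "[] \<in> st_nodes T"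
  by (simp add: st_nodes_iff)

lemma st_nodes_cong: "rx x = rx y \<Longrightarrow> x \<in> st_nodes T \<longleftrightarrow> y \<in> st_nodes T"
  using rx_eqI_Nil by (auto simp: st_nodes_iff) 

lemma rx_nonempty: "x \<in> st_nodes T \<Longrightarrow> rx x \<noteq> {}"
  using T_nonempty by (auto simp: st_nodes_iff) (auto simp: right_contexts_def)

lemma leaf_node: "z \<in> rx x \<Longrightarrow> x @ z \<in> st_nodes T"
  by (auto simp: st_nodes_iff Nil_in_rx right_contexts_def)

lemma st_nodes_finite: "finite (st_nodes T)"
proof (rule finite_subset)
  show "st_nodes T \<subseteq> set (sublists T)"
  proof
    fix x assume "x \<in> st_nodes T"
    then obtain z where "suffix (x @ z) T"
      using rx_nonempty by (auto simp: right_contexts_def)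
    then show "x \<in> set (sublists T)"
      by (auto simp: suffix_def sublist_def)
  qed
qed simp

section \<open>Edges and parents in the suffix tree\<close>

lemma st_edges_iff:
  "(x, l, y) \<in> st_edges T \<longleftrightarrow> x \<in> st_nodes T \<and> y = x @ l \<and> l \<noteq> [] \<and> x @ l \<in> st_nodes T \<and>
     (\<forall>m. m \<noteq> [] \<and> strict_prefix m l \<longrightarrow> x @ m \<notin> st_nodes T)"
proof -
  have "(\<exists>z \<in> st_nodes T. strict_prefix x z \<and> strict_prefix z (x @ l)) \<longleftrightarrow>
      (\<exists>m. m \<noteq> [] \<and> strict_prefix m l \<and> x @ m \<in> st_nodes T)" (is "?L \<longleftrightarrow> ?R")
  proof
    assume ?L
    then obtain z where z: "z \<in> st_nodes T" "strict_prefix x z" "strict_prefix z (x @ l)"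
      by blast
    then obtain m where "z = x @ m" "m \<noteq> []"
      by (auto simp: strict_prefix_def prefix_def)
    then show ?R
      using z by (auto simp: strict_prefix_def)
  next
    assume ?R
    then obtain m where "m \<noteq> []" "strict_prefix m l" "x @ m \<in> st_nodes T"
      by blast
    then show ?L
      by (intro bexI[of _ "x @ m"]) (auto simp: strict_prefix_def)
  qed
  then show ?thesis
    unfolding st_edges_def by blast
qed

lemma st_edges_cong:
  assumes "rx x = rx x'"
  shows "(x, l, x @ l) \<in> st_edges T \<longleftrightarrow> (x', l, x' @ l) \<in> st_edges T"
proof -
  have "x @ m \<in> st_nodes T \<longleftrightarrow> x' @ m \<in> st_nodes T" for m
    using assms by (intro st_nodes_cong) (auto simp: rx_append)
  from this this[of "[]"] show ?thesis
    by (auto simp: st_edges_iff)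
qed

lemma st_edge_exists:
  assumes "x \<in> st_nodes T" "z \<in> rx x" "z \<noteq> []"
  obtains l where "(x, l, x @ l) \<in> st_edges T" "prefix l z"
proof -
  \<comment> \<open>The edge ends at the first node met when \<open>z\<close> is read from
    \<open>x\<close>; one is met because all of \<open>z\<close> leads to a leaf.\<close>
  define P where "P m \<longleftrightarrow> m \<noteq> [] \<and> prefix m z \<and> x @ m \<in> st_nodes T" for m
  have "P z"
    using assms leaf_node by (simp add: P_def)
  then obtain l where l: "P l" and min: "\<And>m. length m < length l \<Longrightarrow> \<not> P m"
    using ex_has_least_nat[of P z length] by (meson not_less)
  have "x @ m \<notin> st_nodes T" if "m \<noteq> []" "strict_prefix m l" for m
    using min[of m] that l prefix_length_less[of m l]
    by (auto simp: P_def strict_prefix_def)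
  then have "(x, l, x @ l) \<in> st_edges T"
    using l assms(1) by (auto simp: st_edges_iff P_def)
  then show ?thesis
    using l that by (auto simp: P_def)
qed

text \<open>If one label were a proper prefix of the other, its end would be a node inside the other
  edge. If they diverged after a common prefix, the end of that prefix would be a branching node
  inside both.\<close>

lemma st_edge_unique:
  assumes "(x, l, y) \<in> st_edges T" "(x, l', y') \<in> st_edges T" "hd l = hd l'"
  shows "l = l'"
proof (rule ccontr)
  assume ne: "l \<noteq> l'"
  have e: "l \<noteq> []" "l' \<noteq> []" "x @ l \<in> st_nodes T" "x @ l' \<in> st_nodes T"
    using assms by (auto simp: st_edges_iff)
  have "\<not> strict_prefix l l'" "\<not> strict_prefix l' l"
    using assms e by (auto simp: st_edges_iff)
  then have "l \<parallel> l'"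
    using ne by (auto simp: strict_prefix_def parallel_def)
  then obtain m b bs c cs where d: "b \<noteq> c" "l = m @ b # bs" "l' = m @ c # cs"
    using parallel_decomp by blast
  have m: "m \<noteq> []"
    using d assms(3) by auto
  obtain u v where "u \<in> rx (x @ l)" "v \<in> rx (x @ l')"
    using e rx_nonempty by blast
  then have "b # bs @ u \<in> rx (x @ m)" "c # cs @ v \<in> rx (x @ m)"
    using d by (auto simp: rx_append)
  then have "x @ m \<in> st_nodes T"
    using d(1) by (auto simp: st_nodes_iff)
  moreover have "strict_prefix m l"
    using d(2) by (simp add: strict_prefix_def)
  ultimately show False
    using assms(1) m by (auto simp: st_edges_iff)
qed

lemma st_parent_exists:
  assumes "x \<in> st_nodes T" "x @ z \<in> st_nodes T" "z \<noteq> []"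
  obtains z' l where "z = z' @ l" "(x @ z', l, x @ z) \<in> st_edges T"
proof -
  define P where "P m \<longleftrightarrow> strict_prefix m z \<and> x @ m \<in> st_nodes T" for m
  have "P []"
    using assms by (simp add: P_def strict_prefix_def)
  moreover have "P m \<Longrightarrow> length m \<le> length z" for m
    by (auto simp: P_def dest: prefix_length_less)
  ultimately obtain m where m: "P m" and max: "\<And>m'. P m' \<Longrightarrow> length m' \<le> length m"
    using ex_has_greatest_nat[of P "[]" length "Suc (length z)"] by (auto simp: less_Suc_eq_le)
  obtain l where l: "z = m @ l" "l \<noteq> []"
    using m by (auto simp: P_def strict_prefix_def prefix_def)
  have "(x @ m) @ k \<notin> st_nodes T" if "k \<noteq> []" "strict_prefix k l" for k
    using max[of "m @ k"] that l by (auto simp: P_def strict_prefix_def)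
  then have "(x @ m, l, x @ z) \<in> st_edges T"
    using m l assms by (auto simp: st_edges_iff P_def)
  then show ?thesis
    using l that by blast
qed

lemma st_parent_unique:
  assumes "(x, l, y) \<in> st_edges T" "(x', l', y) \<in> st_edges T"
  shows "x = x' \<and> l = l'"
proof -
  have *: False if "(x, l, y) \<in> st_edges T" "(x', l', y) \<in> st_edges T" "strict_prefix x x'"
    for x l x' l'
    using that by (auto simp: st_edges_def strict_prefix_def)
  have "prefix x y"
    using assms(1) by (auto simp: st_edges_iff)
  moreover have "prefix x' y"
    using assms(2) by (auto simp: st_edges_iff)
  ultimately have "prefix x x' \<or> prefix x' x"
    by (rule prefix_same_cases)
  then have "x = x'"
    using *[OF assms] *[OF assms(2,1)] by (auto simp: strict_prefix_def)
  then show ?thesis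
    using assms by (auto simp: st_edges_iff)
qed

text \<open>A subtree isomorphism is only required to respect edges; through this equivalence it
  also respects leaves, that is, suffixes of \<open>T\<close>.\<close>

lemma leaf_iff_no_edge:
  assumes "x \<in> st_nodes T"
  shows "[] \<in> rx x \<longleftrightarrow> (\<nexists>l y. (x, l, y) \<in> st_edges T)"
proof
  assume leaf: "[] \<in> rx x"
  show "\<nexists>l y. (x, l, y) \<in> st_edges T"
  proof clarify
    fix l y assume e: "(x, l, y) \<in> st_edges T"
    then obtain z where "z \<in> rx (x @ l)"
      using rx_nonempty by (fastforce simp: st_edges_iff)
    then have "l @ z \<in> rx x"
      by (simp add: rx_append)
    then show False
      using rx_leaf[OF leaf] e by (auto simp: st_edges_iff)
  qed
next
  assume no: "\<nexists>l y. (x, l, y) \<in> st_edges T"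
  obtain z where "z \<in> rx x"
    using rx_nonempty assms by blast
  then show "[] \<in> rx x"
    using no st_edge_exists[OF assms] by metis
qed

section \<open>Isomorphic subtrees are equal right contexts\<close>

lemma st_iso_imp_rx_eq:
  assumes "(x, y) \<in> st_iso T"
  shows "rx x = rx y"
proof -
  from assms obtain f where x: "x \<in> st_nodes T" and y: "y \<in> st_nodes T"
    and bij: "bij_betw f (st_subtree T x) (st_subtree T y)" and fx: "f x = y"
    and f: "\<And>u v l. u \<in> st_subtree T x \<Longrightarrow> v \<in> st_subtree T x \<Longrightarrow>
      (u, l, v) \<in> st_edges T \<longleftrightarrow> (f u, l, f v) \<in> st_edges T"
    unfolding st_iso_def by blast
  \<comment> \<open>Every node below \<open>x\<close> is reached by a labelled path, which
    \<open>f\<close> must copy edge by edge. So \<open>f\<close> can only exchange the prefix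
    \<open>x\<close> for \<open>y\<close>.\<close>
  have f_eq: "f (x @ z) = y @ z" if "x @ z \<in> st_nodes T" for z
    using that
  proof (induction z rule: length_induct)
    case (1 z)
    show ?case
    proof (cases "z = []")
      case False
      obtain z' l where z': "z = z' @ l" and e: "(x @ z', l, x @ z) \<in> st_edges T"
        using st_parent_exists[OF x "1.prems" False] .
      have n: "x @ z' \<in> st_nodes T" "l \<noteq> []"
        using e by (auto simp: st_edges_iff)
      then have "f (x @ z') = y @ z'"
        using 1 z' by auto
      moreover have "(f (x @ z'), l, f (x @ z)) \<in> st_edges T"
        using f[of "x @ z'" "x @ z" l] e n "1.prems" by (auto simp: st_subtree_def)
      ultimately show ?thesis
        using z' by (auto simp: st_edges_iff)
    qed (simp add: fx)
  qed
  have nodes: "x @ z \<in> st_nodes T \<longleftrightarrow> y @ z \<in> st_nodes T" for z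
  proof
    assume "x @ z \<in> st_nodes T"
    then have "f (x @ z) \<in> st_subtree T y"
      using bij_betwE[OF bij] by (auto simp: st_subtree_def)
    then show "y @ z \<in> st_nodes T"
      using f_eq \<open>x @ z \<in> st_nodes T\<close> by (auto simp: st_subtree_def)
  next
    assume "y @ z \<in> st_nodes T"
    then have "y @ z \<in> f ` st_subtree T x"
      using bij by (auto simp: st_subtree_def bij_betw_def)
    then obtain v where v: "f (x @ v) = y @ z" "x @ v \<in> st_nodes T"
      by (auto simp: st_subtree_def prefix_def)
    then show "x @ z \<in> st_nodes T"
      using f_eq[of v] by auto
  qed
  have edge: "(x @ z, l, x @ z @ l) \<in> st_edges T \<longleftrightarrow> (y @ z, l, y @ z @ l) \<in> st_edges T" for z l
    using nodes by (auto simp: st_edges_iff)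
  have "z \<in> rx x \<longleftrightarrow> z \<in> rx y" if "x @ z \<in> st_nodes T" for z
  proof -
    have "(\<exists>l v. (x @ z, l, v) \<in> st_edges T) \<longleftrightarrow> (\<exists>l v. (y @ z, l, v) \<in> st_edges T)"
      using edge[of z] by (simp add: st_edges_iff)
    then have "[] \<in> rx (x @ z) \<longleftrightarrow> [] \<in> rx (y @ z)"
      using that nodes by (simp add: leaf_iff_no_edge)
    then show ?thesis
      by (simp add: rx_append)
  qed
  then show ?thesis
    using leaf_node[of _ x] leaf_node[of _ y] nodes by (intro set_eqI) auto
qed

lemma rx_eq_imp_st_iso:
  assumes x: "x \<in> st_nodes T" and y: "y \<in> st_nodes T" and eq: "rx x = rx y"
  shows "(x, y) \<in> st_iso T"
proof -
  define f where "f u = y @ drop (length x) u" for u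
  have nodes: "x @ z \<in> st_nodes T \<longleftrightarrow> y @ z \<in> st_nodes T" for z
    using eq by (intro st_nodes_cong) (auto simp: rx_append)
  have "bij_betw f (st_subtree T x) (st_subtree T y)"
    by (rule bij_betw_byWitness[where f' = "\<lambda>u. x @ drop (length y) u"])
      (auto simp: st_subtree_def f_def prefix_def nodes)
  moreover have "(u, l, v) \<in> st_edges T \<longleftrightarrow> (f u, l, f v) \<in> st_edges T"
    if "u \<in> st_subtree T x" "v \<in> st_subtree T x" for u v l
    using that nodes by (auto simp: st_subtree_def f_def prefix_def st_edges_iff)
  ultimately show ?thesis
    using x y unfolding st_iso_def by (auto intro!: exI[of _ f] simp: f_def)
qed

lemma st_iso_iff: "(x, y) \<in> st_iso T \<longleftrightarrow> x \<in> st_nodes T \<and> y \<in> st_nodes T \<and> rx x = rx y"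
proof -
  have "x \<in> st_nodes T \<and> y \<in> st_nodes T" if "(x, y) \<in> st_iso T"
    using that by (simp add: st_iso_def)
  then show ?thesis
    using st_iso_imp_rx_eq rx_eq_imp_st_iso by blast
qed

section \<open>Nodes and edges of the CDAWG as classes\<close>

lemma cdawg_nodes_iff: "U \<in> cdawg_nodes T \<longleftrightarrow> (\<exists>x \<in> st_nodes T. U = st_iso T `` {x})"
  by (auto simp: cdawg_nodes_def quotient_def)

lemma st_iso_class: "x \<in> st_nodes T \<Longrightarrow> st_iso T `` {x} \<in> cdawg_nodes T"
  by (auto simp: cdawg_nodes_iff)

lemma in_st_iso_class: "x \<in> st_nodes T \<Longrightarrow> x \<in> st_iso T `` {x}"
  by (auto simp: st_iso_iff)

lemma cdawg_node_subset: "U \<in> cdawg_nodes T \<Longrightarrow> x \<in> U \<Longrightarrow> x \<in> st_nodes T"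
  by (auto simp: cdawg_nodes_iff st_iso_iff)

lemma cdawg_node_finite: "U \<in> cdawg_nodes T \<Longrightarrow> finite U"
  using cdawg_node_subset st_nodes_finite by (meson finite_subset subsetI)

lemma cdawg_node_nonempty: "U \<in> cdawg_nodes T \<Longrightarrow> U \<noteq> {}"
  by (auto simp: cdawg_nodes_iff st_iso_iff)

lemma cdawg_node_mem: "U \<in> cdawg_nodes T \<Longrightarrow> x \<in> U \<Longrightarrow> y \<in> U \<longleftrightarrow> rx y = rx x"
  using st_nodes_cong[of x y] by (auto simp: cdawg_nodes_iff st_iso_iff)

lemma cdawg_node_eq:
  "U \<in> cdawg_nodes T \<Longrightarrow> V \<in> cdawg_nodes T \<Longrightarrow> x \<in> U \<Longrightarrow> x \<in> V \<Longrightarrow> U = V"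
  by (rule set_eqI) (simp add: cdawg_node_mem[of U x] cdawg_node_mem[of V x])

lemma cdawg_node_rx: "U \<in> cdawg_nodes T \<Longrightarrow> x \<in> U \<Longrightarrow> y \<in> U \<Longrightarrow> rx x = rx y"
  using cdawg_node_mem[of U x y] by simp

lemma cdawg_node_memI: "U \<in> cdawg_nodes T \<Longrightarrow> x \<in> U \<Longrightarrow> rx y = rx x \<Longrightarrow> y \<in> U"
  using cdawg_node_mem[of U x y] by simp

lemma cdawg_nodes_finite: "finite (cdawg_nodes T)"
proof -
  have "cdawg_nodes T = (\<lambda>x. st_iso T `` {x}) ` st_nodes T"
    by (auto simp: cdawg_nodes_iff)
  then show ?thesis
    by (simp add: st_nodes_finite)
qed

text \<open>A common right context completes both strings to suffixes of the same text, and these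
  are comparable.\<close>

lemma cdawg_node_suffix:
  assumes "U \<in> cdawg_nodes T" "x \<in> U" "y \<in> U" "length x \<le> length y"
  shows "suffix x y"
proof -
  have eq: "rx x = rx y"
    by (rule cdawg_node_rx[OF assms(1-3)])
  obtain z where "z \<in> rx x"
    using assms cdawg_node_subset rx_nonempty by blast
  then have "suffix (x @ z) T" "suffix (y @ z) T"
    using eq by (auto simp: right_contexts_def)
  then have "suffix (x @ z) (y @ z)"
    by (rule suffix_length_suffix) (simp add: assms(4))
  then show ?thesis
    by (auto simp: suffix_def)
qed

text \<open>Extending a string on the left can only lose right contexts, so equality at both ends of
  the interval forces equality in between.\<close>

lemma cdawg_node_between:
  assumes "U \<in> cdawg_nodes T" "x \<in> U" "y \<in> U" "suffix x u" "suffix u y"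
  shows "u \<in> U"
proof (cases "x = []")
  \<comment> \<open>For empty \<open>x\<close> the monotonicity can fail at the right context
    \<open>[]\<close>; but then the node is the root and holds no other string.\<close>
  case True
  then have "rx y = rx []"
    using cdawg_node_rx[OF assms(1,3,2)] by simp
  then have "y = []"
    by (rule rx_eqI_Nil)
  then show ?thesis
    using assms by (simp add: suffix_def)
next
  case False
  have eq: "rx x = rx y"
    by (rule cdawg_node_rx[OF assms(1-3)])
  have "rx y \<subseteq> rx u" "rx u \<subseteq> rx x"
    using assms(4,5) False by (auto simp: right_contexts_def suffix_def)
  then show ?thesis
    using eq by (intro cdawg_node_memI[OF assms(1,2)]) simp
qed

text \<open>Edges of the suffix tree depend on right contexts only, so the edge that one member of
  the class has is shared by all members.\<close>

lemma cdawg_edgeD: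
  assumes "(U, l, V) \<in> cdawg_edges T" "u \<in> U"
  shows "(u, l, u @ l) \<in> st_edges T" "u @ l \<in> V"
proof -
  from assms(1) obtain u' v where U: "U \<in> cdawg_nodes T" "V \<in> cdawg_nodes T"
    and u': "u' \<in> U" "v \<in> V" "(u', l, v) \<in> st_edges T"
    by (auto simp: cdawg_edges_def)
  have v: "v = u' @ l"
    using u' by (auto simp: st_edges_iff)
  have eq: "rx u = rx u'"
    by (rule cdawg_node_rx[OF U(1) assms(2) u'(1)])
  show "(u, l, u @ l) \<in> st_edges T"
    using st_edges_cong[OF eq] u' v by simp
  have "rx (u @ l) = rx (u' @ l)"
    using eq by (auto simp: rx_append)
  then show "u @ l \<in> V"
    using v by (intro cdawg_node_memI[OF U(2) u'(2)]) simp
qed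

lemma cdawg_edgeI:
  assumes "U \<in> cdawg_nodes T" "u \<in> U" "(u, l, v) \<in> st_edges T"
  shows "(U, l, st_iso T `` {v}) \<in> cdawg_edges T"
proof -
  have "v \<in> st_nodes T"
    using assms(3) by (auto simp: st_edges_iff)
  then show ?thesis
    using assms in_st_iso_class st_iso_class by (auto simp: cdawg_edges_def)
qed

lemma cdawg_edge_nodes:
  "(U, l, V) \<in> cdawg_edges T \<Longrightarrow> U \<in> cdawg_nodes T \<and> V \<in> cdawg_nodes T \<and> l \<noteq> []"
  by (auto simp: cdawg_edges_def st_edges_iff)

lemma cdawg_edge_det:
  assumes "(U, l, V) \<in> cdawg_edges T" "(U, l', V') \<in> cdawg_edges T" "hd l = hd l'"
  shows "l = l' \<and> V = V'"
proof -
  obtain u where u: "u \<in> U"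
    using assms cdawg_edge_nodes cdawg_node_nonempty by blast
  have "l = l'"
    using st_edge_unique cdawg_edgeD(1)[OF assms(1) u] cdawg_edgeD(1)[OF assms(2) u] assms(3) by blast
  then show ?thesis
    using cdawg_edgeD(2)[OF assms(1) u] cdawg_edgeD(2)[OF assms(2) u] assms
      cdawg_node_eq cdawg_edge_nodes by metis
qed

lemma cdawg_edge_into:
  assumes "V \<in> cdawg_nodes T" "v \<in> V" "v \<noteq> []"
  obtains U u l where "(U, l, V) \<in> cdawg_edges T" "u \<in> U" "v = u @ l"
proof -
  have "[] @ v \<in> st_nodes T"
    using assms cdawg_node_subset by simp
  then obtain u' l where "([] @ u', l, [] @ v) \<in> st_edges T"
    using st_parent_exists[OF Nil_node _ assms(3)] by blast
  then obtain u where u: "(u, l, v) \<in> st_edges T"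
    by simp
  then have un: "u \<in> st_nodes T" "v = u @ l" "v \<in> st_nodes T"
    by (auto simp: st_edges_iff)
  have "st_iso T `` {v} = V"
    using un assms cdawg_node_eq st_iso_class in_st_iso_class by metis
  then have "(st_iso T `` {u}, l, V) \<in> cdawg_edges T"
    using cdawg_edgeI[OF st_iso_class in_st_iso_class u] un by auto
  then show ?thesis
    using that un in_st_iso_class by blast
qed

text \<open>A string has one parent in the suffix tree. Hence the blocks of strings that the
  entering edges contribute to a node are disjoint.\<close>

lemma cdawg_edge_source_unique:
  assumes "(U, l, V) \<in> cdawg_edges T" "(U', l', V') \<in> cdawg_edges T" "u \<in> U" "u' \<in> U'"
    "u @ l = u' @ l'"
  shows "U = U' \<and> l = l' \<and> u = u'"
proof -
  have "u = u' \<and> l = l'"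
    using st_parent_unique cdawg_edgeD(1)[OF assms(1,3)] cdawg_edgeD(1)[OF assms(2,4)] assms(5) by metis
  then show ?thesis
    using assms cdawg_node_eq cdawg_edge_nodes by metis
qed

text \<open>Symbols prepended to \<open>u @ l\<close> are prepended to \<open>u\<close>, so the
  interval of strings of the source is carried over to an interval in the target.\<close>

lemma cdawg_edge_between:
  assumes e: "(U, l, V) \<in> cdawg_edges T" and "u \<in> U" "u' \<in> U" "suffix (u @ l) v" "suffix v (u' @ l)"
  obtains u'' where "u'' \<in> U" "v = u'' @ l"
proof -
  obtain q where q: "v = q @ u @ l"
    using assms(4) by (auto simp: suffix_def)
  then have "suffix (q @ u) u'"
    using assms(5) by (auto simp: suffix_def)
  then have "q @ u \<in> U"
    using assms cdawg_edge_nodes cdawg_node_between[of U u u' "q @ u"] by (auto simp: suffix_def)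
  then show ?thesis
    using q that by auto
qed

lemma cdawg_edges_finite: "finite (cdawg_edges T)"
proof (rule finite_subset)
  show "cdawg_edges T \<subseteq> cdawg_nodes T \<times> (\<lambda>(u, v). drop (length u) v) ` (st_nodes T \<times> st_nodes T) \<times> cdawg_nodes T"
    by (force simp: cdawg_edges_def st_edges_iff image_iff)
  show "finite (cdawg_nodes T \<times> (\<lambda>(u, v). drop (length u) v) ` (st_nodes T \<times> st_nodes T) \<times> cdawg_nodes T)"
    using cdawg_nodes_finite st_nodes_finite by auto
qed

end

section \<open>The BWT below the longest string of a node\<close>

definition leaves :: "str \<Rightarrow> str \<Rightarrow> str list" where
  "leaves T x = sorted_list_of_set {s. s \<noteq> [] \<and> suffix s T \<and> prefix x s}"

text \<open>Suffixes are handled as strings from here on; the starting position is recovered from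
  the length.\<close>

definition preceding :: "str \<Rightarrow> str \<Rightarrow> nat" where
  "preceding T s = (if s = T then last T else T ! (length T - length s - 1))"

definition longest :: "str set \<Rightarrow> str" where
  "longest U = (SOME x. x \<in> U \<and> (\<forall>y \<in> U. length y \<le> length x))"

definition shortest :: "str set \<Rightarrow> str" where
  "shortest U = (SOME x. x \<in> U \<and> (\<forall>y \<in> U. length x \<le> length y))"

lemma shortest:
  assumes "U \<noteq> {}"
  shows "shortest U \<in> U" "y \<in> U \<Longrightarrow> length (shortest U) \<le> length y"
proof -
  obtain x where "x \<in> U"
    using assms by blast
  then have "\<exists>x. x \<in> U \<and> (\<forall>y \<in> U. length x \<le> length y)"
    using ex_has_least_nat[of "\<lambda>x. x \<in> U" x length] by blast
  from someI_ex[OF this] show "shortest U \<in> U" "y \<in> U \<Longrightarrow> length (shortest U) \<le> length y"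
    unfolding shortest_def by blast+
qed

lemma longest:
  assumes "finite U" "U \<noteq> {}"
  shows "longest U \<in> U" "y \<in> U \<Longrightarrow> length y \<le> length (longest U)"
    and length_longest: "node_length U = length (longest U)"
proof -
  have "Max (length ` U) \<in> length ` U"
    using assms by (intro Max_in) auto
  then obtain x where "x \<in> U" "length x = Max (length ` U)"
    by auto
  then have "x \<in> U \<and> (\<forall>y \<in> U. length y \<le> length x)"
    using assms by auto
  from someI[of "\<lambda>x. x \<in> U \<and> (\<forall>y \<in> U. length y \<le> length x)", OF this]
  have *: "longest U \<in> U \<and> (\<forall>y \<in> U. length y \<le> length (longest U))"
    unfolding longest_def .
  then show "longest U \<in> U" "y \<in> U \<Longrightarrow> length y \<le> length (longest U)"
    by auto
  show "node_length U = length (longest U)"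
    unfolding node_length_def using * assms(1) by (intro Max_eqI) auto
qed

lemma finite_suffixes: "finite {s. s \<noteq> [] \<and> suffix s T \<and> P s}"
  by (rule finite_subset[of _ "set (suffixes T)"]) auto

lemma set_leaves: "set (leaves T x) = {s. s \<noteq> [] \<and> suffix s T \<and> prefix x s}"
  by (simp add: leaves_def finite_suffixes)

lemma strict_sorted_leaves: "sorted_wrt (<) (leaves T x)"
  by (simp add: leaves_def)

lemma strict_sorted_concat:
  fixes f :: "'b \<Rightarrow> 'a :: linorder list"
  assumes "\<And>x. x \<in> set xs \<Longrightarrow> sorted_wrt (<) (f x)"
    and "sorted_wrt (\<lambda>x y. \<forall>s \<in> set (f x). \<forall>t \<in> set (f y). s < t) xs"
  shows "sorted_wrt (<) (concat (map f xs))"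
  using assms by (induction xs) (auto simp: sorted_wrt_append)

lemma same_prefix_less: "x @ s < x @ (t :: nat list) \<longleftrightarrow> s < t"
  by (induction x) auto

text \<open>Different starting positions give suffixes of different lengths. So the sort keys are
  distinct, and sorting the positions amounts to listing the set of suffixes in order.\<close>

lemma suffix_array_leaves: "map (\<lambda>p. drop p T) (suffix_array T) = leaves T []"
proof -
  let ?S = "map (\<lambda>p. drop p T) (suffix_array T)"
  have "sorted ?S"
    by (simp add: suffix_array_def)
  moreover have "inj_on (\<lambda>p. drop p T) {0..<length T}"
  proof (rule inj_onI)
    fix p q assume pq: "p \<in> {0..<length T}" "q \<in> {0..<length T}" "drop p T = drop q T"
    then have "length T - p = length T - q"
      by (metis length_drop)
    then show "p = q"
      using pq by auto
  qed
  then have "distinct ?S"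
    by (simp add: suffix_array_def distinct_map)
  moreover have "set ?S = {s. s \<noteq> [] \<and> suffix s T \<and> prefix [] s}"
  proof safe
    fix s assume s: "s \<noteq> []" "suffix s T"
    then obtain p where p: "T = p @ s"
      by (auto simp: suffix_def)
    show "s \<in> set ?S"
      using s p by (auto simp: suffix_array_def image_iff intro!: bexI[of _ "length p"])
  qed (auto simp: suffix_array_def suffix_drop)
  ultimately show ?thesis
    using sorted_list_of_set.idem_if_sorted_distinct[of ?S] by (simp add: leaves_def)
qed

lemma bwt_leaves: "bwt T = map (preceding T) (leaves T [])"
proof -
  have "preceding T (drop p T) = (if p = 0 then last T else T ! (p - 1))" if "p < length T" for p
  proof -
    have "length (drop p T) \<noteq> length T" if "p > 0"
      using that \<open>p < length T\<close> by simp
    then have "drop p T \<noteq> T" if "p > 0"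
      using that by metis
    then show ?thesis
      using that by (auto simp: preceding_def)
  qed
  moreover have "p \<in> set (suffix_array T) \<Longrightarrow> p < length T" for p
    by (simp add: suffix_array_def)
  ultimately show ?thesis
    unfolding suffix_array_leaves[symmetric] bwt_def by simp
qed

context terminated_text
begin

lemma leaves_eq_rx: "set (leaves T x) = (@) x ` rx x"
  by (auto simp: set_leaves right_contexts_def prefix_def image_iff)

lemma length_leaves: "length (leaves T x) = card (rx x)"
proof -
  have "distinct (leaves T x)"
    by (simp add: leaves_def)
  then have "length (leaves T x) = card (set (leaves T x))"
    by (simp add: distinct_card)
  also have "\<dots> = card (rx x)"
    unfolding leaves_eq_rx by (rule card_image) (simp add: inj_on_def)
  finally show ?thesis .
qed

lemma leaves_leaf:
  assumes "[] \<in> rx x"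
  shows "leaves T x = [x]"
proof -
  have "rx x = {[]}"
    using assms rx_leaf by blast
  then have "{s. s \<noteq> [] \<and> suffix s T \<and> prefix x s} = {x}"
    using leaves_eq_rx[of x] by (simp add: set_leaves)
  then show ?thesis
    by (simp add: leaves_def)
qed

text \<open>Suffixes below two different children first differ at the first symbols of the two
  labels, so the order of these symbols decides.\<close>

lemma leaves_children:
  assumes x: "x \<in> st_nodes T" "[] \<notin> rx x"
    and sorted: "sorted_wrt (\<lambda>l l'. hd l < hd l') ls"
    and ls: "set ls = {l. (x, l, x @ l) \<in> st_edges T}"
  shows "leaves T x = concat (map (\<lambda>l. leaves T (x @ l)) ls)"
proof (rule strict_sorted_equal[OF strict_sorted_leaves, symmetric])
  show "sorted_wrt (<) (concat (map (\<lambda>l. leaves T (x @ l)) ls))"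
  proof (rule strict_sorted_concat[OF strict_sorted_leaves])
    show "sorted_wrt (\<lambda>l l'. \<forall>s \<in> set (leaves T (x @ l)). \<forall>t \<in> set (leaves T (x @ l')). s < t) ls"
    proof (rule sorted_wrt_mono_rel[OF _ sorted], intro ballI)
      fix l l' s t
      assume l: "l \<in> set ls" "l' \<in> set ls" "hd l < hd l'"
        and "s \<in> set (leaves T (x @ l))" "t \<in> set (leaves T (x @ l'))"
      then obtain u v where st: "s = x @ l @ u" "t = x @ l' @ v"
        by (auto simp: leaves_eq_rx)
      have "l \<noteq> []" "l' \<noteq> []"
        using l ls by (auto simp: st_edges_iff)
      then show "s < t"
        using st l(3) by (cases l; cases l') (auto simp: same_prefix_less)
    qed
  qed
  show "set (concat (map (\<lambda>l. leaves T (x @ l)) ls)) = set (leaves T x)"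
  proof (intro set_eqI iffI)
    fix s assume "s \<in> set (leaves T x)"
    then obtain z where z: "s = x @ z" "z \<in> rx x"
      by (auto simp: leaves_eq_rx)
    then have "z \<noteq> []"
      using x by auto
    then obtain l where l: "(x, l, x @ l) \<in> st_edges T" "prefix l z"
      using st_edge_exists x z by metis
    then obtain z' where "z = l @ z'"
      by (auto simp: prefix_def)
    then have "s \<in> set (leaves T (x @ l))"
      using z by (auto simp: leaves_eq_rx rx_append)
    then show "s \<in> set (concat (map (\<lambda>l. leaves T (x @ l)) ls))"
      using l ls by auto
  qed (auto simp: leaves_eq_rx rx_append)
qed

text \<open>Equality of the right contexts means that every occurrence of \<open>x\<close> in
  \<open>T\<close> is the tail of an occurrence of \<open>a # x\<close>.\<close>

lemma preceding_unique:
  assumes "rx (a # x) = rx x" "s \<in> set (leaves T x)"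
  shows "preceding T s = a"
proof -
  obtain z where z: "s = x @ z" "z \<in> rx x"
    using assms by (auto simp: leaves_eq_rx)
  then have "z \<in> rx (a # x)"
    using assms by simp
  then obtain p where "T = p @ a # s"
    using z by (auto simp: right_contexts_def suffix_def)
  then show ?thesis
    by (auto simp: preceding_def nth_append)
qed

section \<open>Entering edges as intervals of lengths\<close>

lemma longest_props:
  assumes "U \<in> cdawg_nodes T"
  shows longest_in: "longest U \<in> U" and longest_max: "y \<in> U \<Longrightarrow> length y \<le> length (longest U)"
    and node_length_longest: "node_length U = length (longest U)"
    and longest_suffix: "y \<in> U \<Longrightarrow> suffix y (longest U)"
  using longest[OF cdawg_node_finite[OF assms] cdawg_node_nonempty[OF assms]]
    length_longest[OF cdawg_node_finite[OF assms] cdawg_node_nonempty[OF assms]]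
    cdawg_node_suffix[OF assms] by blast+

lemma shortest_props:
  assumes "U \<in> cdawg_nodes T"
  shows shortest_in: "shortest U \<in> U" and shortest_min: "y \<in> U \<Longrightarrow> length (shortest U) \<le> length y"
    and shortest_suffix: "y \<in> U \<Longrightarrow> suffix (shortest U) y"
  using shortest[OF cdawg_node_nonempty[OF assms]] cdawg_node_suffix[OF assms] by blast+

text \<open>The strings of a node are nested suffixes, so length alone tells whether a string lies
  in the block of an edge.\<close>

lemma cdawg_edge_interval:
  assumes e: "(U, l, V) \<in> cdawg_edges T" and v: "v \<in> V"
    and "length (shortest U @ l) \<le> length v" "length v \<le> length (longest U @ l)"
  obtains u where "u \<in> U" "v = u @ l"
proof -
  have U: "U \<in> cdawg_nodes T" "V \<in> cdawg_nodes T"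
    using cdawg_edge_nodes[OF e] by auto
  have "shortest U @ l \<in> V" "longest U @ l \<in> V"
    using cdawg_edgeD(2)[OF e] U longest_in shortest_in by auto
  then have "suffix (shortest U @ l) v" "suffix v (longest U @ l)"
    using cdawg_node_suffix[OF U(2)] assms by auto
  then show ?thesis
    using cdawg_edge_between[OF e shortest_in[OF U(1)] longest_in[OF U(1)]] that by blast
qed

text \<open>Strings of one node with equal length coincide, and a string has one parent. This allows
  the strict order demanded of \<open>ins\<close>, and hence an index for every text.\<close>

lemma cdawg_in_edge_length_inj:
  assumes "(U, l, V) \<in> cdawg_edges T" "(U', l', V) \<in> cdawg_edges T"
    "length (longest U @ l) = length (longest U' @ l')"
  shows "U = U' \<and> l = l'"
proof -
  have U: "U \<in> cdawg_nodes T" "U' \<in> cdawg_nodes T" "V \<in> cdawg_nodes T"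
    using cdawg_edge_nodes assms by auto
  have V: "longest U @ l \<in> V" "longest U' @ l' \<in> V"
    using cdawg_edgeD(2) assms U longest_in by auto
  have "longest U @ l = longest U' @ l'"
    using cdawg_node_suffix[OF U(3) V] cdawg_node_suffix[OF U(3) V(2,1)] assms(3)
    by (intro suffix_order.antisym) simp_all
  then show ?thesis
    using cdawg_edge_source_unique[OF assms(1,2)] U longest_in by blast
qed

text \<open>The longest string of \<open>V\<close> enters through some edge, and no edge contributes
  a longer string than \<open>longest U @ l\<close>.\<close>

lemma longest_first_edge:
  assumes e: "(U, l, V) \<in> cdawg_edges T"
    and max: "\<And>U' l'. (U', l', V) \<in> cdawg_edges T \<Longrightarrow> length (longest U' @ l') \<le> length (longest U @ l)"
  shows "longest V = longest U @ l"
proof -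
  have U: "U \<in> cdawg_nodes T" "V \<in> cdawg_nodes T" "l \<noteq> []"
    using cdawg_edge_nodes[OF e] by auto
  have in_V: "longest U @ l \<in> V"
    using cdawg_edgeD(2)[OF e] U longest_in by auto
  then have "longest V \<noteq> []"
    using longest_max[OF U(2) in_V] U(3) by auto
  then obtain U' u' l' where e': "(U', l', V) \<in> cdawg_edges T" "u' \<in> U'" "longest V = u' @ l'"
    using cdawg_edge_into[OF U(2) longest_in[OF U(2)]] by blast
  have "length (longest V) \<le> length (longest U' @ l')"
    using e' longest_max cdawg_edge_nodes by auto
  also have "\<dots> \<le> length (longest U @ l)"
    by (rule max[OF e'(1)])
  finally have "suffix (longest V) (longest U @ l)"
    using cdawg_node_suffix[OF U(2) longest_in[OF U(2)] in_V] by simp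
  then show ?thesis
    using longest_suffix[OF U(2) in_V] by (rule suffix_order.antisym)
qed

text \<open>The shortest string of \<open>V\<close> enters through some edge
  \<open>(U', l', V)\<close>. The block of that edge reaches up at least to the length of
  \<open>longest U @ l\<close>, so it contains this string and the two edges coincide.\<close>

lemma shortest_last_edge:
  assumes e: "(U, l, V) \<in> cdawg_edges T"
    and min: "\<And>U' l'. (U', l', V) \<in> cdawg_edges T \<Longrightarrow> length (longest U @ l) \<le> length (longest U' @ l')"
  shows "shortest V = shortest U @ l"
proof -
  have U: "U \<in> cdawg_nodes T" "V \<in> cdawg_nodes T" "l \<noteq> []"
    using cdawg_edge_nodes[OF e] by auto
  have in_V: "u @ l \<in> V" if "u \<in> U" for u
    using cdawg_edgeD(2)[OF e that] .
  have "shortest V \<noteq> []"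
  proof
    assume "shortest V = []"
    then have "rx (longest U @ l) = rx []"
      using cdawg_node_rx[OF U(2) in_V[OF longest_in[OF U(1)]] shortest_in[OF U(2)]] by simp
    then show False
      using rx_eqI_Nil U(3) by blast
  qed
  then obtain U' u' l' where e': "(U', l', V) \<in> cdawg_edges T" "u' \<in> U'" "shortest V = u' @ l'"
    using cdawg_edge_into[OF U(2) shortest_in[OF U(2)]] by blast
  have U': "U' \<in> cdawg_nodes T"
    using cdawg_edge_nodes[OF e'(1)] by auto
  have "length (shortest U' @ l') \<le> length (shortest V)"
    using shortest_min[OF U' e'(2)] e'(3) by simp
  also have "length (shortest V) \<le> length (longest U @ l)"
    by (rule shortest_min[OF U(2) in_V[OF longest_in[OF U(1)]]])
  finally obtain u'' where "u'' \<in> U'" "longest U @ l = u'' @ l'"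
    using cdawg_edge_interval[OF e'(1) in_V[OF longest_in[OF U(1)]]] min[OF e'(1)] by blast
  then have eq: "U = U'" "l = l'"
    using cdawg_edge_source_unique[OF e e'(1) longest_in[OF U(1)]] by auto
  have "length (shortest U @ l) \<le> length (shortest V)"
    using shortest_min[OF U(1)] e' eq by simp
  then have "suffix (shortest U @ l) (shortest V)"
    using cdawg_node_suffix[OF U(2) in_V[OF shortest_in[OF U(1)]] shortest_in[OF U(2)]] by simp
  then show ?thesis
    using shortest_suffix[OF U(2) in_V[OF shortest_in[OF U(1)]]] suffix_order.antisym by blast
qed

text \<open>Prepend to \<open>x = longest U @ l\<close> the symbol \<open>a\<close> that precedes it
  in the longer string. The result stays in \<open>V\<close>, but enters through another edge
  \<open>(W, m, V)\<close>, as \<open>x\<close> is the longest of its own block. The block of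
  \<open>(W, m, V)\<close> reaches above \<open>x\<close>, so by adjacency it contains
  \<open>longest U' @ l'\<close> and its edge is \<open>(U', l', V)\<close>. A string of that block
  shorter than \<open>a # x\<close> would pull \<open>x\<close> into it as well.\<close>

lemma shortest_preceding_edge:
  assumes e: "(U, l, V) \<in> cdawg_edges T" and e': "(U', l', V) \<in> cdawg_edges T"
    and less: "length (longest U @ l) < length (longest U' @ l')"
    and adj: "\<And>W m. (W, m, V) \<in> cdawg_edges T \<Longrightarrow> length (longest U @ l) < length (longest W @ m) \<Longrightarrow>
      length (longest U' @ l') \<le> length (longest W @ m)"
  obtains a where "shortest U' @ l' = a # longest U @ l"
proof -
  let ?x = "longest U @ l" and ?y = "longest U' @ l'"
  have U: "U \<in> cdawg_nodes T" "U' \<in> cdawg_nodes T" "V \<in> cdawg_nodes T"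
    using cdawg_edge_nodes e e' by auto
  have x: "?x \<in> V" and y: "?y \<in> V"
    using cdawg_edgeD(2) e e' U longest_in by auto
  have "suffix ?x ?y"
    using cdawg_node_suffix[OF U(3) x y] less by simp
  then obtain q where y_eq: "?y = q @ ?x"
    by (auto simp: suffix_def)
  then have "q \<noteq> []"
    using less by (metis append_Nil less_irrefl)
  note q = y_eq this
  define a where "a = last q"
  have qa: "?y = butlast q @ a # ?x"
    using q by (simp add: a_def)
  then have ax: "a # ?x \<in> V"
    by (intro cdawg_node_between[OF U(3) x y]) (auto simp: suffix_def)
  then obtain W w m where W: "(W, m, V) \<in> cdawg_edges T" "w \<in> W" "a # ?x = w @ m"
    by (rule cdawg_edge_into[OF U(3)]) auto
  have Wn: "W \<in> cdawg_nodes T"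
    using cdawg_edge_nodes[OF W(1)] by simp
  have "length (w @ m) \<le> length (longest W @ m)"
    using longest_max[OF Wn W(2)] by simp
  then have lW: "length ?x < length (longest W @ m)"
    using W(3)[symmetric] by simp
  have "length (shortest W @ m) \<le> length (w @ m)"
    using shortest_min[OF Wn W(2)] by simp
  also have "length (w @ m) \<le> length ?y"
    unfolding W(3)[symmetric] using less by simp
  finally obtain u where "u \<in> W" "?y = u @ m"
    using cdawg_edge_interval[OF W(1) y] adj[OF W(1) lW] by blast
  then have eq: "U' = W" "l' = m"
    using cdawg_edge_source_unique[OF e' W(1) longest_in[OF U(2)]] by auto
  have "w = shortest W"
  proof (rule ccontr)
    assume "w \<noteq> shortest W"
    then have "length (shortest W) < length w"
      using shortest_suffix[OF Wn W(2)] shortest_min[OF Wn W(2)] by (auto simp: suffix_def)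
    then have "length (shortest W @ m) \<le> length ?x"
      using arg_cong[OF W(3), of length] by simp
    then obtain u where "u \<in> W" "?x = u @ m"
      using cdawg_edge_interval[OF W(1) x] lW by (metis less_imp_le)
    then have "U = W \<and> l = m"
      using cdawg_edge_source_unique[OF e W(1) longest_in[OF U(1)]] by auto
    then show False
      using less eq by simp
  qed
  then show ?thesis
    using that[of a] W(3) eq by simp
qed

lemma longest_sink: "longest (cdawg_sink T) = T"
proof -
  have T: "T \<in> st_nodes T"
    using T_nonempty by (simp add: st_nodes_def)
  then have s: "cdawg_sink T \<in> cdawg_nodes T" "T \<in> cdawg_sink T"
    using st_iso_class in_st_iso_class by (auto simp: cdawg_sink_def)
  have "[] \<in> rx T"
    using T_nonempty by (simp add: Nil_in_rx)
  then have "[] \<in> rx (longest (cdawg_sink T))"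
    using cdawg_node_rx[OF s longest_in[OF s(1)]] by simp
  then have "suffix (longest (cdawg_sink T)) T"
    by (simp add: Nil_in_rx)
  then show ?thesis
    using longest_suffix[OF s] suffix_order.antisym by blast
qed

lemma root_class: "cdawg_root T = {[]}"
proof -
  have "x = []" if "x \<in> cdawg_root T" for x
    using that rx_eqI_Nil[of x] by (auto simp: cdawg_root_def st_iso_iff)
  moreover have "[] \<in> cdawg_root T"
    using in_st_iso_class[OF Nil_node] by (simp add: cdawg_root_def)
  ultimately show ?thesis
    by blast
qed

text \<open>All leaves have the right contexts \<open>{[]}\<close>, so they form a single class, the
  one of \<open>T\<close>.\<close>

lemma sink_iff: "U \<in> cdawg_nodes T \<Longrightarrow> x \<in> U \<Longrightarrow> [] \<in> rx x \<longleftrightarrow> U = cdawg_sink T"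
proof
  assume U: "U \<in> cdawg_nodes T" "x \<in> U"
  have T: "T \<in> st_nodes T" "[] \<in> rx T"
    using T_nonempty by (auto simp: st_nodes_def Nil_in_rx)
  have rxT: "rx T = {[]}"
    using rx_leaf T by blast
  have s: "cdawg_sink T \<in> cdawg_nodes T" "T \<in> cdawg_sink T"
    using st_iso_class[OF T(1)] in_st_iso_class[OF T(1)] by (auto simp: cdawg_sink_def)
  {
    assume "[] \<in> rx x"
    then have "rx x = rx T"
      using rx_leaf rxT by blast
    then have "x \<in> cdawg_sink T"
      by (rule cdawg_node_memI[OF s])
    then show "U = cdawg_sink T"
      using cdawg_node_eq U s by blast
  }
  {
    assume "U = cdawg_sink T"
    then show "[] \<in> rx x"
      using cdawg_node_rx[OF U s(2)[folded \<open>U = cdawg_sink T\<close>]] T by simp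
  }
qed

end

section \<open>The graph seen by the algorithm\<close>

text \<open>What the algorithm sees of the CDAWG: nodes and edges are numbered, \<open>oo\<close> and \<open>io\<close> are the two offset
  tables and \<open>ins\<close> lists the edges by target. The specification of the output consists of \<open>cnt k\<close>, the number
  of suffixes below node \<open>k\<close>, \<open>fsym k\<close>, the first symbol of the shortest string of \<open>k\<close>, and \<open>piece f\<close>,
  the part of the BWT that belongs to the suffixes starting with the longest string that ends with edge \<open>f\<close>.\<close>

locale edge_graph =
  fixes N E rt sk n fin :: nat
    and src hdf tgt oo io ins cnt fsym rank :: "nat \<Rightarrow> nat"
    and piece :: "nat \<Rightarrow> nat list"
  assumes rt: "rt < N" and sk: "sk < N" and rt_sk: "rt \<noteq> sk"
    and src: "f < E \<Longrightarrow> src f < N" and tgt: "f < E \<Longrightarrow> tgt f < N"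
    and oo_mono: "oo k \<le> oo (Suc k)" and oo_le: "oo k \<le> E"
    and oo_iff: "f < E \<Longrightarrow> src f = k \<longleftrightarrow> oo k \<le> f \<and> f < oo (Suc k)"
    and io_mono: "io k \<le> io (Suc k)" and io_le: "io k \<le> E"
    and io_iff: "p < E \<Longrightarrow> tgt (ins p) = k \<longleftrightarrow> io k \<le> p \<and> p < io (Suc k)"
    and ins_bij: "bij_betw ins {..<E} {..<E}"
    and rank: "f < E \<Longrightarrow> rank (src f) < rank (tgt f)"
    and out_edge: "k < N \<Longrightarrow> oo k < oo (Suc k) \<longleftrightarrow> k \<noteq> sk"
    and in_edge: "k < N \<Longrightarrow> io k < io (Suc k) \<longleftrightarrow> k \<noteq> rt"
    and cnt_sk: "cnt sk = 1"
    and cnt_sum: "k < N \<Longrightarrow> k \<noteq> sk \<Longrightarrow> cnt k = (\<Sum>f = oo k..<oo (Suc k). cnt (tgt f))"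
    and cnt_le: "cnt k \<le> n" and cnt_pos: "k < N \<Longrightarrow> 0 < cnt k"
    and fsym_last: "k < N \<Longrightarrow> k \<noteq> rt \<Longrightarrow> g = ins (io (Suc k) - 1) \<Longrightarrow>
      fsym k = (if src g = rt then hdf g else fsym (src g))"
    and piece_sink: "p < E \<Longrightarrow> tgt (ins p) = sk \<Longrightarrow> io sk = p \<Longrightarrow> piece (ins p) = [fin]"
    and piece_primary: "p < E \<Longrightarrow> tgt (ins p) = k \<Longrightarrow> k \<noteq> sk \<Longrightarrow> io k = p \<Longrightarrow>
      piece (ins p) = concat (map piece [oo k..<oo (Suc k)])"
    and piece_secondary: "p < E \<Longrightarrow> tgt (ins p) = k \<Longrightarrow> io k \<noteq> p \<Longrightarrow> g = ins (p - 1) \<Longrightarrow>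
      piece (ins p) = replicate (cnt k) (if src g = rt then hdf g else fsym (src g))"
    and fin: "fin = hdf (oo rt)"
    and length_le: "length (concat (map piece [oo rt..<oo (Suc rt)])) \<le> n"

text \<open>The entries with small keys form a prefix of a sorted list; its length is what an offset
  table stores.\<close>

lemma sorted_group:
  assumes "sorted_wrt (\<lambda>x y. (key x :: nat) \<le> key y) xs" "f < length xs"
  shows "key (xs ! f) < k \<longleftrightarrow> f < length (filter (\<lambda>x. key x < k) xs)"
  using assms
proof (induction xs arbitrary: f)
  case (Cons x xs)
  show ?case
  proof (cases "key x < k")
    case True
    then show ?thesis
      using Cons by (cases f) auto
  next
    case False
    then have "\<forall>y \<in> set (x # xs). \<not> key y < k"
      using Cons.prems(1) by auto
    then have "filter (\<lambda>x. key x < k) (x # xs) = []" "\<not> key ((x # xs) ! f) < k"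
      using nth_mem[OF Cons.prems(2)] unfolding filter_empty_conv by blast+
    then show ?thesis
      by simp
  qed
qed simp

section \<open>The self-index as an instance of the graph\<close>

locale self_index = terminated_text +
  fixes ns :: "str set list" and rt sk :: nat and es :: "(nat \<times> str \<times> nat) list"
    and ins :: "nat list"
  assumes ns: "distinct ns" "set ns = cdawg_nodes T"
    and rt: "rt < length ns" "ns ! rt = cdawg_root T"
    and sk: "sk < length ns" "ns ! sk = cdawg_sink T"
    and es_distinct: "distinct es"
    and es_set: "set es = {(i, l, j). i < length ns \<and> j < length ns \<and>
      (ns ! i, l, ns ! j) \<in> cdawg_edges T}"
    and es_sorted: "sorted_wrt (\<lambda>(i, l, j) (i', l', j'). i < i' \<or> i = i' \<and> hd l < hd l') es"
    and ins: "distinct ins" "set ins = {..<length es}"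
    and ins_sorted: "sorted_wrt (\<lambda>f g. case (es ! f, es ! g) of ((i, l, j), (i', l', j')) \<Rightarrow>
        j < j' \<or>
        j = j' \<and> node_length (ns ! i) + length l > node_length (ns ! i') + length l') ins"
begin

definition "src f = fst (es ! f)"
definition "lab f = fst (snd (es ! f))"
definition "tgt f = snd (snd (es ! f))"
definition "oo k = length (filter (\<lambda>(i, l, j). i < k) es)"
definition "io k = length (filter (\<lambda>(i, l, j). j < k) es)"
definition "cnt k = card (rx (longest (ns ! k)))"
definition "fsym k = hd (shortest (ns ! k))"
definition "edge_string f = longest (ns ! src f) @ lab f"
definition "piece f = map (preceding T) (leaves T (edge_string f))"

lemma es_nth: "es ! f = (src f, lab f, tgt f)"
  by (simp add: src_def lab_def tgt_def)

lemma edge: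
  assumes "f < length es"
  shows "src f < length ns" "tgt f < length ns" "(ns ! src f, lab f, ns ! tgt f) \<in> cdawg_edges T"
proof -
  have "(src f, lab f, tgt f) \<in> set es"
    using assms es_nth nth_mem by metis
  then show "src f < length ns" "tgt f < length ns" "(ns ! src f, lab f, ns ! tgt f) \<in> cdawg_edges T"
    by (auto simp: es_set)
qed

lemma edge_exists:
  assumes "(U, l, V) \<in> cdawg_edges T"
  obtains f where "f < length es" "ns ! src f = U" "lab f = l" "ns ! tgt f = V"
proof -
  have "U \<in> set ns" "V \<in> set ns"
    using cdawg_edge_nodes[OF assms] ns by auto
  then obtain i j where "i < length ns" "j < length ns" "ns ! i = U" "ns ! j = V"
    by (auto simp: in_set_conv_nth)
  then have "(i, l, j) \<in> set es"
    using assms by (simp add: es_set)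
  then obtain f where "f < length es" "es ! f = (i, l, j)"
    by (auto simp: in_set_conv_nth)
  then show ?thesis
    using that \<open>ns ! i = U\<close> \<open>ns ! j = V\<close> by (simp add: es_nth)
qed

lemma node: "k < length ns \<Longrightarrow> ns ! k \<in> cdawg_nodes T"
  using ns nth_mem by blast

lemma node_inj: "i < length ns \<Longrightarrow> j < length ns \<Longrightarrow> ns ! i = ns ! j \<longleftrightarrow> i = j"
  using ns by (simp add: nth_eq_iff_index_eq)

lemma root_iff:
  assumes "k < length ns"
  shows "[] \<in> ns ! k \<longleftrightarrow> k = rt"
proof
  have Nil: "[] \<in> ns ! rt"
    using rt root_class by simp
  then show "[] \<in> ns ! k" if "k = rt"
    using that by simp
  assume "[] \<in> ns ! k"
  then have "ns ! k = ns ! rt"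
    by (rule cdawg_node_eq[OF node[OF assms] node[OF rt(1)] _ Nil])
  then show "k = rt"
    using node_inj[OF assms rt(1)] by simp
qed

lemma es_sorted_nth:
  "f < g \<Longrightarrow> g < length es \<Longrightarrow> src f < src g \<or> src f = src g \<and> hd (lab f) < hd (lab g)"
  using sorted_wrt_nth_less[OF es_sorted, of f g] by (simp add: es_nth)

lemma oo_less: "f < length es \<Longrightarrow> src f < k \<longleftrightarrow> f < oo k"
proof -
  assume f: "f < length es"
  have "sorted_wrt (\<lambda>x y. fst x \<le> fst y) es"
    by (rule sorted_wrt_mono_rel[OF _ es_sorted]) auto
  from sorted_group[OF this f, of k] show ?thesis
    unfolding oo_def src_def by (simp add: case_prod_unfold)
qed

lemma length_ins: "length ins = length es"
  using ins distinct_card[of ins] by simp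

lemma ins_lt: "p < length es \<Longrightarrow> ins ! p < length es"
  using ins(2) length_ins nth_mem[of p ins] by simp

lemma ins_exists: "f < length es \<Longrightarrow> \<exists>p < length es. ins ! p = f"
  using ins(2) length_ins in_set_conv_nth[of f ins] by simp

lemma edge_string_length:
  "f < length es \<Longrightarrow> length (edge_string f) = node_length (ns ! src f) + length (lab f)"
  by (simp add: edge_string_def node_length_longest[OF node] edge(1))

lemma ins_sorted_nth:
  assumes "p < q" "q < length es"
  shows "tgt (ins ! p) < tgt (ins ! q) \<or> tgt (ins ! p) = tgt (ins ! q) \<and>
    length (edge_string (ins ! p)) > length (edge_string (ins ! q))"
  using sorted_wrt_nth_less[OF ins_sorted, of p q] assms
  by (simp add: length_ins es_nth edge_string_length ins_lt)

text \<open>The offset table counts over \<open>es\<close>, whereas \<open>p\<close> is a position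
  in \<open>ins\<close>. The counts agree because \<open>ins\<close> lists every edge index exactly
  once.\<close>

lemma io_less: "p < length es \<Longrightarrow> tgt (ins ! p) < k \<longleftrightarrow> p < io k"
proof -
  assume p: "p < length es"
  have "sorted_wrt (\<lambda>x y. tgt x \<le> tgt y) ins"
    by (rule sorted_wrt_mono_rel[OF _ ins_sorted]) (auto simp: es_nth)
  from sorted_group[OF this, of p k] have "tgt (ins ! p) < k \<longleftrightarrow> p < length (filter (\<lambda>x. tgt x < k) ins)"
    using p length_ins by simp
  also have "length (filter (\<lambda>x. tgt x < k) ins) = card {f \<in> set ins. tgt f < k}"
    using ins(1) distinct_card[of "filter (\<lambda>x. tgt x < k) ins"] by simp
  also have "\<dots> = io k"
    unfolding io_def length_filter_conv_card ins(2) by (simp add: es_nth)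
  finally show ?thesis .
qed

lemma out_labels:
  assumes k: "k < length ns" and x: "x \<in> ns ! k"
  shows "sorted_wrt (\<lambda>l l'. hd l < hd l') (map lab [oo k..<oo (Suc k)])"
    and "set (map lab [oo k..<oo (Suc k)]) = {l. (x, l, x @ l) \<in> st_edges T}"
proof -
  have le: "oo (Suc k) \<le> length es"
    by (simp add: oo_def)
  have src: "src f = k" if "oo k \<le> f" "f < oo (Suc k)" for f
    using oo_less[of f k] oo_less[of f "Suc k"] le that by simp
  show "sorted_wrt (\<lambda>l l'. hd l < hd l') (map lab [oo k..<oo (Suc k)])"
    unfolding sorted_wrt_map
  proof (rule sorted_wrt_mono_rel[of _ "(<)"])
    fix f g assume "f \<in> set [oo k..<oo (Suc k)]" "g \<in> set [oo k..<oo (Suc k)]" "f < g"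
    then show "hd (lab f) < hd (lab g)"
      using es_sorted_nth[of f g] src le by simp
  qed simp
  show "set (map lab [oo k..<oo (Suc k)]) = {l. (x, l, x @ l) \<in> st_edges T}"
  proof (intro set_eqI iffI)
    fix l assume "l \<in> set (map lab [oo k..<oo (Suc k)])"
    then obtain f where "oo k \<le> f" "f < oo (Suc k)" "l = lab f"
      by auto
    then have "(ns ! k, l, ns ! tgt f) \<in> cdawg_edges T"
      using edge(3)[of f] src le by simp
    then show "l \<in> {l. (x, l, x @ l) \<in> st_edges T}"
      using cdawg_edgeD(1) x by blast
  next
    fix l assume "l \<in> {l. (x, l, x @ l) \<in> st_edges T}"
    then have "(ns ! k, l, st_iso T `` {x @ l}) \<in> cdawg_edges T"
      using cdawg_edgeI[OF node[OF k] x] by blast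
    then obtain f where f: "f < length es" "ns ! src f = ns ! k" "lab f = l"
      by (rule edge_exists)
    then have "src f = k"
      using node_inj edge(1) k by blast
    then have "oo k \<le> f" "f < oo (Suc k)"
      using oo_less[OF f(1), of k] oo_less[OF f(1), of "Suc k"] by auto
    then show "l \<in> set (map lab [oo k..<oo (Suc k)])"
      using f by auto
  qed
qed

lemma leaves_longest:
  assumes k: "k < length ns" "k \<noteq> sk"
  shows "map (preceding T) (leaves T (longest (ns ! k))) = concat (map piece [oo k..<oo (Suc k)])"
proof -
  have n: "ns ! k \<in> cdawg_nodes T"
    by (rule node[OF k(1)])
  have x: "longest (ns ! k) \<in> ns ! k"
    by (rule longest_in[OF n])
  have "[] \<notin> rx (longest (ns ! k))"
    using sink_iff[OF n x] sk node_inj[OF k(1) sk(1)] k by auto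
  from leaves_children[OF cdawg_node_subset[OF n x] this out_labels[OF k(1) x]]
  have "leaves T (longest (ns ! k)) = concat (map (\<lambda>f. leaves T (longest (ns ! k) @ lab f)) [oo k..<oo (Suc k)])"
    by (simp add: comp_def)
  moreover have "src f = k" if "oo k \<le> f" "f < oo (Suc k)" for f
  proof -
    have "oo (Suc k) \<le> length es"
      by (simp add: oo_def)
    then show ?thesis
      using oo_less[of f k] oo_less[of f "Suc k"] that by simp
  qed
  ultimately show ?thesis
    by (auto simp: map_concat piece_def edge_string_def intro!: arg_cong[of _ _ concat])
qed

lemma in_group:
  assumes "(U, l, ns ! k) \<in> cdawg_edges T" "k < length ns"
  obtains p where "p < length es" "ns ! src (ins ! p) = U" "lab (ins ! p) = l" "tgt (ins ! p) = k"
    "io k \<le> p" "p < io (Suc k)"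
proof -
  obtain f where f: "f < length es" "ns ! src f = U" "lab f = l" "ns ! tgt f = ns ! k"
    using edge_exists[OF assms(1)] .
  obtain p where p: "p < length es" "ins ! p = f"
    using ins_exists f by blast
  have "tgt f = k"
    using f node_inj edge(2) assms(2) by blast
  then show ?thesis
    using that f p io_less[OF p(1), of k] io_less[OF p(1), of "Suc k"] by auto
qed

lemma io_iff: "p < length es \<Longrightarrow> tgt (ins ! p) = k \<longleftrightarrow> io k \<le> p \<and> p < io (Suc k)"
  using io_less[of p k] io_less[of p "Suc k"] by auto

lemma io_le: "io k \<le> length es"
  by (simp add: io_def)

lemma edge_string_le:
  assumes "p \<le> q" "q < length es" "tgt (ins ! p) = tgt (ins ! q)"
  shows "length (edge_string (ins ! q)) \<le> length (edge_string (ins ! p))"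
  using ins_sorted_nth[of p q] assms by (cases "p = q") auto

lemma edge_string_in: "f < length es \<Longrightarrow> edge_string f \<in> ns ! tgt f"
  unfolding edge_string_def using cdawg_edgeD(2)[OF edge(3)] longest_in[OF node] edge(1) by blast

lemma longest_first:
  assumes "p < length es" "tgt (ins ! p) = k" "io k = p"
  shows "longest (ns ! k) = edge_string (ins ! p)"
  unfolding edge_string_def
proof (rule longest_first_edge)
  show "(ns ! src (ins ! p), lab (ins ! p), ns ! k) \<in> cdawg_edges T"
    using edge(3)[OF ins_lt] assms by blast
  fix U' l' assume e: "(U', l', ns ! k) \<in> cdawg_edges T"
  have k: "k < length ns"
    using assms edge(2) ins_lt by blast
  from e k obtain q where "q < length es" "ns ! src (ins ! q) = U'" "lab (ins ! q) = l'"
    "tgt (ins ! q) = k" "io k \<le> q" "q < io (Suc k)"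
    by (rule in_group)
  then show "length (longest U' @ l') \<le> length (longest (ns ! src (ins ! p)) @ lab (ins ! p))"
    using edge_string_le[of p q] assms by (auto simp: edge_string_def)
qed

lemma shortest_last:
  assumes "k < length ns" "p < length es" "tgt (ins ! p) = k" "io (Suc k) = Suc p"
  shows "shortest (ns ! k) = shortest (ns ! src (ins ! p)) @ lab (ins ! p)"
proof (rule shortest_last_edge)
  show "(ns ! src (ins ! p), lab (ins ! p), ns ! k) \<in> cdawg_edges T"
    using edge(3)[OF ins_lt] assms by blast
  fix U' l' assume "(U', l', ns ! k) \<in> cdawg_edges T"
  from this assms(1) obtain q where "q < length es" "ns ! src (ins ! q) = U'" "lab (ins ! q) = l'"
    "tgt (ins ! q) = k" "io k \<le> q" "q < io (Suc k)"
    by (rule in_group)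
  then show "length (longest (ns ! src (ins ! p)) @ lab (ins ! p)) \<le> length (longest U' @ l')"
    using edge_string_le[of q p] assms by (auto simp: edge_string_def)
qed

lemma shortest_preceding:
  assumes p: "p < length es" "tgt (ins ! p) = k" "io k \<noteq> p"
  obtains a where "shortest (ns ! src (ins ! (p - 1))) @ lab (ins ! (p - 1)) = a # edge_string (ins ! p)"
proof -
  have p': "io k < p" "p < io (Suc k)"
    using io_iff[of p k] p by auto
  then have q: "p - 1 < length es" "tgt (ins ! (p - 1)) = k"
    using io_iff[of "p - 1" k] p by auto
  have k: "k < length ns"
    using p edge(2) ins_lt by blast
  show ?thesis
  proof (rule shortest_preceding_edge)
    show "(ns ! src (ins ! p), lab (ins ! p), ns ! k) \<in> cdawg_edges T"
      using edge(3)[OF ins_lt] p by blast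
    show "(ns ! src (ins ! (p - 1)), lab (ins ! (p - 1)), ns ! k) \<in> cdawg_edges T"
      using edge(3)[OF ins_lt] q by blast
    show "length (longest (ns ! src (ins ! p)) @ lab (ins ! p))
        < length (longest (ns ! src (ins ! (p - 1))) @ lab (ins ! (p - 1)))"
      using ins_sorted_nth[of "p - 1" p] p' p q by (simp add: edge_string_def)
    fix W m assume e: "(W, m, ns ! k) \<in> cdawg_edges T"
      and l: "length (longest (ns ! src (ins ! p)) @ lab (ins ! p)) < length (longest W @ m)"
    from e k obtain r where r: "r < length es" "ns ! src (ins ! r) = W" "lab (ins ! r) = m"
      "tgt (ins ! r) = k" "io k \<le> r" "r < io (Suc k)"
      by (rule in_group)
    have "r < p"
    proof (rule ccontr)
      assume "\<not> r < p"
      then show False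
        using edge_string_le[of p r] l r p by (simp add: edge_string_def)
    qed
    then show "length (longest (ns ! src (ins ! (p - 1))) @ lab (ins ! (p - 1))) \<le> length (longest W @ m)"
      using edge_string_le[of r "p - 1"] r q by (simp add: edge_string_def)
  next
    fix a assume "shortest (ns ! src (ins ! (p - 1))) @ lab (ins ! (p - 1)) =
      a # longest (ns ! src (ins ! p)) @ lab (ins ! p)"
    then show ?thesis
      using that by (simp add: edge_string_def)
  qed
qed

text \<open>Only the root has an empty shortest string; there the label has to supply the first
  symbol.\<close>

lemma edge_symbol:
  assumes "f < length es"
  shows "(if src f = rt then hd (lab f) else fsym (src f)) = hd (shortest (ns ! src f) @ lab f)"
proof -
  have n: "src f < length ns" "ns ! src f \<in> cdawg_nodes T"
    using edge(1) node assms by auto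
  show ?thesis
  proof (cases "src f = rt")
    case True
    then have "shortest (ns ! src f) = []"
      using shortest_in[OF n(2)] rt root_class by auto
    then show ?thesis
      using True by simp
  next
    case False
    then have "shortest (ns ! src f) \<noteq> []"
      using root_iff[OF n(1)] shortest_in[OF n(2)] by auto
    then show ?thesis
      using False by (simp add: fsym_def)
  qed
qed

lemma length_leaves_root: "length (leaves T []) = length T"
  unfolding suffix_array_leaves[symmetric] by (simp add: suffix_array_def)

lemma rx_card: "card (rx x) \<le> length T"
proof -
  have d: "distinct (leaves T y)" for y
    by (simp add: leaves_def)
  have "card (set (leaves T x)) \<le> card (set (leaves T []))"
    by (rule card_mono[OF List.finite_set]) (auto simp: set_leaves)
  then show ?thesis
    using length_leaves[of x] length_leaves_root by (simp add: distinct_card[OF d])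
qed

lemma rx_finite: "finite (rx x)"
  by (rule finite_imageD[of "(@) x"]) (simp_all add: leaves_eq_rx[symmetric] inj_on_def)

lemma rt_neq_sk: "rt \<noteq> sk"
proof
  assume "rt = sk"
  then have "T \<in> cdawg_root T"
    using longest_in[OF node[OF sk(1)]] sk rt longest_sink by simp
  then show False
    using root_class T_nonempty by simp
qed

lemma bwt_pieces: "bwt T = concat (map piece [oo rt..<oo (Suc rt)])"
proof -
  have "longest (ns ! rt) = []"
    using longest_in[OF node[OF rt(1)]] rt root_class by auto
  then show ?thesis
    using leaves_longest[OF rt(1) rt_neq_sk] by (simp add: bwt_leaves)
qed

text \<open>This is how the end-marker is found without the text: the suffix of length one is a leaf
  directly below the root, and as its symbol is the smallest, its edge comes first.\<close>

lemma last_symbol: "last T = hd (lab (oo rt))"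
proof -
  have Nil: "[] \<in> ns ! rt"
    using rt root_class by auto
  obtain p where p: "T = p @ [last T]"
    using T_nonempty append_butlast_last_id by metis
  then have "[last T] \<in> rx []"
    by (auto simp: right_contexts_def suffix_def)
  then obtain l where l: "([], l, [] @ l) \<in> st_edges T" "prefix l [last T]"
    using st_edge_exists[OF Nil_node] by blast
  then have "l = [last T]"
    by (auto simp: st_edges_iff prefix_Cons)
  then have "[last T] \<in> set (map lab [oo rt..<oo (Suc rt)])"
    using out_labels(2)[OF rt(1) Nil] l by auto
  then obtain f where f: "oo rt \<le> f" "f < oo (Suc rt)" "lab f = [last T]"
    by auto
  have le: "oo (Suc rt) \<le> length es"
    by (simp add: oo_def)
  have "lab (oo rt) \<in> set (map lab [oo rt..<oo (Suc rt)])"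
    using f by simp
  then have e: "([], lab (oo rt), [] @ lab (oo rt)) \<in> st_edges T"
    using out_labels(2)[OF rt(1) Nil] by blast
  have "hd (lab (oo rt)) \<in> set T"
  proof -
    obtain z where "z \<in> rx (lab (oo rt))"
      using e rx_nonempty by (fastforce simp: st_edges_iff)
    then have "set (lab (oo rt)) \<subseteq> set T"
      by (auto simp: right_contexts_def suffix_def)
    then show ?thesis
      using e by (auto simp: st_edges_iff)
  qed
  then have ge: "last T \<le> hd (lab (oo rt))"
    using terminated_T p by (auto simp: terminated_def) (metis UnE butlast_snoc empty_iff empty_set insert_iff less_imp_le list.simps(15) order_refl set_append)
  show ?thesis
  proof (cases "f = oo rt")
    case False
    then have "hd (lab (oo rt)) < hd (lab f)"
      using es_sorted_nth[of "oo rt" f] f le oo_less[of f "Suc rt"] oo_less[of "oo rt" rt] by auto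
    then show ?thesis
      using f ge by simp
  qed (use f in simp)
qed

text \<open>Acyclicity is witnessed by \<open>node_length\<close> as rank: labels are nonempty, so
  longest strings grow along edges.\<close>

sublocale edge_graph "length ns" "length es" rt sk "length T" "last T"
  src "\<lambda>f. hd (lab f)" tgt oo io "\<lambda>p. ins ! p" cnt fsym "\<lambda>k. node_length (ns ! k)" piece
proof
  show "rt < length ns" "sk < length ns" "rt \<noteq> sk" "last T = hd (lab (oo rt))"
    by (fact rt(1) sk(1) rt_neq_sk last_symbol)+
  show "f < length es \<Longrightarrow> src f < length ns" "f < length es \<Longrightarrow> tgt f < length ns" for f
    by (simp_all add: edge)
  show "oo k \<le> oo (Suc k)" "io k \<le> io (Suc k)" for k
    by (auto simp: oo_def io_def length_filter_conv_card intro!: card_mono)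
  show "oo k \<le> length es" "io k \<le> length es" for k
    by (simp_all add: oo_def io_def)
  show "f < length es \<Longrightarrow> src f = k \<longleftrightarrow> oo k \<le> f \<and> f < oo (Suc k)" for f k
    using oo_less[of f k] oo_less[of f "Suc k"] by auto
  show "p < length es \<Longrightarrow> tgt (ins ! p) = k \<longleftrightarrow> io k \<le> p \<and> p < io (Suc k)" for p k
    by (rule io_iff)
  show "bij_betw (\<lambda>p. ins ! p) {..<length es} {..<length es}"
    using ins length_ins by (intro bij_betw_nth) auto
  show "node_length (ns ! src f) < node_length (ns ! tgt f)" if "f < length es" for f
  proof -
    have "lab f \<noteq> []"
      using cdawg_edge_nodes[OF edge(3)[OF that]] by simp
    then have "length (longest (ns ! src f)) < length (edge_string f)"
      by (simp add: edge_string_def)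
    also have "\<dots> \<le> length (longest (ns ! tgt f))"
      using edge_string_in[OF that] longest_max[OF node] edge(2)[OF that] by blast
    finally show ?thesis
      using node_length_longest[OF node] edge[OF that] by simp
  qed
  show "oo k < oo (Suc k) \<longleftrightarrow> k \<noteq> sk" if "k < length ns" for k
  proof -
    have x: "longest (ns ! k) \<in> ns ! k"
      using longest_in node that by blast
    have "oo k < oo (Suc k) \<longleftrightarrow> set (map lab [oo k..<oo (Suc k)]) \<noteq> {}"
      by auto
    also have "\<dots> \<longleftrightarrow> (\<exists>l y. (longest (ns ! k), l, y) \<in> st_edges T)"
      unfolding out_labels(2)[OF that x] by (auto simp: st_edges_iff)
    also have "\<dots> \<longleftrightarrow> [] \<notin> rx (longest (ns ! k))"
      using leaf_iff_no_edge[OF cdawg_node_subset[OF node[OF that] x]] by auto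
    also have "\<dots> \<longleftrightarrow> k \<noteq> sk"
      using sink_iff[OF node[OF that] x] sk node_inj[OF that sk(1)] by auto
    finally show ?thesis .
  qed
  show "io k < io (Suc k) \<longleftrightarrow> k \<noteq> rt" if "k < length ns" for k
  proof
    assume lt: "io k < io (Suc k)"
    have "tgt (ins ! io k) = k" "io k < length es"
      using io_iff[of "io k" k] lt io_le[of "Suc k"] by auto
    then have "edge_string (ins ! io k) \<in> ns ! k" "lab (ins ! io k) \<noteq> []"
      using edge_string_in[OF ins_lt, of "io k"] cdawg_edge_nodes[OF edge(3)[OF ins_lt, of "io k"]] by auto
    then show "k \<noteq> rt"
      using rt root_class by (auto simp: edge_string_def)
  next
    assume k: "k \<noteq> rt"
    have kn: "ns ! k \<in> cdawg_nodes T"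
      by (rule node[OF that])
    have x: "longest (ns ! k) \<in> ns ! k"
      using longest_in node that by blast
    then have "longest (ns ! k) \<noteq> []"
      using root_iff[OF that] k by auto
    then obtain U u l where "(U, l, ns ! k) \<in> cdawg_edges T" "u \<in> U" "longest (ns ! k) = u @ l"
      using cdawg_edge_into[OF kn x] by blast
    from in_group[OF this(1) that] show "io k < io (Suc k)"
      by (metis le_less_trans)
  qed
  show "cnt sk = 1"
  proof -
    have "longest (ns ! sk) = T"
      using longest_sink sk by simp
    moreover have "rx T = {[]}"
      using rx_leaf[of T] T_nonempty Nil_in_rx[of T] by auto
    ultimately show ?thesis
      by (simp add: cnt_def)
  qed
  \<comment> \<open>All members of a class have equally many suffixes below them, whichever member
    the edge ends in.\<close>
  have piece_cnt: "length (piece f) = cnt (tgt f)" if "f < length es" for f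
  proof -
    have "rx (edge_string f) = rx (longest (ns ! tgt f))"
      using cdawg_node_rx[OF node[OF edge(2)[OF that]] edge_string_in[OF that]]
        longest_in[OF node[OF edge(2)[OF that]]] by blast
    then show ?thesis
      by (simp add: piece_def length_leaves cnt_def)
  qed
  show "cnt k = (\<Sum>f = oo k..<oo (Suc k). cnt (tgt f))" if "k < length ns" "k \<noteq> sk" for k
  proof -
    have le: "oo (Suc k) \<le> length es"
      by (simp add: oo_def)
    have "cnt k = length (map (preceding T) (leaves T (longest (ns ! k))))"
      by (simp add: length_leaves cnt_def)
    also have "\<dots> = (\<Sum>f\<leftarrow>[oo k..<oo (Suc k)]. length (piece f))"
      unfolding leaves_longest[OF that] by (simp add: length_concat comp_def)
    also have "\<dots> = (\<Sum>f = oo k..<oo (Suc k). length (piece f))"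
      by (simp add: interv_sum_list_conv_sum_set_nat)
    also have "\<dots> = (\<Sum>f = oo k..<oo (Suc k). cnt (tgt f))"
      using le by (intro sum.cong) (auto simp: piece_cnt)
    finally show ?thesis .
  qed
  show "cnt k \<le> length T" for k
    by (simp add: cnt_def rx_card)
  show "0 < cnt k" if "k < length ns" for k
    using rx_nonempty[OF cdawg_node_subset[OF node[OF that] longest_in[OF node[OF that]]]]
    by (simp add: cnt_def card_gt_0_iff rx_finite)
  show "fsym k = (if src g = rt then hd (lab g) else fsym (src g))"
    if "k < length ns" "k \<noteq> rt" "g = ins ! (io (Suc k) - 1)" for k g
  proof -
    have kn: "ns ! k \<in> cdawg_nodes T"
      by (rule node[OF that(1)])
    have x: "longest (ns ! k) \<in> ns ! k"
      by (rule longest_in[OF kn])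
    then have "longest (ns ! k) \<noteq> []"
      using root_iff[OF that(1)] that by auto
    then obtain U u l where "(U, l, ns ! k) \<in> cdawg_edges T" "u \<in> U" "longest (ns ! k) = u @ l"
      using cdawg_edge_into[OF kn x] by blast
    from in_group[OF this(1) that(1)] have "io k < io (Suc k)"
      by (metis le_less_trans)
    then have p: "io (Suc k) - 1 < length es" "tgt g = k" "io (Suc k) = Suc (io (Suc k) - 1)"
      using io_iff[of "io (Suc k) - 1" k] io_le[of "Suc k"] that by auto
    have "shortest (ns ! k) = shortest (ns ! src g) @ lab g"
      using shortest_last[OF that(1) p(1) _ p(3)] p(2) that(3) by simp
    then show ?thesis
      using edge_symbol[of g] ins_lt[OF p(1)] that(3) by (simp add: fsym_def)
  qed
  show "piece (ins ! p) = [last T]" if "p < length es" "tgt (ins ! p) = sk" "io sk = p" for p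
  proof -
    have "edge_string (ins ! p) = T"
      using longest_first[OF that] longest_sink sk by simp
    then show ?thesis
      using leaves_leaf[of T] T_nonempty by (simp add: piece_def preceding_def Nil_in_rx)
  qed
  show "piece (ins ! p) = concat (map piece [oo k..<oo (Suc k)])"
    if "p < length es" "tgt (ins ! p) = k" "k \<noteq> sk" "io k = p" for p k
  proof -
    have k: "k < length ns"
      using that edge(2) ins_lt by blast
    show ?thesis
      using longest_first[OF that(1,2,4)] leaves_longest[OF k that(3)] by (simp add: piece_def)
  qed
  show "piece (ins ! p) = replicate (cnt k) (if src g = rt then hd (lab g) else fsym (src g))"
    if "p < length es" "tgt (ins ! p) = k" "io k \<noteq> p" "g = ins ! (p - 1)" for p k g
  proof -
    have "\<exists>a. shortest (ns ! src g) @ lab g = a # edge_string (ins ! p)"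
      using shortest_preceding[OF that(1-3)] unfolding that(4) by blast
    then obtain a where a: "shortest (ns ! src g) @ lab g = a # edge_string (ins ! p)"
      by blast
    have q: "p - 1 < length es" "tgt g = k"
      using io_iff[of p k] io_iff[of "p - 1" k] that by auto
    have g: "g < length es"
      using ins_lt[OF q(1)] that(4) by simp
    have k: "k < length ns"
      using edge(2)[OF g] q by simp
    have "a # edge_string (ins ! p) \<in> ns ! k"
      using cdawg_edgeD(2)[OF edge(3)[OF g] shortest_in[OF node[OF edge(1)[OF g]]]] a q by simp
    moreover have "edge_string (ins ! p) \<in> ns ! k"
      using edge_string_in[OF ins_lt[OF that(1)]] that by simp
    ultimately have "rx (a # edge_string (ins ! p)) = rx (edge_string (ins ! p))"
      by (rule cdawg_node_rx[OF node[OF k]])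
    then have "\<forall>s \<in> set (leaves T (edge_string (ins ! p))). preceding T s = a"
      using preceding_unique by blast
    then have "piece (ins ! p) = replicate (length (piece (ins ! p))) a"
      by (simp add: piece_def map_replicate_const[symmetric])
    moreover have "(if src g = rt then hd (lab g) else fsym (src g)) = a"
      using edge_symbol[OF g] a by simp
    ultimately show ?thesis
      using piece_cnt[OF ins_lt[OF that(1)]] that(2) by simp
  qed
  show "length (concat (map piece [oo rt..<oo (Suc rt)])) \<le> length T"
    unfolding bwt_pieces[symmetric] bwt_leaves by (simp add: length_leaves_root)
qed

end

section \<open>A structured language for the word RAM\<close>

datatype com =
    Skip
  | Set_reg nat nat
  | Add_reg nat nat nat
  | Sub_reg nat nat nat
  | Read nat nat nat
  | Write nat nat nat
  | Seq com com (infixr ";;" 60)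
  | If_eq nat nat com com
  | While_less nat nat com

type_synonym regs = "nat \<Rightarrow> nat"
type_synonym arrays = "nat \<Rightarrow> nat \<Rightarrow> nat"

text \<open>The side conditions exclude overflow, so arithmetic on numbers agrees with arithmetic on
  words. The costs are those of the compiled code: three instructions of address computation per
  array access, one jump over the branch for equality but two jumps around the branch for
  inequality, and two jumps per test of a loop.\<close>

inductive exec :: "nat \<Rightarrow> regs \<Rightarrow> com \<Rightarrow> regs \<Rightarrow> arrays \<Rightarrow> nat \<Rightarrow> regs \<Rightarrow> arrays \<Rightarrow> bool"
  for W :: nat and len :: regs where
  "exec W len Skip R A 0 R A"
| "k < W \<Longrightarrow> exec W len (Set_reg d k) R A 1 (R(d := k)) A"
| "R a + R b < W \<Longrightarrow> exec W len (Add_reg d a b) R A 1 (R(d := R a + R b)) A"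
| "R b \<le> R a \<Longrightarrow> R a < W \<Longrightarrow> exec W len (Sub_reg d a b) R A 1 (R(d := R a - R b)) A"
| "R a < len k \<Longrightarrow> exec W len (Read d k a) R A 4 (R(d := A k (R a))) A"
| "R a < len k \<Longrightarrow> exec W len (Write k a s) R A 4 R (A(k := (A k)(R a := R s)))"
| "exec W len c R A t R' A' \<Longrightarrow> exec W len c' R' A' t' R'' A'' \<Longrightarrow>
    exec W len (c ;; c') R A (t + t') R'' A''"
| "R a = R b \<Longrightarrow> exec W len c R A t R' A' \<Longrightarrow> exec W len (If_eq a b c c') R A (t + 1) R' A'"
| "R a \<noteq> R b \<Longrightarrow> exec W len c' R A t R' A' \<Longrightarrow> exec W len (If_eq a b c c') R A (t + 2) R' A'"
| "R a < R b \<Longrightarrow> exec W len c R A t R' A' \<Longrightarrow> exec W len (While_less a b c) R' A' t' R'' A'' \<Longrightarrow>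
    exec W len (While_less a b c) R A (t + t' + 2) R'' A''"
| "\<not> R a < R b \<Longrightarrow> exec W len (While_less a b c) R A 2 R A"

lemma exec_iff:
  "exec W len Skip R A t R' A' \<longleftrightarrow> t = 0 \<and> R' = R \<and> A' = A"
  "exec W len (Set_reg d k) R A t R' A' \<longleftrightarrow> k < W \<and> t = 1 \<and> R' = R(d := k) \<and> A' = A"
  "exec W len (Add_reg d a b) R A t R' A' \<longleftrightarrow>
     R a + R b < W \<and> t = 1 \<and> R' = R(d := R a + R b) \<and> A' = A"
  "exec W len (Sub_reg d a b) R A t R' A' \<longleftrightarrow>
     R b \<le> R a \<and> R a < W \<and> t = 1 \<and> R' = R(d := R a - R b) \<and> A' = A"
  "exec W len (Read d k a) R A t R' A' \<longleftrightarrow>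
     R a < len k \<and> t = 4 \<and> R' = R(d := A k (R a)) \<and> A' = A"
  "exec W len (Write k a s) R A t R' A' \<longleftrightarrow>
     R a < len k \<and> t = 4 \<and> R' = R \<and> A' = A(k := (A k)(R a := R s))"
  "exec W len (c ;; c') R A t R' A' \<longleftrightarrow>
     (\<exists>t1 t2 R1 A1. t = t1 + t2 \<and> exec W len c R A t1 R1 A1 \<and> exec W len c' R1 A1 t2 R' A')"
  "exec W len (If_eq a b c c') R A t R' A' \<longleftrightarrow>
     (\<exists>t1. if R a = R b then t = t1 + 1 \<and> exec W len c R A t1 R' A'
       else t = t1 + 2 \<and> exec W len c' R A t1 R' A')"
  by (subst exec.simps, fastforce)+

text \<open>Demanding that a run exists gives total correctness. The clock \<open>t\<close> is
  carried along, so that postconditions and invariants can bound the time.\<close>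

definition wp :: "nat \<Rightarrow> regs \<Rightarrow> com \<Rightarrow> (regs \<Rightarrow> arrays \<Rightarrow> nat \<Rightarrow> bool) \<Rightarrow> regs \<Rightarrow> arrays \<Rightarrow> nat \<Rightarrow> bool" where
  "wp W len c Q R A t \<longleftrightarrow> (\<exists>k R' A'. exec W len c R A k R' A' \<and> Q R' A' (t + k))"

lemma wp_simps [simp]:
  "wp W len Skip Q R A t \<longleftrightarrow> Q R A t"
  "wp W len (Set_reg d k) Q R A t \<longleftrightarrow> k < W \<and> Q (R(d := k)) A (t + 1)"
  "wp W len (Add_reg d a b) Q R A t \<longleftrightarrow> R a + R b < W \<and> Q (R(d := R a + R b)) A (t + 1)"
  "wp W len (Sub_reg d a b) Q R A t \<longleftrightarrow> R b \<le> R a \<and> R a < W \<and> Q (R(d := R a - R b)) A (t + 1)"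
  "wp W len (Read d k a) Q R A t \<longleftrightarrow> R a < len k \<and> Q (R(d := A k (R a))) A (t + 4)"
  "wp W len (Write k a s) Q R A t \<longleftrightarrow> R a < len k \<and> Q R (A(k := (A k)(R a := R s))) (t + 4)"
  by (simp_all add: wp_def exec_iff)

lemma wp_Seq [simp]: "wp W len (c ;; c') Q R A t \<longleftrightarrow> wp W len c (wp W len c' Q) R A t"
proof
  assume "wp W len (c ;; c') Q R A t"
  then obtain t1 t2 R1 A1 R2 A2 where
    "exec W len c R A t1 R1 A1" "exec W len c' R1 A1 t2 R2 A2" "Q R2 A2 (t + t1 + t2)"
    unfolding wp_def exec_iff by (auto simp: add.assoc)
  then show "wp W len c (wp W len c' Q) R A t"
    unfolding wp_def by blast
next
  assume "wp W len c (wp W len c' Q) R A t"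
  then obtain t1 t2 R1 A1 R2 A2 where
    "exec W len c R A t1 R1 A1" "exec W len c' R1 A1 t2 R2 A2" "Q R2 A2 (t + (t1 + t2))"
    unfolding wp_def by (auto simp: add.assoc)
  then show "wp W len (c ;; c') Q R A t"
    unfolding wp_def exec_iff by blast
qed

lemma wp_If [simp]:
  "wp W len (If_eq a b c c') Q R A t \<longleftrightarrow>
     (if R a = R b then wp W len c Q R A (t + 1) else wp W len c' Q R A (t + 2))"
proof -
  have *: "(\<exists>k R' A'. (\<exists>t1. k = t1 + s \<and> exec W len c R A t1 R' A') \<and> Q R' A' (t + k)) \<longleftrightarrow>
      wp W len c Q R A (t + s)" (is "?L \<longleftrightarrow> ?R") for c s
  proof -
    have "t + (k + s) = t + s + k" for k
      by simp
    then show ?thesis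
      unfolding wp_def by metis
  qed
  show ?thesis
    unfolding *[symmetric] by (cases "R a = R b") (simp_all add: wp_def exec_iff)
qed

lemma wp_conseq:
  "wp W len c Q R A t \<Longrightarrow> (\<And>R A t. Q R A t \<Longrightarrow> Q' R A t) \<Longrightarrow> wp W len c Q' R A t"
  unfolding wp_def by blast

text \<open>The variant is an index of the invariant instead of a function of the state. It can
  therefore measure data that the state does not determine explicitly, such as the set of edges
  already popped.\<close>

lemma wp_While_variant:
  assumes inv: "I k R A t"
    and step: "\<And>k R A t. I k R A t \<Longrightarrow> R a < R b \<Longrightarrow>
      wp W len c (\<lambda>R' A' t'. \<exists>k' < (k :: nat). I k' R' A' t') R A (t + 2)"
    and exit: "\<And>k R A t. I k R A t \<Longrightarrow> \<not> R a < R b \<Longrightarrow> Q R A (t + 2)"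
  shows "wp W len (While_less a b c) Q R A t"
  using inv
proof (induction k arbitrary: R A t rule: less_induct)
  case (less k)
  show ?case
  proof (cases "R a < R b")
    case True
    obtain n R' A' k' where k: "exec W len c R A n R' A'" "k' < k" "I k' R' A' (t + 2 + n)"
      using step[OF less.prems True] unfolding wp_def by blast
    obtain n' R'' A'' where "exec W len (While_less a b c) R' A' n' R'' A''" "Q R'' A'' (t + 2 + n + n')"
      using less.IH[OF k(2,3)] unfolding wp_def by blast
    then have "exec W len (While_less a b c) R A (n + n' + 2) R'' A''" "Q R'' A'' (t + (n + n' + 2))"
      using exec.intros(10)[where R = R and A = A, OF True k(1)] by (simp_all add: ac_simps)
    then show ?thesis
      unfolding wp_def by blast
  next
    case False
    then show ?thesis
      unfolding wp_def using exec.intros(11) exit[OF less.prems False] by blast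
  qed
qed

lemma wp_While:
  fixes m :: "regs \<Rightarrow> arrays \<Rightarrow> nat"
  assumes inv: "I R A t"
    and step: "\<And>R A t. I R A t \<Longrightarrow> R a < R b \<Longrightarrow>
      wp W len c (\<lambda>R' A' t'. I R' A' t' \<and> m R' A' < m R A) R A (t + 2)"
    and exit: "\<And>R A t. I R A t \<Longrightarrow> \<not> R a < R b \<Longrightarrow> Q R A (t + 2)"
  shows "wp W len (While_less a b c) Q R A t"
proof (rule wp_While_variant[where I = "\<lambda>k R A t. I R A t \<and> k = m R A"])
  show "I R A t \<and> m R A = m R A"
    using inv by simp
  show "wp W len c (\<lambda>R' A' t'. \<exists>k' < k. I R' A' t' \<and> k' = m R' A') R A (t + 2)"
    if "I R A t \<and> k = m R A" "R a < R b" for k R A t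
    by (rule wp_conseq[OF step[of R A t]]) (use that in auto)
qed (use exit in blast)

text \<open>Registers below 50 belong to the program, register 99 is scratch, and register \<open>100 + k\<close>
  holds the base address of array \<open>k\<close>, whose \<open>i\<close>-th entry is stored at \<open>base k + stride k * i\<close>.\<close>

fun well_formed :: "nat set \<Rightarrow> nat set \<Rightarrow> com \<Rightarrow> bool" where
  "well_formed K V Skip \<longleftrightarrow> True"
| "well_formed K V (Set_reg d k) \<longleftrightarrow> d < 50"
| "well_formed K V (Add_reg d a b) \<longleftrightarrow> d < 50 \<and> a < 50 \<and> b < 50"
| "well_formed K V (Sub_reg d a b) \<longleftrightarrow> d < 50 \<and> a < 50 \<and> b < 50"
| "well_formed K V (Read d k a) \<longleftrightarrow> d < 50 \<and> a < 50 \<and> k \<in> K"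
| "well_formed K V (Write k a s) \<longleftrightarrow> a < 50 \<and> s < 50 \<and> k \<in> V"
| "well_formed K V (c ;; c') \<longleftrightarrow> well_formed K V c \<and> well_formed K V c'"
| "well_formed K V (If_eq a b c c') \<longleftrightarrow> a < 50 \<and> b < 50 \<and> well_formed K V c \<and> well_formed K V c'"
| "well_formed K V (While_less a b c) \<longleftrightarrow> a < 50 \<and> b < 50 \<and> well_formed K V c"

section \<open>Compilation to the word RAM\<close>

primrec code_size :: "com \<Rightarrow> nat" where
  "code_size Skip = 0"
| "code_size (Set_reg d k) = 1"
| "code_size (Add_reg d a b) = 1"
| "code_size (Sub_reg d a b) = 1"
| "code_size (Read d k a) = 4"
| "code_size (Write k a s) = 4"
| "code_size (c ;; c') = code_size c + code_size c'"
| "code_size (If_eq a b c c') = code_size c + code_size c' + 2"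
| "code_size (While_less a b c) = code_size c + 3"

primrec compile :: "(nat \<Rightarrow> nat) \<Rightarrow> nat \<Rightarrow> com \<Rightarrow> instr list" where
  "compile stride pc Skip = []"
| "compile stride pc (Set_reg d k) = [Const d k]"
| "compile stride pc (Add_reg d a b) = [Op Add d a b]"
| "compile stride pc (Sub_reg d a b) = [Op Sub d a b]"
| "compile stride pc (Read d k a) =
     [Const 99 (stride k), Op Mul 99 99 a, Op Add 99 99 (100 + k), Load d 99]"
| "compile stride pc (Write k a s) =
     [Const 99 (stride k), Op Mul 99 99 a, Op Add 99 99 (100 + k), Store 99 s]"
| "compile stride pc (c ;; c') = compile stride pc c @ compile stride (pc + code_size c) c'"
| "compile stride pc (If_eq a b c c') =
     [Jump_eq a b (pc + code_size c' + 2)] @ compile stride (pc + 1) c' @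
     [Jump (pc + code_size c' + 2 + code_size c)] @ compile stride (pc + code_size c' + 2) c"
| "compile stride pc (While_less a b c) =
     [Jump_less a b (pc + 2), Jump (pc + code_size c + 3)] @ compile stride (pc + 2) c @ [Jump pc]"

lemma length_compile [simp]: "length (compile stride pc c) = code_size c"
  by (induction c arbitrary: pc) auto

definition code_at :: "instr list \<Rightarrow> nat \<Rightarrow> instr list \<Rightarrow> bool" where
  "code_at P pc is \<longleftrightarrow> (\<exists>xs ys. P = xs @ is @ ys \<and> length xs = pc)"

lemma code_at_append:
  "code_at P pc (is @ js) \<longleftrightarrow> code_at P pc is \<and> code_at P (pc + length is) js"
proof
  assume "code_at P pc (is @ js)"
  then obtain xs ys where "P = xs @ (is @ js) @ ys" "length xs = pc"
    by (auto simp: code_at_def)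
  then have "P = xs @ is @ (js @ ys)" "P = (xs @ is) @ js @ ys" "length xs = pc"
    by auto
  then show "code_at P pc is \<and> code_at P (pc + length is) js"
    unfolding code_at_def by (metis length_append)
next
  assume "code_at P pc is \<and> code_at P (pc + length is) js"
  then obtain xs ys xs' ys' where a: "P = xs @ is @ ys" "length xs = pc"
    "P = xs' @ js @ ys'" "length xs' = pc + length is"
    unfolding code_at_def by blast
  then have "(xs @ is) @ ys = xs' @ js @ ys'"
    by simp
  then have "ys = js @ ys'"
    using a(2,4) by (subst (asm) append_eq_append_conv) auto
  then show "code_at P pc (is @ js)"
    unfolding code_at_def using a by auto
qed

lemma code_at_Cons: "code_at P pc (i # is) \<longleftrightarrow> pc < length P \<and> P ! pc = i \<and> code_at P (pc + 1) is"
proof -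
  have "code_at P pc [i] \<longleftrightarrow> pc < length P \<and> P ! pc = i"
  proof
    assume "pc < length P \<and> P ! pc = i"
    then have "P = take pc P @ [i] @ drop (Suc pc) P" "length (take pc P) = pc"
      using id_take_nth_drop[of pc P] by auto
    then show "code_at P pc [i]"
      unfolding code_at_def by blast
  qed (auto simp: code_at_def)
  then show ?thesis
    using code_at_append[of P pc "[i]" "is"] by simp
qed

lemma steps_add: "steps w P (t + t') s = Option.bind (steps w P t s) (steps w P t')"
proof (induction t arbitrary: s)
  case (Suc t)
  then show ?case
    by (cases "step w P s") simp_all
qed simp

lemma steps_numeral:
  "steps w P 2 s = steps w P (Suc (Suc 0)) s"
  "steps w P 4 s = steps w P (Suc (Suc (Suc (Suc 0)))) s"
  by (simp_all only: numeral_eq_Suc pred_numeral_simps BitM.simps numeral_1_eq_Suc_0 One_nat_def)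

lemma steps_addI:
  "steps w P t s = Some s' \<Longrightarrow> steps w P t' s' = Some s'' \<Longrightarrow> steps w P (t + t') s = Some s''"
  by (simp add: steps_add)

text \<open>\<open>K\<close> are the arrays that may be read and \<open>V\<close> those that may be
  written. Distinctness of addresses is demanded wherever one of the two arrays is writable: that is
  what a store must not disturb. The stride makes the interleaved fields of the edge records look
  like separate arrays.\<close>

locale memory_layout =
  fixes w m :: nat and K V :: "nat set" and base stride len :: "nat \<Rightarrow> nat"
  assumes m: "m \<le> 2 ^ w"
    and in_memory: "k \<in> K \<Longrightarrow> i < len k \<Longrightarrow> base k + stride k * i < m"
    and stride_pos: "k \<in> K \<Longrightarrow> 0 < stride k" and stride_less: "k \<in> K \<Longrightarrow> stride k < 2 ^ w"
    and subset: "V \<subseteq> K"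
    and disjoint: "k \<in> V \<Longrightarrow> k' \<in> K \<Longrightarrow> i < len k \<Longrightarrow> i' < len k' \<Longrightarrow>
      base k + stride k * i = base k' + stride k' * i' \<Longrightarrow> k = k' \<and> i = i'"
begin

definition represents :: "regs \<Rightarrow> nat list \<Rightarrow> regs \<Rightarrow> arrays \<Rightarrow> bool" where
  "represents R' M R A \<longleftrightarrow> (\<forall>r < 50. R' r = R r) \<and> (\<forall>k \<in> K. R' (100 + k) = base k) \<and> length M = m \<and>
     (\<forall>k \<in> K. \<forall>i < len k. M ! (base k + stride k * i) = A k i)"

lemma representsD:
  assumes "represents R' M R A"
  shows "r < 50 \<Longrightarrow> R' r = R r" "k \<in> K \<Longrightarrow> R' (100 + k) = base k" "length M = m"
    "k \<in> K \<Longrightarrow> i < len k \<Longrightarrow> M ! (base k + stride k * i) = A k i"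
  using assms by (auto simp: represents_def)

lemma represents_upd: "represents R' M R A \<Longrightarrow> d < 50 \<Longrightarrow> represents (R'(d := x)) M (R(d := x)) A"
  by (auto simp: represents_def)

lemma represents_scratch: "represents R' M R A \<Longrightarrow> represents (R'(99 := x)) M R A"
  by (auto simp: represents_def)

lemma address:
  assumes "k \<in> K" "i < len k"
  shows "base k + stride k * i < 2 ^ w" "(stride k * i) mod 2 ^ w = stride k * i"
    "stride k mod 2 ^ w = stride k"
  using in_memory[OF assms] m stride_less[OF assms(1)] by auto

text \<open>A forward simulation. Since the costs of \<open>exec\<close> are exact instruction
  counts, the time carries over unchanged.\<close>

lemma compile_correct:
  assumes "exec (2 ^ w) len c R A t R1 A1" "well_formed K V c" "represents R' M R A"
    "code_at P pc (compile stride pc c)"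
  shows "\<exists>R1' M1. steps w P t (pc, R', M) = Some (pc + code_size c, R1', M1) \<and> represents R1' M1 R1 A1"
  using assms
proof (induction arbitrary: R' M pc rule: exec.induct)
  case (1 R A)
  then show ?case
    by auto
next
  case (2 k d R A)
  then have "represents (R'(d := k)) M (R(d := k)) A"
    by (intro represents_upd) auto
  moreover have "steps w P 1 (pc, R', M) = Some (pc + code_size (Set_reg d k), R'(d := k), M)"
    using 2 by (simp add: code_at_Cons)
  ultimately show ?case
    by blast
next
  case (3 R a b d A)
  then have "represents (R'(d := R a + R b)) M (R(d := R a + R b)) A"
    by (intro represents_upd) auto
  moreover have "steps w P 1 (pc, R', M) = Some (pc + code_size (Add_reg d a b), R'(d := R a + R b), M)"
    using 3 representsD(1)[OF 3(3)] by (simp add: code_at_Cons)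
  ultimately show ?case
    by blast
next
  case (4 R b a d A)
  have "(R a + 2 ^ w - R b) mod 2 ^ w = R a - R b"
    using 4(1,2) by (metis diff_add_assoc2 less_imp_diff_less mod_add_self2 mod_less)
  then have "steps w P 1 (pc, R', M) = Some (pc + code_size (Sub_reg d a b), R'(d := R a - R b), M)"
    using 4 representsD(1)[OF 4(4)] by (simp add: code_at_Cons)
  moreover have "represents (R'(d := R a - R b)) M (R(d := R a - R b)) A"
    using 4 by (intro represents_upd) auto
  ultimately show ?case
    by blast
next
  case (5 R a k d A)
  then have k: "k \<in> K" "a < 50" "d < 50"
    by auto
  note ad = address[OF k(1) 5(1)]
  have "represents (R'(99 := base k + stride k * R a, d := A k (R a))) M (R(d := A k (R a))) A"
    by (rule represents_upd[OF represents_scratch[OF 5(3)] k(3)])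
  moreover have "steps w P 4 (pc, R', M) =
      Some (pc + code_size (Read d k a), R'(99 := base k + stride k * R a, d := A k (R a)), M)"
    using 5(1,4) k ad representsD[OF 5(3)] in_memory[OF k(1) 5(1)]
    by (simp add: code_at_Cons steps_numeral add.commute)
  ultimately show ?case
    by blast
next
  case (6 R a k s A)
  then have k: "k \<in> V" "k \<in> K" "a < 50" "s < 50"
    using subset by auto
  note ad = address[OF k(2) 6(1)]
  let ?p = "base k + stride k * R a"
  have "represents R' (M[?p := R s]) R (A(k := (A k)(R a := R s)))"
    unfolding represents_def
  proof (intro conjI ballI allI impI)
    fix k' i' assume k': "k' \<in> K" "i' < len k'"
    show "M[?p := R s] ! (base k' + stride k' * i') = (A(k := (A k)(R a := R s))) k' i'"
      using disjoint[OF k(1) k'(1) 6(1) k'(2)] representsD(3,4)[OF 6(3)] k'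
        in_memory[OF k(2) 6(1)] by (auto simp: nth_list_update)
  qed (use representsD[OF 6(3)] in auto)
  moreover have "steps w P 4 (pc, R', M) =
      Some (pc + code_size (Write k a s), R'(99 := ?p), M[?p := R s])"
    using 6(4) k ad representsD[OF 6(3)] in_memory[OF k(2) 6(1)]
    by (simp add: code_at_Cons steps_numeral add.commute)
  ultimately show ?case
    using represents_scratch by blast
next
  case (7 c R A t R1 A1 c' t' R2 A2)
  have c: "code_at P pc (compile stride pc c)"
    "code_at P (pc + code_size c) (compile stride (pc + code_size c) c')"
    and wf: "well_formed K V c" "well_formed K V c'"
    using "7.prems" by (simp_all add: code_at_append)
  obtain R1' M1 where 1: "steps w P t (pc, R', M) = Some (pc + code_size c, R1', M1)"
    and rep: "represents R1' M1 R1 A1"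
    using "7.IH"(1)[OF wf(1) "7.prems"(2) c(1)] by blast
  obtain R2' M2 where 2: "steps w P t' (pc + code_size c, R1', M1) =
      Some (pc + code_size c + code_size c', R2', M2)" and rep2: "represents R2' M2 R2 A2"
    using "7.IH"(2)[OF wf(2) rep c(2)] by blast
  from steps_addI[OF 1 2] have "steps w P (t + t') (pc, R', M) = Some (pc + code_size (c ;; c'), R2', M2)"
    by (simp add: add.assoc)
  then show ?case
    using rep2 by blast
next
  case (8 R a b c A t R1 A1 c')
  have 1: "steps w P 1 (pc, R', M) = Some (pc + code_size c' + 2, R', M)"
    using 8(1) "8.prems" representsD(1)[OF "8.prems"(2)] by (simp add: code_at_Cons)
  have c: "code_at P (pc + code_size c' + 2) (compile stride (pc + code_size c' + 2) c)"
    and wf: "well_formed K V c"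
    using "8.prems" by (simp_all add: code_at_append code_at_Cons add.commute)
  obtain R1' M1 where 2: "steps w P t (pc + code_size c' + 2, R', M) =
      Some (pc + code_size c' + 2 + code_size c, R1', M1)" and rep: "represents R1' M1 R1 A1"
    using "8.IH"[OF wf "8.prems"(2) c] by blast
  from steps_addI[OF 1 2] have "steps w P (t + 1) (pc, R', M) =
      Some (pc + code_size (If_eq a b c c'), R1', M1)"
    by (simp add: ac_simps)
  then show ?case
    using rep by blast
next
  case (9 R a b c' A t R1 A1 c)
  have 1: "steps w P 1 (pc, R', M) = Some (pc + 1, R', M)"
    using 9(1) "9.prems" representsD(1)[OF "9.prems"(2)] by (simp add: code_at_Cons)
  have c: "code_at P (pc + 1) (compile stride (pc + 1) c')" and wf: "well_formed K V c'"
    using "9.prems" by (simp_all add: code_at_append code_at_Cons)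
  obtain R1' M1 where 2: "steps w P t (pc + 1, R', M) = Some (pc + 1 + code_size c', R1', M1)"
    and rep: "represents R1' M1 R1 A1"
    using "9.IH"[OF wf "9.prems"(2) c] by blast
  have 3: "steps w P 1 (pc + 1 + code_size c', R1', M1) =
      Some (pc + code_size c' + 2 + code_size c, R1', M1)"
    using "9.prems"(3) by (simp add: code_at_append code_at_Cons)
  from steps_addI[OF steps_addI[OF 1 2] 3] have "steps w P (t + 2) (pc, R', M) =
      Some (pc + code_size (If_eq a b c c'), R1', M1)"
    by (simp add: ac_simps)
  then show ?case
    using rep by blast
next
  case (10 R a b c A t R1 A1 t' R2 A2)
  have 1: "steps w P 1 (pc, R', M) = Some (pc + 2, R', M)"
    using 10(1) "10.prems" representsD(1)[OF "10.prems"(2)] by (simp add: code_at_Cons)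
  have c: "code_at P (pc + 2) (compile stride (pc + 2) c)" and wf: "well_formed K V c"
    using "10.prems" by (simp_all add: code_at_append code_at_Cons)
  obtain R1' M1 where 2: "steps w P t (pc + 2, R', M) = Some (pc + 2 + code_size c, R1', M1)"
    and rep: "represents R1' M1 R1 A1"
    using "10.IH"(1)[OF wf "10.prems"(2) c] by blast
  have 3: "steps w P 1 (pc + 2 + code_size c, R1', M1) = Some (pc, R1', M1)"
    using "10.prems"(3) by (simp add: code_at_append code_at_Cons)
  obtain R2' M2 where 4: "steps w P t' (pc, R1', M1) = Some (pc + code_size (While_less a b c), R2', M2)"
    and rep2: "represents R2' M2 R2 A2"
    using "10.IH"(2)[OF "10.prems"(1) rep "10.prems"(3)] by blast
  have "1 + t + 1 + t' = t + t' + 2"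
    by simp
  then have "steps w P (t + t' + 2) (pc, R', M) = Some (pc + code_size (While_less a b c), R2', M2)"
    using steps_addI[OF steps_addI[OF steps_addI[OF 1 2] 3] 4] by metis
  then show ?case
    using rep2 by blast
next
  case (11 R a b c A)
  have "steps w P 2 (pc, R', M) = Some (pc + code_size (While_less a b c), R', M)"
    using 11 representsD(1)[OF 11(3)] by (simp add: code_at_Cons steps_numeral)
  then show ?case
    using 11(3) by blast
qed

end

section \<open>Counting paths to the sink\<close>

abbreviation (input) "rN \<equiv> 2 :: nat"
abbreviation (input) "rE \<equiv> 3 :: nat"
abbreviation (input) "rRoot \<equiv> 4 :: nat"
abbreviation (input) "rSink \<equiv> 5 :: nat"
abbreviation (input) "rZero \<equiv> 6 :: nat"
abbreviation (input) "rOne \<equiv> 7 :: nat"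
abbreviation (input) "rI \<equiv> 8 :: nat"
abbreviation (input) "rX \<equiv> 9 :: nat"
abbreviation (input) "rY \<equiv> 10 :: nat"
abbreviation (input) "rHead \<equiv> 11 :: nat"
abbreviation (input) "rTail \<equiv> 12 :: nat"
abbreviation (input) "rV \<equiv> 13 :: nat"
abbreviation (input) "rP \<equiv> 14 :: nat"
abbreviation (input) "rEnd \<equiv> 15 :: nat"
abbreviation (input) "rF \<equiv> 16 :: nat"
abbreviation (input) "rU \<equiv> 17 :: nat"
abbreviation (input) "rSym \<equiv> 18 :: nat"
abbreviation (input) "rCnt \<equiv> 19 :: nat"
abbreviation (input) "rFin \<equiv> 20 :: nat"
abbreviation (input) "rTop \<equiv> 21 :: nat"
abbreviation (input) "rOut \<equiv> 22 :: nat"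
abbreviation (input) "rRuns \<equiv> 23 :: nat"
abbreviation (input) "rD \<equiv> 24 :: nat"

abbreviation (input) "aOutOff \<equiv> 0 :: nat"
abbreviation (input) "aInOff \<equiv> 1 :: nat"
abbreviation (input) "aSrc \<equiv> 2 :: nat"
abbreviation (input) "aSymbol \<equiv> 3 :: nat"
abbreviation (input) "aTgt \<equiv> 4 :: nat"
abbreviation (input) "aIns \<equiv> 5 :: nat"
abbreviation (input) "aDeg \<equiv> 6 :: nat"
abbreviation (input) "aCnt \<equiv> 7 :: nat"
abbreviation (input) "aQueue \<equiv> 8 :: nat"
abbreviation (input) "aSym \<equiv> 9 :: nat"
abbreviation (input) "aPos \<equiv> 10 :: nat"
abbreviation (input) "aStack \<equiv> 11 :: nat"
abbreviation (input) "aOut \<equiv> 12 :: nat"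

definition init_degrees :: com where
  "init_degrees =
     Set_reg rI 0 ;;
     While_less rI rN (
       Read rX aOutOff rI ;; Add_reg rY rI rOne ;; Read rY aOutOff rY ;; Sub_reg rY rY rX ;;
       Write aDeg rI rY ;; Write aCnt rI rZero ;; Add_reg rI rI rOne)"

definition process_in_edges :: com where
  "process_in_edges =
     While_less rP rEnd (
       Read rF aIns rP ;; Read rU aSrc rF ;;
       Read rX aCnt rU ;; Add_reg rX rX rY ;; Write aCnt rU rX ;;
       Read rX aDeg rU ;; Sub_reg rX rX rOne ;; Write aDeg rU rX ;;
       If_eq rX rZero (Write aQueue rTail rU ;; Add_reg rTail rTail rOne) Skip ;;
       Add_reg rP rP rOne)"

definition count_paths :: com where
  "count_paths =
     Write aCnt rSink rOne ;; Set_reg rHead 0 ;; Write aQueue rHead rSink ;; Set_reg rTail 1 ;;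
     While_less rHead rTail (
       Read rV aQueue rHead ;; Add_reg rHead rHead rOne ;; Read rY aCnt rV ;;
       Read rP aInOff rV ;; Add_reg rEnd rV rOne ;; Read rEnd aInOff rEnd ;;
       process_in_edges)"

context edge_graph
begin

lemma out_edges: "{f. f < E \<and> src f = k} = {oo k..<oo (Suc k)}"
proof (rule set_eqI)
  fix f show "f \<in> {f. f < E \<and> src f = k} \<longleftrightarrow> f \<in> {oo k..<oo (Suc k)}"
    using oo_iff[of f k] oo_le[of "Suc k"] by (cases "f < E") auto
qed

lemma sink_no_out: "f < E \<Longrightarrow> src f \<noteq> sk"
  using oo_iff[of f sk] out_edge[OF sk] oo_mono[of sk] by auto

lemma ins_lt: "p < E \<Longrightarrow> ins p < E"
  using ins_bij by (auto simp: bij_betw_def)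

lemma ins_inj: "p < E \<Longrightarrow> q < E \<Longrightarrow> ins p = ins q \<Longrightarrow> p = q"
  using ins_bij by (auto simp: bij_betw_def inj_on_def)

lemma ins_surj: "f < E \<Longrightarrow> \<exists>p < E. ins p = f"
  using ins_bij unfolding bij_betw_def by (metis imageE lessThan_iff)

lemma in_edges: "ins ` {io k..<io (Suc k)} = {f. f < E \<and> tgt f = k}"
proof (intro set_eqI iffI)
  fix f assume "f \<in> ins ` {io k..<io (Suc k)}"
  then show "f \<in> {f. f < E \<and> tgt f = k}"
    using io_iff[of _ k] io_le[of "Suc k"] ins_lt by auto
next
  fix f assume "f \<in> {f. f < E \<and> tgt f = k}"
  then obtain p where "p < E" "ins p = f" "tgt f = k"
    using ins_surj by auto
  then show "f \<in> ins ` {io k..<io (Suc k)}"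
    using io_iff[of p k] by auto
qed

text \<open>Every node but the root is the target of an edge. This turns bounds in the number of
  nodes into bounds in the number of edges.\<close>

lemma N_le: "N \<le> Suc E"
proof -
  have "{..<N} \<subseteq> insert rt (tgt ` {..<E})"
  proof
    fix k assume k: "k \<in> {..<N}"
    show "k \<in> insert rt (tgt ` {..<E})"
    proof (cases "k = rt")
      case False
      then have "io k < E" "tgt (ins (io k)) = k"
        using k in_edge[of k] io_iff[of "io k" k] io_le[of "Suc k"] by auto
      then show ?thesis
        using ins_lt[of "io k"] by (metis image_eqI insertI2 lessThan_iff)
    qed simp
  qed
  then have "card {..<N} \<le> card (insert rt (tgt ` {..<E}))"
    by (intro card_mono) auto
  also have "\<dots> \<le> Suc (card (tgt ` {..<E}))"
    by (simp add: card_insert_if)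
  also have "\<dots> \<le> Suc E"
    using card_image_le[of "{..<E}" tgt] by simp
  finally show ?thesis
    by simp
qed

text \<open>Kahn's algorithm on the reversed graph: \<open>q\<close> is the queue, \<open>F\<close> the set of the edges already processed,
  \<open>deg u\<close> the number of unprocessed edges leaving \<open>u\<close> and \<open>cn u\<close> the number of paths found so far.\<close>

definition kahn :: "nat list \<Rightarrow> nat set \<Rightarrow> (nat \<Rightarrow> nat) \<Rightarrow> (nat \<Rightarrow> nat) \<Rightarrow> bool" where
  "kahn q F deg cn \<longleftrightarrow> distinct q \<and> set q \<subseteq> {..<N} \<and> F \<subseteq> {..<E} \<and> (\<forall>f \<in> F. tgt f \<in> set q) \<and>
     (\<forall>u < N. deg u = card ({f. f < E \<and> src f = u} - F)) \<and>
     (\<forall>u < N. cn u = (if u = sk then 1 else 0) + (\<Sum>f \<in> {f. f < E \<and> src f = u} \<inter> F. cnt (tgt f))) \<and>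
     (\<forall>u < N. u \<in> set q \<longleftrightarrow> deg u = 0) \<and>
     (\<forall>i < length q. \<forall>f < E. src f = q ! i \<longrightarrow> tgt f \<in> set (take i q))"

lemma kahnD:
  assumes "kahn q F deg cn"
  shows "distinct q" "set q \<subseteq> {..<N}" "F \<subseteq> {..<E}" "f \<in> F \<Longrightarrow> tgt f \<in> set q"
    "u < N \<Longrightarrow> deg u = card ({f. f < E \<and> src f = u} - F)"
    "u < N \<Longrightarrow> cn u = (if u = sk then 1 else 0) + (\<Sum>f \<in> {f. f < E \<and> src f = u} \<inter> F. cnt (tgt f))"
    "u < N \<Longrightarrow> u \<in> set q \<longleftrightarrow> deg u = 0"
    "i < length q \<Longrightarrow> f < E \<Longrightarrow> src f = q ! i \<Longrightarrow> tgt f \<in> set (take i q)"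
  using assms by (simp_all add: kahn_def)

lemma kahn_init:
  assumes "\<And>u. u < N \<Longrightarrow> deg u = oo (Suc u) - oo u" "\<And>u. u < N \<Longrightarrow> cn u = (if u = sk then 1 else 0)"
  shows "kahn [sk] {} deg cn"
  unfolding kahn_def
proof (intro conjI allI impI)
  fix u assume u: "u < N"
  show "deg u = card ({f. f < E \<and> src f = u} - {})"
    unfolding out_edges using assms(1)[OF u] by simp
  show "u \<in> set [sk] \<longleftrightarrow> deg u = 0"
    using out_edge[OF u] assms(1)[OF u] by auto
qed (use sk assms sink_no_out in auto)

text \<open>A queued node has no unprocessed leaving edge, so the sum collected for it is
  complete.\<close>

lemma kahn_cnt:
  assumes "kahn q F deg cn" "v \<in> set q"
  shows "cn v = cnt v"
proof -
  have v: "v < N"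
    using kahnD(2)[OF assms(1)] assms(2) by auto
  then have "deg v = 0"
    using kahnD(7)[OF assms(1) v] assms(2) by simp
  then have "{f. f < E \<and> src f = v} - F = {}"
    using kahnD(5)[OF assms(1) v] by simp
  then have "{f. f < E \<and> src f = v} \<inter> F = {oo v..<oo (Suc v)}"
    unfolding out_edges by blast
  then have "cn v = (if v = sk then 1 else 0) + (\<Sum>f = oo v..<oo (Suc v). cnt (tgt f))"
    using kahnD(6)[OF assms(1) v] by simp
  then show ?thesis
    using cnt_sk cnt_sum[OF v] out_edge[OF sk] oo_mono[of sk] by auto
qed

text \<open>A partial sum is bounded by the complete one. This keeps the additions of the program
  from overflowing before a count is final.\<close>

lemma kahn_le:
  assumes "kahn q F deg cn" "u < N"
  shows "cn u \<le> n"
proof (cases "u = sk")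
  case True
  then have "{f. f < E \<and> src f = u} \<inter> F = {}"
    using sink_no_out by auto
  then have "cn u = cnt sk"
    using kahnD(6)[OF assms] True cnt_sk by simp
  then show ?thesis
    using cnt_le by simp
next
  case False
  then have "cn u = (\<Sum>f \<in> {f. f < E \<and> src f = u} \<inter> F. cnt (tgt f))"
    using kahnD(6)[OF assms] by simp
  also have "\<dots> \<le> (\<Sum>f = oo u..<oo (Suc u). cnt (tgt f))"
    unfolding out_edges by (intro sum_mono2) auto
  also have "\<dots> = cnt u"
    using cnt_sum[OF assms(2) False] by simp
  also have "\<dots> \<le> n"
    by (rule cnt_le)
  finally show ?thesis .
qed

lemma kahn_step:
  assumes k: "kahn q F deg cn" and f: "f < E" "f \<notin> F" "tgt f \<in> set q" and u: "u = src f"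
  shows "0 < deg u"
    and "kahn (if deg u - 1 = 0 then q @ [u] else q) (insert f F) (deg(u := deg u - 1))
      (cn(u := cn u + cnt (tgt f)))"
proof -
  have uN: "u < N"
    using src f u by blast
  have deg: "deg u = card ({f. f < E \<and> src f = u} - F)"
    by (rule kahnD(5)[OF k uN])
  have fin: "finite ({f. f < E \<and> src f = u} - F)"
    by simp
  have f_in: "f \<in> {f. f < E \<and> src f = u} - F"
    using f u by simp
  show pos: "0 < deg u"
    unfolding deg using fin f_in by (auto simp: card_gt_0_iff)
  have u_notin: "u \<notin> set q"
    using kahnD(7)[OF k uN] pos by simp
  have deg': "deg u - 1 = card ({f. f < E \<and> src f = u} - insert f F)"
  proof -
    have "{f. f < E \<and> src f = u} - insert f F = {f. f < E \<and> src f = u} - F - {f}"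
      by blast
    then show ?thesis
      using card_Diff_singleton[OF f_in] deg by (simp only:)
  qed
  have all: "tgt g \<in> set q" if "deg u - 1 = 0" "g < E" "src g = u" for g
  proof -
    have "{f. f < E \<and> src f = u} - insert f F = {}"
      using deg' that(1) by simp
    then have "g = f \<or> g \<in> F"
      using that by blast
    then show ?thesis
      using f kahnD(4)[OF k] by auto
  qed
  let ?q = "if deg u - 1 = 0 then q @ [u] else q"
  show "kahn ?q (insert f F) (deg(u := deg u - 1)) (cn(u := cn u + cnt (tgt f)))"
    unfolding kahn_def
  proof (intro conjI allI impI ballI)
    show "distinct ?q" "set ?q \<subseteq> {..<N}" "insert f F \<subseteq> {..<E}"
      using kahnD(1-3)[OF k] uN u_notin f by auto
    show "tgt g \<in> set ?q" if "g \<in> insert f F" for g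
      using kahnD(4)[OF k] f that by auto
    fix u' assume u': "u' < N"
    show "(deg(u := deg u - 1)) u' = card ({f. f < E \<and> src f = u'} - insert f F)"
    proof (cases "u' = u")
      case False
      then have "{f. f < E \<and> src f = u'} - insert f F = {f. f < E \<and> src f = u'} - F"
        using u by auto
      then show ?thesis
        using kahnD(5)[OF k u'] False by simp
    qed (use deg' in simp)
    show "(cn(u := cn u + cnt (tgt f))) u' = (if u' = sk then 1 else 0) +
        (\<Sum>f \<in> {f. f < E \<and> src f = u'} \<inter> insert f F. cnt (tgt f))"
    proof (cases "u' = u")
      case False
      then have "{f. f < E \<and> src f = u'} \<inter> insert f F = {f. f < E \<and> src f = u'} \<inter> F"
        using u by auto
      then show ?thesis
        using kahnD(6)[OF k u'] False by simp
    next
      case True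
      have "{f. f < E \<and> src f = u} \<inter> insert f F = insert f ({f. f < E \<and> src f = u} \<inter> F)"
        using f_in by auto
      then show ?thesis
        using kahnD(6)[OF k u'] True f(2) by simp
    qed
    show "u' \<in> set ?q \<longleftrightarrow> (deg(u := deg u - 1)) u' = 0"
      using kahnD(7)[OF k u'] u_notin pos by auto
  next
    fix i g assume i: "i < length ?q" "g < E" "src g = ?q ! i"
    show "tgt g \<in> set (take i ?q)"
    proof (cases "i < length q")
      case True
      then show ?thesis
        using kahnD(8)[OF k True] i by (auto simp: nth_append split: if_splits)
    next
      case False
      then have "deg u - 1 = 0" "i = length q"
        using i by (auto split: if_splits)
      then show ?thesis
        using all[of g] i by simp
    qed
  qed
qed

text \<open>An unqueued node of maximal rank would have an unprocessed edge, whose target is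
  unqueued too but of larger rank.\<close>

lemma kahn_final:
  assumes k: "kahn q F deg cn" and F: "\<And>f. f < E \<Longrightarrow> tgt f \<in> set q \<Longrightarrow> f \<in> F"
  shows "set q = {..<N}"
proof (rule ccontr)
  assume "set q \<noteq> {..<N}"
  then obtain u where "u < N \<and> u \<notin> set q"
    using kahnD(2)[OF k] by auto
  moreover have "finite (rank ` {..<N})"
    by simp
  then obtain b where "\<And>u. u < N \<Longrightarrow> rank u < b"
    unfolding finite_nat_set_iff_bounded by blast
  ultimately obtain u where u: "u < N" "u \<notin> set q"
    and max: "\<And>v. v < N \<Longrightarrow> v \<notin> set q \<Longrightarrow> rank v \<le> rank u"
    using ex_has_greatest_nat[of "\<lambda>u. u < N \<and> u \<notin> set q" u rank b] by (meson less_imp_le)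
  have "card ({f. f < E \<and> src f = u} - F) \<noteq> 0"
    using kahnD(5,7)[OF k u(1)] u(2) by simp
  then obtain f where f: "f < E" "src f = u" "f \<notin> F"
    by (auto simp: card_eq_0_iff)
  then have "tgt f \<notin> set q"
    using F by blast
  then show False
    using max[OF tgt[OF f(1)]] rank[OF f(1)] f(2) by simp
qed

end

section \<open>Correctness of the path counting program\<close>

locale rlbwt_algorithm = edge_graph +
  fixes W :: nat and len :: "nat \<Rightarrow> nat"
  assumes W_n: "n < W" and W_E: "2 * E + 2 < W"
    and len: "len 0 = Suc N" "len 1 = Suc N" "len 2 = E" "len 3 = E" "len 4 = E" "len 5 = E"
    and len_work: "6 \<le> k \<Longrightarrow> len k = 2 * E + 2"
begin

text \<open>The numbering puts everything that stays constant first: the registers up to 7 and the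
  arrays up to 5. So updates of higher numbers preserve this predicate by simplification.\<close>

definition static :: "regs \<Rightarrow> arrays \<Rightarrow> bool" where
  "static R A \<longleftrightarrow> R rN = N \<and> R rE = E \<and> R rRoot = rt \<and> R rSink = sk \<and> R rZero = 0 \<and> R rOne = 1 \<and>
     (\<forall>i \<le> N. A aOutOff i = oo i \<and> A aInOff i = io i) \<and>
     (\<forall>f < E. A aSrc f = src f \<and> A aSymbol f = hdf f \<and> A aTgt f = tgt f \<and> A aIns f = ins f)"

lemma static_upd [simp]:
  "8 \<le> d \<Longrightarrow> static (R(d := x)) A \<longleftrightarrow> static R A"
  "6 \<le> k \<Longrightarrow> static R (A(k := g)) \<longleftrightarrow> static R A"
  by (auto simp: static_def)

lemma staticD:
  assumes "static R A"
  shows "R rN = N" "R rE = E" "R rRoot = rt" "R rSink = sk" "R rZero = 0" "R rOne = 1" "R rOne = Suc 0"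
    "i \<le> N \<Longrightarrow> A aOutOff i = oo i" "i \<le> N \<Longrightarrow> A aInOff i = io i" "i \<le> N \<Longrightarrow> A (Suc 0) i = io i"
    "f < E \<Longrightarrow> A aSrc f = src f" "f < E \<Longrightarrow> A aSymbol f = hdf f"
    "f < E \<Longrightarrow> A aTgt f = tgt f" "f < E \<Longrightarrow> A aIns f = ins f"
  using assms by (auto simp: static_def)

lemma init_degrees_correct:
  assumes "static R A"
    and "\<And>R' A' t'. static R' A' \<Longrightarrow> (\<And>u. u < N \<Longrightarrow> A' aDeg u = oo (Suc u) - oo u \<and> A' aCnt u = 0) \<Longrightarrow>
      t' \<le> t + 30 * N + 10 \<Longrightarrow> Q R' A' t'"
  shows "wp W len init_degrees Q R A t"
proof -
  define I where "I R A t' \<longleftrightarrow> static R A \<and> R rI \<le> N \<and>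
    (\<forall>u < R rI. A aDeg u = oo (Suc u) - oo u \<and> A aCnt u = 0) \<and> t' \<le> t + 1 + 30 * R rI"
    for R A t'
  show ?thesis
    unfolding init_degrees_def wp_Seq wp_simps
  proof (intro conjI wp_While[where I = I and m = "\<lambda>R A. N - R rI"])
    show "0 < W"
      using W_E by simp
    show "I (R(rI := 0)) A (t + 1)"
      using assms(1) by (simp add: I_def)
  next
    fix R A t' assume I: "I R A t'" "R rI < R rN"
    then have s: "static R A"
      by (simp add: I_def)
    have i: "R rI < N" "Suc (R rI) \<le> N" "Suc (R rI) < W" "oo (R rI) \<le> oo (Suc (R rI))" "oo (Suc (R rI)) < W" "R rI < 2 * E + 2"
      using I(2) staticD[OF s] N_le W_E oo_mono[of "R rI"] oo_le[of "Suc (R rI)"] by auto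
    show "wp W len (Read rX aOutOff rI ;; Add_reg rY rI rOne ;; Read rY aOutOff rY ;; Sub_reg rY rY rX ;;
       Write aDeg rI rY ;; Write aCnt rI rZero ;; Add_reg rI rI rOne)
       (\<lambda>R' A' t'. I R' A' t' \<and> N - R' rI < N - R rI) R A (t' + 2)"
      using I(1) i by (simp add: I_def staticD[OF s] len len_work All_less_Suc diff_less_mono2)
  next
    fix R A t' assume "I R A t'" "\<not> R rI < R rN"
    then show "Q R A (t' + 2)"
      using staticD(1)[of R A] by (intro assms(2)) (auto simp: I_def)
  qed
qed

end

context rlbwt_algorithm
begin

lemma len_1: "len (Suc 0) = Suc N"
  using len(2) by simp

lemma kahn_length:
  assumes "kahn q F deg cn"
  shows "length q \<le> N"
  using card_mono[OF _ kahnD(2)[OF assms]] distinct_card[OF kahnD(1)[OF assms]] by simp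

text \<open>\<open>G\<close> and \<open>F'\<close> are the processed edges before and after the
  loop. Each edge of the difference is charged 50 steps, so the total over all nodes is linear
  whatever the degrees are.\<close>

lemma process_in_edges_correct:
  assumes s0: "static R A" and tail: "R rTail = length q" and queue: "\<forall>i < length q. A aQueue i = q ! i"
    and h: "h < length q" and v: "v = q ! h" and regs: "R rY = cnt v" "R rP = io v" "R rEnd = io (Suc v)"
    and G: "G = {f. f < E \<and> tgt f \<in> set (take h q)}" and k: "kahn q G (A aDeg) (A aCnt)"
    and post: "\<And>R' A' t' q' F'. static R' A' \<Longrightarrow> R' rTail = length q' \<Longrightarrow>
      \<forall>i < length q'. A' aQueue i = q' ! i \<Longrightarrow> h < length q' \<Longrightarrow> R' rHead = R rHead \<Longrightarrow>
      F' = {f. f < E \<and> tgt f \<in> set (take (Suc h) q')} \<Longrightarrow> kahn q' F' (A' aDeg) (A' aCnt) \<Longrightarrow>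
      t' + 50 * card G \<le> t + 50 * card F' + 2 \<Longrightarrow> Q R' A' t'"
  shows "wp W len process_in_edges Q R A t"
proof -
  define F where "F p = G \<union> ins ` {io v..<p}" for p
  define I where "I R' A' t' \<longleftrightarrow> (\<exists>q'. static R' A' \<and> R' rTail = length q' \<and>
      (\<forall>i < length q'. A' aQueue i = q' ! i) \<and> h < length q' \<and> take (Suc h) q' = take (Suc h) q \<and>
      R' rY = cnt v \<and> R' rEnd = io (Suc v) \<and> io v \<le> R' rP \<and> R' rP \<le> io (Suc v) \<and> R' rHead = R rHead \<and>
      kahn q' (F (R' rP)) (A' aDeg) (A' aCnt) \<and>
      t' + 50 * card G \<le> t + 50 * card (F (R' rP)))" for R' A' t'
  have finite_F: "finite (F p)" for p
    by (simp add: F_def G)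
  \<comment> \<open>The queue is distinct, so no edge entering \<open>v\<close> is in
    \<open>G\<close> yet and each pass enlarges \<open>F\<close>.\<close>
  have v_notin: "v \<notin> set (take h q)"
    using kahnD(1)[OF k] h v by (metis Cons_nth_drop_Suc append_take_drop_id disjoint_insert(1)
      distinct_append list.simps(15))
  show ?thesis
    unfolding process_in_edges_def
  proof (rule wp_While[where I = I and m = "\<lambda>R A. io (Suc v) - R rP"])
    show "I R A t"
      unfolding I_def F_def using assms io_mono[of v] by (intro exI[of _ q]) simp
  next
    fix R1 A1 t1 assume I: "I R1 A1 t1" "R1 rP < R1 rEnd"
    then obtain q' where s: "static R1 A1" and q': "R1 rTail = length q'"
      "\<forall>i < length q'. A1 aQueue i = q' ! i" "h < length q'" "take (Suc h) q' = take (Suc h) q"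
      and r: "R1 rY = cnt v" "R1 rEnd = io (Suc v)" "io v \<le> R1 rP" "R1 rP \<le> io (Suc v)" "R1 rHead = R rHead"
      and k: "kahn q' (F (R1 rP)) (A1 aDeg) (A1 aCnt)"
      and t: "t1 + 50 * card G \<le> t + 50 * card (F (R1 rP))"
      unfolding I_def by blast
    define p where "p = R1 rP"
    define f where "f = ins p"
    define u where "u = src f"
    have p: "io v \<le> p" "p < io (Suc v)" "p < E"
      using r I(2) io_le[of "Suc v"] by (auto simp: p_def)
    have f: "f < E" "tgt f = v"
      using ins_lt[OF p(3)] io_iff[OF p(3)] p by (auto simp: f_def)
    have uN: "u < N"
      using src[OF f(1)] by (simp add: u_def)
    have f_notin: "f \<notin> F p"
      using f v_notin ins_inj p by (auto simp: F_def G f_def) (metis ins_inj less_irrefl less_trans p(3))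
    have "v = q' ! h"
      using q'(4) v h q'(3) by (metis lessI nth_take)
    then have vq: "tgt f \<in> set q'"
      using f q'(3) by simp
    let ?q = "if A1 aDeg u - 1 = 0 then q' @ [u] else q'"
    let ?D = "(A1 aDeg)(u := A1 aDeg u - 1)" and ?C = "(A1 aCnt)(u := A1 aCnt u + cnt v)"
    have FS: "F (Suc p) = insert f (F p)"
      using p by (auto simp: F_def f_def atLeastLessThanSuc)
    note step = kahn_step[OF k[folded p_def] f(1) f_notin vq u_def]
    have k': "kahn ?q (F (Suc p)) ?D ?C"
      using step(2) f FS by simp
    have pos: "0 < A1 aDeg u"
      by (rule step(1))
    have "card ({f. f < E \<and> src f = u} - F p) \<le> card {..<E}"
      by (intro card_mono) auto
    then have degE: "A1 aDeg u \<le> E"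
      using kahnD(5)[OF k uN] by (simp add: p_def)
    \<comment> \<open>The increased count belongs to a state that again satisfies the invariant,
      hence it is bounded by \<open>n\<close>.\<close>
    have cn: "A1 aCnt u + cnt v < W"
      using kahn_le[OF k' uN] W_n by simp
    have tk: "take (Suc h) (q' @ [u]) = take (Suc h) q'"
      using q'(3) by simp
    have len_q: "length ?q \<le> N"
      by (rule kahn_length[OF k'])
    have time: "t' + 50 * card G \<le> t + 50 * card (F (Suc p))" if "t' \<le> t1 + 50" for t'
      using t that f_notin finite_F[of p] FS by (simp add: p_def)
    have x: "A1 aIns p = f" "A1 aSrc f = u"
      using staticD(14)[OF s p(3)] staticD(11)[OF s f(1)] by (simp_all add: f_def u_def)
    have small: "p < E" "f < E" "u < 2 * E + 2" "Suc p < W" "A1 aDeg u < W" "length q' < 2 * E + 2"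
       "Suc (length q') < W" if "length q' \<le> N"
      using that p f uN N_le W_E degE by auto
    have lq': "length q' \<le> N"
      by (rule kahn_length[OF k])
    have I': "I R2 A2 t2" if "static R2 A2" "R2 rTail = length ?q" "\<forall>i < length ?q. A2 aQueue i = ?q ! i"
      "R2 rY = cnt v" "R2 rEnd = io (Suc v)" "R2 rP = Suc p" "R2 rHead = R rHead" "A2 aDeg = ?D" "A2 aCnt = ?C"
      "t2 \<le> t1 + 50" for R2 A2 t2
      unfolding I_def
      using that q' p k' time[of t2] tk by (intro exI[of _ ?q]) auto
    show "wp W len
       (Read rF aIns rP ;; Read rU aSrc rF ;;
       Read rX aCnt rU ;; Add_reg rX rX rY ;; Write aCnt rU rX ;;
       Read rX aDeg rU ;; Sub_reg rX rX rOne ;; Write aDeg rU rX ;;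
       If_eq rX rZero (Write aQueue rTail rU ;; Add_reg rTail rTail rOne) Skip ;;
       Add_reg rP rP rOne)
       (\<lambda>R' A' t'. I R' A' t' \<and> io (Suc v) - R' rP < io (Suc v) - R1 rP) R1 A1 (t1 + 2)"
    proof (cases "A1 aDeg u - 1 = 0")
      case True
      then have one: "A1 aDeg u = Suc 0"
        using pos by simp
      have queue': "\<forall>i < length (q' @ [u]). ((A1 aQueue)(length q' := u)) i = (q' @ [u]) ! i"
        using q'(2) by (auto simp: nth_append less_Suc_eq)
      show ?thesis
        by (use small[OF lq'] p pos cn r q' in
            \<open>simp add: staticD[OF s] len len_work x p_def[symmetric] one\<close>, intro conjI, rule I')
          (use s queue' one in \<open>simp_all add: diff_less_mono2\<close>)
    next
      case False
      show ?thesis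
        by (use False small[OF lq'] p pos cn r q' in
            \<open>simp add: staticD[OF s] len len_work x p_def[symmetric]\<close>, intro conjI, rule I')
          (use False s in \<open>simp_all add: diff_less_mono2\<close>)
    qed
  next
    fix R1 A1 t1 assume I: "I R1 A1 t1" "\<not> R1 rP < R1 rEnd"
    then obtain q' where s: "static R1 A1" and q': "R1 rTail = length q'"
      "\<forall>i < length q'. A1 aQueue i = q' ! i" "h < length q'" "take (Suc h) q' = take (Suc h) q"
      and r: "R1 rHead = R rHead" "R1 rP = io (Suc v)"
      and k: "kahn q' (F (io (Suc v))) (A1 aDeg) (A1 aCnt)"
      and t: "t1 + 50 * card G \<le> t + 50 * card (F (io (Suc v)))"
      unfolding I_def by force
    have "F (io (Suc v)) = {f. f < E \<and> tgt f \<in> set (take (Suc h) q')}"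
      unfolding F_def in_edges G q'(4) using h v by (auto simp: take_Suc_conv_app_nth)
    then show "Q R1 A1 (t1 + 2)"
      using s q' r k t by (intro post) auto
  qed
qed

text \<open>Besides the counts, the queue itself is handed on: read backwards it is a topological
  order, which the computation of the first symbols reuses.\<close>

lemma count_paths_correct:
  assumes s0: "static R A" and init: "\<And>u. u < N \<Longrightarrow> A aDeg u = oo (Suc u) - oo u \<and> A aCnt u = 0"
    and post: "\<And>R' A' t' q. static R' A' \<Longrightarrow> distinct q \<Longrightarrow> set q = {..<N} \<Longrightarrow> length q = N \<Longrightarrow>
      \<forall>i < N. A' aQueue i = q ! i \<Longrightarrow> \<forall>i < N. \<forall>f < E. src f = q ! i \<longrightarrow> tgt f \<in> set (take i q) \<Longrightarrow>
      \<forall>u < N. A' aCnt u = cnt u \<Longrightarrow> t' \<le> t + 50 * N + 50 * E + 20 \<Longrightarrow> Q R' A' t'"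
  shows "wp W len count_paths Q R A t"
proof -
  define I where "I R' A' t' \<longleftrightarrow> (\<exists>q F. static R' A' \<and> R' rTail = length q \<and>
      (\<forall>i < length q. A' aQueue i = q ! i) \<and> R' rHead \<le> length q \<and>
      F = {f. f < E \<and> tgt f \<in> set (take (R' rHead) q)} \<and> kahn q F (A' aDeg) (A' aCnt) \<and>
      t' \<le> t + 10 + 50 * R' rHead + 50 * card F)" for R' A' t'
  have "kahn [sk] {} (A aDeg) ((A aCnt)(sk := 1))"
    using init sk by (intro kahn_init) auto
  then have I0: "I (R(rHead := 0, rTail := 1)) (A(aCnt := (A aCnt)(sk := 1), aQueue := (A aQueue)(0 := sk))) (10 + t)"
    unfolding I_def using s0 by (intro exI[of _ "[sk]"] exI[of _ "{}"]) simp
  have W0: "0 < W" "1 < W" "Suc 0 < W" "sk < 2 * E + 2"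
    using W_E sk N_le by auto
  have "wp W len (While_less rHead rTail (
       Read rV aQueue rHead ;; Add_reg rHead rHead rOne ;; Read rY aCnt rV ;;
       Read rP aInOff rV ;; Add_reg rEnd rV rOne ;; Read rEnd aInOff rEnd ;;
       process_in_edges)) Q (R(rHead := 0, rTail := 1))
       (A(aCnt := (A aCnt)(sk := 1), aQueue := (A aQueue)(0 := sk))) (10 + t)"
  proof (rule wp_While[where I = I and m = "\<lambda>R A. N - R rHead"])
    fix R1 A1 t1 assume I: "I R1 A1 t1" "R1 rHead < R1 rTail"
    then obtain q F where s: "static R1 A1" and q: "R1 rTail = length q"
      "\<forall>i < length q. A1 aQueue i = q ! i"
      and F: "F = {f. f < E \<and> tgt f \<in> set (take (R1 rHead) q)}" and k: "kahn q F (A1 aDeg) (A1 aCnt)"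
      and t: "t1 \<le> t + 10 + 50 * R1 rHead + 50 * card F"
      unfolding I_def by blast
    define h where "h = R1 rHead"
    define v where "v = q ! h"
    have h: "h < length q" "h < N"
      using I(2) q kahn_length[OF k] by (auto simp: h_def)
    have v: "v \<in> set q" "v < N"
      using h kahnD(2)[OF k] by (auto simp: v_def subset_iff)
    have vals: "A1 aQueue h = v" "A1 aCnt v = cnt v"
      using q h kahn_cnt[OF k v(1)] by (auto simp: v_def)
    have small: "h < 2 * E + 2" "Suc h < W" "v < 2 * E + 2" "Suc v < W" "v < Suc N" "Suc v < Suc N" "Suc v \<le> N" "v \<le> N"
      using h v N_le W_E by auto
    let ?R = "R1(rV := v, rHead := Suc h, rY := cnt v, rP := io v, rEnd := Suc v, rEnd := io (Suc v))"
    have "wp W len process_in_edges (\<lambda>R' A' t'. I R' A' t' \<and> N - R' rHead < N - h) ?R A1 (20 + t1)"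
    proof (rule process_in_edges_correct[where q = q and h = h and v = v and G = F])
      fix R' A' t' q' F'
      assume *: "static R' A'" "R' rTail = length q'" "\<forall>i < length q'. A' aQueue i = q' ! i"
        "h < length q'" "R' rHead = ?R rHead" "F' = {f. f < E \<and> tgt f \<in> set (take (Suc h) q')}"
        "kahn q' F' (A' aDeg) (A' aCnt)" "t' + 50 * card F \<le> 20 + t1 + 50 * card F' + 2"
      then have "I R' A' t'"
        unfolding I_def using t by (intro exI[of _ q'] exI[of _ F']) (simp add: h_def)
      then show "I R' A' t' \<and> N - R' rHead < N - h"
        using * h by simp
    qed (use s q h F k in \<open>simp_all add: v_def h_def\<close>)
    then show "wp W len (
       Read rV aQueue rHead ;; Add_reg rHead rHead rOne ;; Read rY aCnt rV ;;
       Read rP aInOff rV ;; Add_reg rEnd rV rOne ;; Read rEnd aInOff rEnd ;;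
       process_in_edges) (\<lambda>R' A' t'. I R' A' t' \<and> N - R' rHead < N - R1 rHead) R1 A1 (t1 + 2)"
      using small by (simp add: staticD[OF s] len len_1 len_work vals h_def[symmetric])
  next
    fix R1 A1 t1 assume I: "I R1 A1 t1" "\<not> R1 rHead < R1 rTail"
    then obtain q F where s: "static R1 A1" and q: "\<forall>i < length q. A1 aQueue i = q ! i"
      and F: "F = {f. f < E \<and> tgt f \<in> set q}" and k: "kahn q F (A1 aDeg) (A1 aCnt)"
      and t: "t1 \<le> t + 10 + 50 * length q + 50 * card F"
      unfolding I_def by force
    have set_q: "set q = {..<N}"
      by (rule kahn_final[OF k]) (simp add: F)
    then have len_q: "length q = N"
      using distinct_card[OF kahnD(1)[OF k]] by simp
    have "card F \<le> card {..<E}"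
      unfolding F by (intro card_mono) auto
    then have "t1 + 2 \<le> t + 50 * N + 50 * E + 20"
      using t len_q by simp
    then show "Q R1 A1 (t1 + 2)"
      using s set_q len_q q kahnD(1)[OF k] kahnD(8)[OF k] kahn_cnt[OF k] by (intro post) auto
  qed (rule I0)
  then show ?thesis
    unfolding count_paths_def using W0 by (simp add: staticD[OF s0] len_work)
qed

end

section \<open>First symbols and the lexicographic traversal\<close>

definition expand :: "('a \<times> nat) list \<Rightarrow> 'a list" where
  "expand ps = concat (map (\<lambda>(c, k). replicate k c) ps)"

definition is_rle :: "('a \<times> nat) list \<Rightarrow> bool" where
  "is_rle ps \<longleftrightarrow> (\<forall>(c, k) \<in> set ps. 0 < k) \<and> distinct_adj (map fst ps)"

definition add_run :: "('a \<times> nat) list \<Rightarrow> 'a \<Rightarrow> nat \<Rightarrow> ('a \<times> nat) list" where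
  "add_run ps c k =
     (if ps \<noteq> [] \<and> fst (last ps) = c then butlast ps @ [(c, snd (last ps) + k)] else ps @ [(c, k)])"

lemma run_length_encode_replicate:
  assumes "run_length_encode xs = ps" "ps = [] \<or> fst (hd ps) \<noteq> c"
  shows "run_length_encode (replicate (Suc k) c @ xs) = (c, Suc k) # ps"
proof (induction k)
  case 0
  then show ?case
    using assms by (cases ps) auto
qed simp

text \<open>Run-length encodings are determined by what they spell, provided that runs are nonempty
  and neighbours differ. So it is enough to track these two properties and the spelled list.\<close>

lemma run_length_encode_expand: "is_rle ps \<Longrightarrow> run_length_encode (expand ps) = ps"
proof (induction ps)
  case (Cons p ps)
  obtain c k where p: "p = (c, Suc k)"
    using Cons.prems by (cases p) (auto simp: is_rle_def gr0_conv_Suc)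
  have "is_rle ps" "ps = [] \<or> fst (hd ps) \<noteq> c"
    using Cons.prems p by (auto simp: is_rle_def distinct_adj_Cons hd_map)
  then show ?case
    using run_length_encode_replicate[OF Cons.IH] p by (simp add: expand_def)
qed (simp add: expand_def)

lemma expand_add_run: "expand (add_run ps c k) = expand ps @ replicate k c"
proof (cases "ps \<noteq> [] \<and> fst (last ps) = c")
  case True
  then have ps: "ps = butlast ps @ [(c, snd (last ps))]"
    by (metis append_butlast_last_id prod.collapse)
  have "expand ps = expand (butlast ps) @ replicate (snd (last ps)) c"
    by (subst ps) (simp add: expand_def)
  then show ?thesis
    using True by (simp add: add_run_def expand_def replicate_add)
qed (auto simp: add_run_def expand_def)

lemma is_rle_add_run:
  assumes "is_rle ps" "0 < k"
  shows "is_rle (add_run ps c k)"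
proof (cases "ps \<noteq> [] \<and> fst (last ps) = c")
  case True
  then have ps: "ps = butlast ps @ [(c, snd (last ps))]"
    by (metis append_butlast_last_id prod.collapse)
  have "map fst (add_run ps c k) = map fst ps"
    using True by (subst (2) ps) (simp add: add_run_def)
  moreover have "0 < snd x" if "x \<in> set (add_run ps c k)" for x
    using assms True that by (auto simp: add_run_def is_rle_def dest!: in_set_butlastD)
  ultimately show ?thesis
    using assms by (auto simp: is_rle_def)
next
  case False
  then show ?thesis
    using assms by (auto simp: add_run_def is_rle_def distinct_adj_append_iff last_map)
qed

lemma length_add_run: "length (add_run ps c k) \<le> Suc (length ps)"
  by (auto simp: add_run_def)

section \<open>Programs for the first symbols and the traversal\<close>

definition edge_first_symbol :: com where
  "edge_first_symbol =
     Read rU aSrc rF ;; If_eq rU rRoot (Read rSym aSymbol rF) (Read rSym aSym rU)"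

text \<open>The queue is read backwards because each edge leads from a node queued later to one
  queued earlier: the source of the last edge into a node has its symbol before the node asks for
  it.\<close>

definition first_symbols :: com where
  "first_symbols =
     Add_reg rI rN rZero ;;
     While_less rZero rI (
       Sub_reg rI rI rOne ;; Read rV aQueue rI ;;
       If_eq rV rRoot Skip (
         Add_reg rX rV rOne ;; Read rP aInOff rX ;; Sub_reg rP rP rOne ;; Read rF aIns rP ;;
         edge_first_symbol ;; Write aSym rV rSym))"

text \<open>This inverts \<open>ins\<close>: the traversal meets edges by their index in
  \<open>es\<close>, but whether an edge is primary depends on its position among the entering
  edges.\<close>

definition edge_positions :: com where
  "edge_positions =
     Set_reg rP 0 ;;
     While_less rP rE (Read rF aIns rP ;; Write aPos rF rP ;; Add_reg rP rP rOne)"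

text \<open>Pushing from the last edge to the first leaves the lexicographically smallest one on
  top.\<close>

definition push_out_edges :: com where
  "push_out_edges =
     Read rP aOutOff rV ;; Add_reg rI rV rOne ;; Read rI aOutOff rI ;;
     While_less rP rI (Sub_reg rI rI rOne ;; Write aStack rTop rI ;; Add_reg rTop rTop rOne)"

definition append_run :: com where
  "append_run =
     Write aOut rOut rSym ;; Add_reg rOut rOut rOne ;; Write aOut rOut rCnt ;; Add_reg rOut rOut rOne ;;
     Add_reg rRuns rRuns rOne"

definition emit_run :: com where
  "emit_run =
     If_eq rOut rZero append_run (
       Sub_reg rX rOut rOne ;; Sub_reg rY rX rOne ;; Read rD aOut rY ;;
       If_eq rD rSym (Read rD aOut rX ;; Add_reg rD rD rCnt ;; Write aOut rX rD) append_run)"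

text \<open>An edge is primary iff its position in \<open>ins\<close> opens the group of its target,
  which is the test of \<open>rX\<close> against \<open>rY\<close>. Otherwise the entry just before
  it enters the same target and determines the symbol.\<close>

definition output_runs :: com where
  "output_runs =
     Read rFin aOutOff rRoot ;; Set_reg rTop 0 ;; Set_reg rOut 0 ;; Set_reg rRuns 0 ;;
     Add_reg rV rRoot rZero ;; push_out_edges ;;
     While_less rZero rTop (
       Sub_reg rTop rTop rOne ;; Read rF aStack rTop ;; Read rV aTgt rF ;;
       Read rX aPos rF ;; Read rY aInOff rV ;;
       If_eq rX rY
         (If_eq rV rSink (Read rSym aSymbol rFin ;; Set_reg rCnt 1 ;; emit_run) push_out_edges)
         (Sub_reg rX rX rOne ;; Read rF aIns rX ;; Read rCnt aCnt rV ;; edge_first_symbol ;; emit_run))"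

context edge_graph
begin

text \<open>Here \<open>s\<close> is the stack of edges (top last) and \<open>D\<close> the set of the edges already popped. An edge is pushed
  only after the primary edge into its source, and each node has only one of these, so no edge is pushed
  twice.\<close>

definition dfs :: "nat list \<Rightarrow> nat set \<Rightarrow> bool" where
  "dfs s D \<longleftrightarrow> distinct s \<and> set s \<inter> D = {} \<and> set s \<union> D \<subseteq> {..<E} \<and>
     (\<forall>g \<in> set s \<union> D. src g = rt \<or> ins (io (src g)) \<in> D)"

lemma dfs_init: "dfs (rev [oo rt..<oo (Suc rt)]) {}"
proof -
  have "g < E \<and> src g = rt" if "g \<in> {oo rt..<oo (Suc rt)}" for g
    using that unfolding out_edges[symmetric] by simp
  then show ?thesis
    by (auto simp: dfs_def)
qed

lemma dfs_pop: "dfs (s @ [f]) D \<Longrightarrow> dfs s (insert f D)"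
  by (auto simp: dfs_def)

lemma dfs_expand:
  assumes d: "dfs (s @ [f]) D" and f: "f = ins (io k)" "io k < io (Suc k)" and k: "k < N"
  shows "dfs (s @ rev [oo k..<oo (Suc k)]) (insert f D)"
proof -
  have "k \<noteq> rt"
    using f in_edge[OF k] by simp
  have g: "g < E \<and> src g = k" if "g \<in> set [oo k..<oo (Suc k)]" for g
  proof -
    have "g \<in> {f. f < E \<and> src f = k}"
      unfolding out_edges using that by simp
    then show ?thesis
      by simp
  qed
  \<comment> \<open>An edge leaving \<open>k\<close> can be known only once the primary edge
    \<open>f\<close> into \<open>k\<close> has been popped, but \<open>f\<close> is still on the
    stack.\<close>
  have "g \<notin> set (s @ [f]) \<union> D" if "g \<in> set [oo k..<oo (Suc k)]" for g
  proof
    assume "g \<in> set (s @ [f]) \<union> D"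
    then have "ins (io k) \<in> D"
      using d g[OF that] \<open>k \<noteq> rt\<close> unfolding dfs_def by metis
    then show False
      using d f by (auto simp: dfs_def)
  qed
  then show ?thesis
    using d g f(1) unfolding dfs_def by auto
qed

text \<open>Stack and popped edges are disjoint sets of edges. One inequality thus bounds the stack,
  the number of pops and the number of pushes.\<close>

lemma dfs_card:
  assumes "dfs s D"
  shows "card D + length s \<le> E" "finite D"
proof -
  show fin: "finite D"
    using assms finite_subset[of D "{..<E}"] by (auto simp: dfs_def)
  have "card D + length s = card (set s \<union> D)"
    using assms fin by (subst card_Un_disjoint) (auto simp: dfs_def distinct_card)
  also have "\<dots> \<le> card {..<E}"
    using assms by (intro card_mono) (auto simp: dfs_def)
  finally show "card D + length s \<le> E"
    by simp
qed

end

context rlbwt_algorithm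
begin

lemma edge_first_symbol_correct:
  assumes s: "static R A" and f: "R rF = f" "f < E"
    and sym: "src f \<noteq> rt \<Longrightarrow> A aSym (src f) = fsym (src f)"
    and Q: "\<And>t'. t' \<le> t + 10 \<Longrightarrow>
      Q (R(rU := src f, rSym := if src f = rt then hdf f else fsym (src f))) A t'"
  shows "wp W len edge_first_symbol Q R A t"
  using f sym src[OF f(2)] N_le Q[of "9 + t"] Q[of "10 + t"] unfolding edge_first_symbol_def
  by (cases "src f = rt") (simp_all add: staticD[OF s] len len_work)

lemma first_symbols_correct:
  assumes s0: "static R A" and q: "distinct q" "set q = {..<N}" "length q = N" "\<forall>i < N. A aQueue i = q ! i"
      "\<forall>i < N. \<forall>f < E. src f = q ! i \<longrightarrow> tgt f \<in> set (take i q)"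
    and Q: "\<And>R' A' t'. static R' A' \<Longrightarrow> A' aCnt = A aCnt \<Longrightarrow> \<forall>u < N. u \<noteq> rt \<longrightarrow> A' aSym u = fsym u \<Longrightarrow>
      t' \<le> t + 50 * N + 10 \<Longrightarrow> Q R' A' t'"
  shows "wp W len first_symbols Q R A t"
proof -
  define I where "I R' A' t' \<longleftrightarrow> static R' A' \<and> A' aCnt = A aCnt \<and> A' aQueue = A aQueue \<and> R' rI \<le> N \<and>
    (\<forall>j < N. R' rI \<le> j \<longrightarrow> q ! j \<noteq> rt \<longrightarrow> A' aSym (q ! j) = fsym (q ! j)) \<and>
    t' + 50 * R' rI \<le> t + 50 * N + 1" for R' A' t'
  have "wp W len (While_less rZero rI (
       Sub_reg rI rI rOne ;; Read rV aQueue rI ;;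
       If_eq rV rRoot Skip (
         Add_reg rX rV rOne ;; Read rP aInOff rX ;; Sub_reg rP rP rOne ;; Read rF aIns rP ;;
         edge_first_symbol ;; Write aSym rV rSym))) Q (R(rI := N)) A (Suc t)"
  proof (rule wp_While[where I = I and m = "\<lambda>R A. R rI"])
    show "I (R(rI := N)) A (Suc t)"
      using s0 by (simp add: I_def)
  next
    fix R1 A1 t1 assume I: "I R1 A1 t1" "R1 rZero < R1 rI"
    then have s: "static R1 A1" and A1: "A1 aCnt = A aCnt" "A1 aQueue = A aQueue" "R1 rI \<le> N"
      and sym: "\<And>j. j < N \<Longrightarrow> R1 rI \<le> j \<Longrightarrow> q ! j \<noteq> rt \<Longrightarrow> A1 aSym (q ! j) = fsym (q ! j)"
      and t1: "t1 + 50 * R1 rI \<le> t + 50 * N + 1"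
      unfolding I_def by auto
    obtain i where i: "R1 rI = Suc i" "i < N"
      using I(2) staticD(5)[OF s] A1(3) by (cases "R1 rI") auto
    define v where "v = q ! i"
    have v: "v < N"
      using q i nth_mem[of i q] by (auto simp: v_def)
    have qv: "A aQueue i = v"
      using q i by (simp add: v_def)
    show "wp W len (
       Sub_reg rI rI rOne ;; Read rV aQueue rI ;;
       If_eq rV rRoot Skip (
         Add_reg rX rV rOne ;; Read rP aInOff rX ;; Sub_reg rP rP rOne ;; Read rF aIns rP ;;
         edge_first_symbol ;; Write aSym rV rSym))
       (\<lambda>R' A' t'. I R' A' t' \<and> R' rI < R1 rI) R1 A1 (t1 + 2)"
    proof (cases "v = rt")
      case True
      have "A1 aSym (q ! j) = fsym (q ! j)" if "j < N" "i \<le> j" "q ! j \<noteq> rt" for j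
        using sym[of j] that i True by (cases "j = i") (auto simp: v_def)
      then have "I (R1(rI := i, rV := rt)) A1 t'" if "t' \<le> t1 + 20" for t'
        unfolding I_def using s A1 i t1 that by simp
      then show ?thesis
        using i N_le W_E v True by (simp add: staticD[OF s] len_work A1 qv)
    next
      case False
      define p where "p = io (Suc v) - 1"
      define f where "f = ins p"
      have p: "Suc p = io (Suc v)" "p < E" "tgt f = v"
        using in_edge[OF v] False io_iff[of p v] io_le[of "Suc v"] by (auto simp: p_def f_def)
      have f: "f < E"
        using ins_lt[OF p(2)] by (simp add: f_def)
      have fsym_v: "fsym v = (if src f = rt then hdf f else fsym (src f))"
        by (rule fsym_last[OF v False]) (simp add: f_def p_def)
      \<comment> \<open>All targets of a node stand before it in the queue. So \<open>src f\<close>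
        has a larger index than \<open>v\<close> and was treated in an earlier pass.\<close>
      have sym_src: "A1 aSym (src f) = fsym (src f)" if "src f \<noteq> rt"
      proof -
        obtain j where j: "j < N" "q ! j = src f"
          using q src[OF f] by (metis in_set_conv_nth lessThan_iff)
        then have "v \<in> set (take j q)"
          using q(5) f p(3) by auto
        then obtain i' where "i' < j" "q ! i' = v"
          using j q(3) by (auto simp: in_set_conv_nth)
        then have "i < j"
          using q(1,3) i j by (auto simp: v_def nth_eq_iff_index_eq)
        then show ?thesis
          using sym[of j] i j that by simp
      qed
      have step: "wp W len edge_first_symbol (wp W len (Write aSym rV rSym) (\<lambda>R' A' t'. I R' A' t' \<and> R' rI < Suc i))
        (R1(rI := i, rV := v, rX := Suc v, rP := p, rF := f)) A1 t'" if t': "t' \<le> t1 + 25" for t'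
      proof (rule edge_first_symbol_correct[where f = f])
        fix t2 assume t2: "t2 \<le> t' + 10"
        have "I (R1(rI := i, rV := v, rX := Suc v, rP := p, rF := f, rU := src f, rSym := fsym v))
          (A1(aSym := (A1 aSym)(v := fsym v))) (t2 + 4)"
        proof -
          have "((A1 aSym)(v := fsym v)) (q ! j) = fsym (q ! j)" if "j < N" "i \<le> j" "q ! j \<noteq> rt" for j
            using sym[of j] that i by (cases "j = i") (auto simp: v_def)
          then show ?thesis
            unfolding I_def using s A1 i t1 t2 t' by simp
        qed
        then show "wp W len (Write aSym rV rSym) (\<lambda>R' A' t'. I R' A' t' \<and> R' rI < Suc i)
          (R1(rI := i, rV := v, rX := Suc v, rP := p, rF := f, rU := src f,
            rSym := if src f = rt then hdf f else fsym (src f))) A1 t2"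
          using v N_le unfolding fsym_v[symmetric] by (simp add: len_work)
      qed (use s f sym_src in simp_all)
      have "io (Suc v) < W"
        using io_le[of "Suc v"] W_E by simp
      then show ?thesis
        using i N_le W_E v False p(2) step
        by (simp add: staticD[OF s] len len_1 len_work A1 qv p(1)[symmetric] f_def[symmetric])
    qed
  next
    fix R1 A1 t1 assume "I R1 A1 t1" "\<not> R1 rZero < R1 rI"
    then have *: "static R1 A1" "A1 aCnt = A aCnt" "R1 rI = 0"
      "\<And>j. j < N \<Longrightarrow> q ! j \<noteq> rt \<Longrightarrow> A1 aSym (q ! j) = fsym (q ! j)" "t1 \<le> t + 50 * N + 1"
      using staticD(5)[of R1 A1] by (auto simp: I_def)
    have "A1 aSym u = fsym u" if "u < N" "u \<noteq> rt" for u
      using *(4) q that by (metis in_set_conv_nth lessThan_iff)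
    then show "Q R1 A1 (t1 + 2)"
      using * by (intro Q) auto
  qed
  then show ?thesis
    unfolding first_symbols_def using N_le W_E by (simp add: staticD[OF s0])
qed

lemma edge_positions_correct:
  assumes s0: "static R A"
    and Q: "\<And>R' A' t'. static R' A' \<Longrightarrow> A' aCnt = A aCnt \<Longrightarrow> A' aSym = A aSym \<Longrightarrow>
      \<forall>p < E. A' aPos (ins p) = p \<Longrightarrow> t' \<le> t + 20 * E + 10 \<Longrightarrow> Q R' A' t'"
  shows "wp W len edge_positions Q R A t"
proof -
  define I where "I R' A' t' \<longleftrightarrow> static R' A' \<and> A' aCnt = A aCnt \<and> A' aSym = A aSym \<and> R' rP \<le> E \<and>
    (\<forall>p < R' rP. A' aPos (ins p) = p) \<and> t' \<le> t + 1 + 20 * R' rP" for R' A' t'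
  have "wp W len (While_less rP rE (Read rF aIns rP ;; Write aPos rF rP ;; Add_reg rP rP rOne)) Q
    (R(rP := 0)) A (Suc t)"
  proof (rule wp_While[where I = I and m = "\<lambda>R A. E - R rP"])
    show "I (R(rP := 0)) A (Suc t)"
      using s0 by (simp add: I_def)
  next
    fix R1 A1 t1 assume I: "I R1 A1 t1" "R1 rP < R1 rE"
    then have s: "static R1 A1"
      by (simp add: I_def)
    define p where "p = R1 rP"
    have p: "p < E"
      using I(2) staticD(2)[OF s] by (simp add: p_def)
    have "ins j \<noteq> ins p" if "j < p" for j
      using ins_inj[of j p] p that by auto
    then have "I (R1(rF := ins p, rP := Suc p)) (A1(aPos := (A1 aPos)(ins p := p))) t'" if "t' \<le> t1 + 15" for t'
      using I(1) p that by (auto simp: I_def p_def[symmetric] less_Suc_eq)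
    then show "wp W len (Read rF aIns rP ;; Write aPos rF rP ;; Add_reg rP rP rOne)
      (\<lambda>R' A' t'. I R' A' t' \<and> E - R' rP < E - R1 rP) R1 A1 (t1 + 2)"
      using p ins_lt[OF p] W_E
      by (simp add: staticD[OF s] len len_work p_def[symmetric] diff_less_mono2)
  next
    fix R1 A1 t1 assume "I R1 A1 t1" "\<not> R1 rP < R1 rE"
    then show "Q R1 A1 (t1 + 2)"
      using staticD(2)[of R1 A1] by (intro Q) (auto simp: I_def)
  qed
  then show ?thesis
    unfolding edge_positions_def using W_E by simp
qed

lemma push_out_edges_correct:
  assumes s0: "static R A" and v: "R rV = v" "v < N"
    and st: "R rTop = length s" "\<forall>i < length s. A aStack i = s ! i"
    and room: "length s + (oo (Suc v) - oo v) \<le> E"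
    and Q: "\<And>R' A' t' s'. static R' A' \<Longrightarrow> (\<And>r. r \<notin> {rP, rI, rTop} \<Longrightarrow> R' r = R r) \<Longrightarrow>
      (\<And>k. k \<noteq> aStack \<Longrightarrow> A' k = A k) \<Longrightarrow> s' = s @ rev [oo v..<oo (Suc v)] \<Longrightarrow> R' rTop = length s' \<Longrightarrow>
      \<forall>i < length s'. A' aStack i = s' ! i \<Longrightarrow> t' \<le> t + 20 * (oo (Suc v) - oo v) + 20 \<Longrightarrow> Q R' A' t'"
  shows "wp W len push_out_edges Q R A t"
proof -
  define I where "I R' A' t' \<longleftrightarrow> static R' A' \<and> (\<forall>r. r \<notin> {rP, rI, rTop} \<longrightarrow> R' r = R r) \<and>
    (\<forall>k. k \<noteq> aStack \<longrightarrow> A' k = A k) \<and> R' rP = oo v \<and> oo v \<le> R' rI \<and> R' rI \<le> oo (Suc v) \<and>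
    R' rTop = length s + (oo (Suc v) - R' rI) \<and>
    (\<forall>i < length s + (oo (Suc v) - R' rI). A' aStack i = (s @ rev [R' rI..<oo (Suc v)]) ! i) \<and>
    t' \<le> t + 9 + 20 * (oo (Suc v) - R' rI)" for R' A' t'
  have "wp W len (While_less rP rI (Sub_reg rI rI rOne ;; Write aStack rTop rI ;; Add_reg rTop rTop rOne)) Q
    (R(rP := oo v, rI := oo (Suc v))) A (9 + t)"
  proof (rule wp_While[where I = I and m = "\<lambda>R A. R rI"])
    show "I (R(rP := oo v, rI := oo (Suc v))) A (9 + t)"
      using s0 st oo_mono[of v] by (simp add: I_def)
  next
    fix R1 A1 t1 assume I: "I R1 A1 t1" "R1 rP < R1 rI"
    then have s: "static R1 A1"
      by (simp add: I_def)
    have "oo v < R1 rI"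
      using I by (simp add: I_def)
    then obtain i where i: "R1 rI = Suc i" "oo v \<le> i" "i < oo (Suc v)"
      using I by (cases "R1 rI") (auto simp: I_def)
    define m where "m = R1 rTop"
    have m: "m = length (s @ rev [Suc i..<oo (Suc v)])" "Suc m = length s + (oo (Suc v) - i)"
      using I i by (auto simp: I_def m_def)
    have small: "m < 2 * E + 2" "Suc m < W" "Suc i < W"
      using m(2) room i oo_le[of "Suc v"] W_E by linarith+
    have up: "s @ rev [i..<oo (Suc v)] = (s @ rev [Suc i..<oo (Suc v)]) @ [i]"
      using i by (simp add: upt_conv_Cons)
    have stk: "A1 aStack j = (s @ rev [Suc i..<oo (Suc v)]) ! j" if "j < m" for j
      using I that i by (simp add: I_def m_def)
    have stk': "((A1 aStack)(m := i)) j = (s @ rev [i..<oo (Suc v)]) ! j" if "j < Suc m" for j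
    proof (cases "j = m")
      case True
      then show ?thesis
        unfolding up m(1) by (simp only: nth_append_length fun_upd_same)
    next
      case False
      then have "j < length (s @ rev [Suc i..<oo (Suc v)])"
        using that m(1) by simp
      then show ?thesis
        unfolding up nth_append[of "s @ rev [Suc i..<oo (Suc v)]"] using False that stk[of j] by simp
    qed
    have "I (R1(rI := i, rTop := Suc m)) (A1(aStack := (A1 aStack)(m := i))) t'" if "t' \<le> t1 + 15" for t'
      using I(1) i that m(2) stk' Suc_diff_Suc[OF i(3)] by (simp add: I_def)
    then show "wp W len (Sub_reg rI rI rOne ;; Write aStack rTop rI ;; Add_reg rTop rTop rOne)
      (\<lambda>R' A' t'. I R' A' t' \<and> R' rI < R1 rI) R1 A1 (t1 + 2)"
      using i small by (simp add: staticD[OF s] len_work m_def[symmetric])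
  next
    fix R1 A1 t1 assume I: "I R1 A1 t1" "\<not> R1 rP < R1 rI"
    then have "R1 rI = oo v"
      by (simp add: I_def)
    then show "Q R1 A1 (t1 + 2)"
      using I(1) oo_mono[of v] by (intro Q[of _ _ "s @ rev [oo v..<oo (Suc v)]"]) (auto simp: I_def)
  qed
  then show ?thesis
    unfolding push_out_edges_def using v N_le W_E by (simp add: staticD[OF s0] len)
qed

end

section \<open>Emitting the runs\<close>

definition stores_runs :: "(nat \<Rightarrow> nat) \<Rightarrow> (nat \<times> nat) list \<Rightarrow> bool" where
  "stores_runs a ps \<longleftrightarrow> (\<forall>i < length ps. a (2 * i) = fst (ps ! i) \<and> a (Suc (2 * i)) = snd (ps ! i))"

lemma stores_runs_append:
  assumes "stores_runs a ps"
  shows "stores_runs (a(2 * length ps := c, Suc (2 * length ps) := k)) (ps @ [(c, k)])"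
proof -
  have "2 * i \<noteq> Suc (2 * j)" for i j :: nat
    by presburger
  then show ?thesis
    using assms by (auto simp: stores_runs_def less_Suc_eq nth_append)
qed

lemma stores_runs_merge:
  assumes "stores_runs a (ps @ [(c, k)])"
  shows "stores_runs (a(Suc (2 * length ps) := k')) (ps @ [(c, k')])"
proof -
  have "2 * i \<noteq> Suc (2 * j)" for i j :: nat
    by presburger
  then show ?thesis
    using assms by (auto simp: stores_runs_def less_Suc_eq nth_append)
qed

context rlbwt_algorithm
begin

lemma append_run_correct:
  assumes s: "static R A" and out: "R rOut = 2 * length ps" "R rRuns = length ps" "stores_runs (A aOut) ps"
    and c: "R rSym = c" "R rCnt = k" and room: "length ps < E"
    and Q: "\<And>R' A' t'. static R' A' \<Longrightarrow> (\<And>r. r \<notin> {rX, rY, rD, rOut, rRuns} \<Longrightarrow> R' r = R r) \<Longrightarrow>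
      (\<And>k. k \<noteq> aOut \<Longrightarrow> A' k = A k) \<Longrightarrow> R' rOut = 2 * Suc (length ps) \<Longrightarrow> R' rRuns = Suc (length ps) \<Longrightarrow>
      stores_runs (A' aOut) (ps @ [(c, k)]) \<Longrightarrow> t' \<le> t + 11 \<Longrightarrow> Q R' A' t'"
  shows "wp W len append_run Q R A t"
proof -
  have "Suc (Suc (2 * length ps)) < 2 * E + 2" "Suc (Suc (2 * length ps)) < W"
    using room W_E by auto
  moreover have "Q (R(rOut := Suc (Suc (2 * length ps)), rRuns := Suc (length ps)))
      (A(aOut := (A aOut)(2 * length ps := c, Suc (2 * length ps) := k))) t'" if "t' \<le> t + 11" for t'
    using s stores_runs_append[OF out(3)] that by (intro Q) auto
  ultimately show ?thesis
    unfolding append_run_def using out(1,2) c by (simp add: staticD[OF s] len_work)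
qed

lemma emit_run_correct:
  assumes s: "static R A" and out: "R rOut = 2 * length ps" "R rRuns = length ps" "stores_runs (A aOut) ps"
    and c: "R rSym = c" "R rCnt = k" and room: "length ps < E"
    and bound: "length (expand ps) + k \<le> n"
    and Q: "\<And>R' A' t'. static R' A' \<Longrightarrow> (\<And>r. r \<notin> {rX, rY, rD, rOut, rRuns} \<Longrightarrow> R' r = R r) \<Longrightarrow>
      (\<And>k. k \<noteq> aOut \<Longrightarrow> A' k = A k) \<Longrightarrow> R' rOut = 2 * length (add_run ps c k) \<Longrightarrow>
      R' rRuns = length (add_run ps c k) \<Longrightarrow>
      stores_runs (A' aOut) (add_run ps c k) \<Longrightarrow> t' \<le> t + 40 \<Longrightarrow> Q R' A' t'"
  shows "wp W len emit_run Q R A t"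
proof (cases "ps = []")
  case True
  have "wp W len append_run Q R A (t + 1)"
    using out c room True
    by (intro append_run_correct[where ps = ps and c = c and k = k, OF s] Q) (auto simp: add_run_def)
  then show ?thesis
    unfolding emit_run_def using out True by (simp add: staticD[OF s])
next
  case False
  then obtain qs c' k' where ps: "ps = qs @ [(c', k')]"
    by (metis append_butlast_last_id surj_pair)
  have last: "A aOut (2 * length qs) = c'" "A aOut (Suc (2 * length qs)) = k'"
    using out(3) ps by (auto simp: stores_runs_def less_Suc_eq nth_append)
  have small: "Suc (Suc (2 * length qs)) < 2 * E + 2" "Suc (Suc (2 * length qs)) < W"
    using room ps W_E by auto
  have R_out: "R rOut = Suc (Suc (2 * length qs))"
    using out(1) ps by simp
  show ?thesis
  proof (cases "c' = c")
    case True
    \<comment> \<open>The merged length is at most the length of everything spelled so far, which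
      \<open>bound\<close> keeps at most \<open>n\<close>.\<close>
    have "k' + k < W"
      using bound ps W_n by (simp add: expand_def)
    moreover have "Q (R(rX := Suc (2 * length qs), rY := 2 * length qs, rD := k' + k))
        (A(aOut := (A aOut)(Suc (2 * length qs) := k' + k))) t'" if "t' \<le> t + 40" for t'
      using s out that stores_runs_merge[of "A aOut" qs c' k' "k' + k"] True
      by (intro Q) (auto simp: ps add_run_def)
    ultimately show ?thesis
      unfolding emit_run_def using R_out c True small
      by (simp add: staticD[OF s] len_work last)
  next
    case c': False
    have "wp W len append_run Q (R(rX := Suc (2 * length qs), rY := 2 * length qs, rD := c')) A (t + 10)"
      using s out c room c'
      by (intro append_run_correct[where ps = ps and c = c and k = k] Q) (auto simp: add_run_def ps)
    then show ?thesis
      unfolding emit_run_def using R_out c c' small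
      by (simp add: staticD[OF s] len_work last add.commute)
  qed
qed

definition tables :: "arrays \<Rightarrow> bool" where
  "tables A \<longleftrightarrow> (\<forall>u < N. A aCnt u = cnt u \<and> (u \<noteq> rt \<longrightarrow> A aSym u = fsym u)) \<and>
     (\<forall>p < E. A aPos (ins p) = p)"

lemma tables_cong: "A' aCnt = A aCnt \<Longrightarrow> A' aSym = A aSym \<Longrightarrow> A' aPos = A aPos \<Longrightarrow> tables A' \<longleftrightarrow> tables A"
  by (simp add: tables_def)

definition B :: "nat list" where
  "B = concat (map piece [oo rt..<oo (Suc rt)])"

text \<open>The invariant: the runs emitted so far, followed by the pieces of the edges waiting on
  the stack from the top down, spell \<open>B\<close>. Each pop adds at most one run; this gives the
  bound on the number of runs as well as the room in the output array.\<close>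

lemma output_runs_correct:
  assumes s0: "static R A" and tab: "tables A"
    and Q: "\<And>R' A' t' ps. static R' A' \<Longrightarrow> ps = run_length_encode B \<Longrightarrow> R' rRuns = length ps \<Longrightarrow>
      stores_runs (A' aOut) ps \<Longrightarrow> length ps \<le> E \<Longrightarrow> t' \<le> t + 200 * E + 100 \<Longrightarrow> Q R' A' t'"
  shows "wp W len output_runs Q R A t"
proof -
  \<comment> \<open>Each pop is charged 150 steps. \<open>card D + length s\<close> is the number of
    edges pushed so far, each charged 20.\<close>
  define I where "I k R' A' t' \<longleftrightarrow> (\<exists>s D ps. static R' A' \<and> tables A' \<and> R' rFin = oo rt \<and>
    R' rTop = length s \<and> (\<forall>i < length s. A' aStack i = s ! i) \<and> dfs s D \<and>
    R' rOut = 2 * length ps \<and> R' rRuns = length ps \<and> stores_runs (A' aOut) ps \<and> is_rle ps \<and>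
    length ps \<le> card D \<and> expand ps @ concat (map piece (rev s)) = B \<and> k = E - card D \<and>
    t' \<le> t + 50 + 150 * card D + 20 * (card D + length s))" for k R' A' t'
  let ?body = "
       Sub_reg rTop rTop rOne ;; Read rF aStack rTop ;; Read rV aTgt rF ;;
       Read rX aPos rF ;; Read rY aInOff rV ;;
       If_eq rX rY
         (If_eq rV rSink (Read rSym aSymbol rFin ;; Set_reg rCnt 1 ;; emit_run) push_out_edges)
         (Sub_reg rX rX rOne ;; Read rF aIns rX ;; Read rCnt aCnt rV ;; edge_first_symbol ;; emit_run)"
  have oo_rt: "oo rt < E"
    using oo_le[of "Suc rt"] out_edge[OF rt] rt_sk by simp
  have loop: "wp W len (While_less rZero rTop ?body) Q R1 A1 t1"
    if "I k R1 A1 t1" for k R1 A1 t1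
  proof (rule wp_While_variant[where I = I, OF that])
    fix k R1 A1 t1 assume I: "I k R1 A1 t1" "R1 rZero < R1 rTop"
    then obtain s' D ps where s: "static R1 A1" and tab: "tables A1" and rfin: "R1 rFin = oo rt"
      and st: "R1 rTop = length s'" "\<forall>i < length s'. A1 aStack i = s' ! i" and d: "dfs s' D"
      and out: "R1 rOut = 2 * length ps" "R1 rRuns = length ps" "stores_runs (A1 aOut) ps"
      and rle: "is_rle ps" "length ps \<le> card D" "expand ps @ concat (map piece (rev s')) = B"
      and k: "k = E - card D" and t: "t1 \<le> t + 50 + 150 * card D + 20 * (card D + length s')"
      unfolding I_def by blast
    have "s' \<noteq> []"
      using I(2) st staticD(5)[OF s] by auto
    then obtain s f where s': "s' = s @ [f]"
      by (metis append_butlast_last_id)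
    have d': "dfs (s @ [f]) D"
      using d s' by simp
    note dc = dfs_card[OF d']
    have f: "f < E" "f \<notin> D"
      using d' by (auto simp: dfs_def)
    have top: "R1 rTop = Suc (length s)" "A1 aStack (length s) = f" "\<forall>i < length s. A1 aStack i = s ! i"
      using st s' by (auto simp: nth_append)
    define v where "v = tgt f"
    have v: "v < N" "v \<noteq> rt"
    proof -
      show "v < N"
        using tgt[OF f(1)] by (simp add: v_def)
      obtain p where "p < E" "ins p = f"
        using ins_surj[OF f(1)] by blast
      then have "io v < io (Suc v)"
        using io_iff[of p v] by (simp add: v_def)
      then show "v \<noteq> rt"
        using in_edge[OF \<open>v < N\<close>] by simp
    qed
    obtain p where p: "p < E" "ins p = f" "A1 aPos f = p"
      using ins_surj[OF f(1)] tab by (auto simp: tables_def)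
    have pv: "io v \<le> p" "p < io (Suc v)"
      using io_iff[OF p(1), of v] p by (auto simp: v_def)
    have card_D: "card (insert f D) = Suc (card D)" "card D < E"
      using f dc by auto
    have total: "expand ps @ piece f @ concat (map piece (rev s)) = B"
      using rle(3) s' by simp
    have bound: "length (expand ps) + length (piece f) \<le> n"
      using arg_cong[OF total, of length] length_le unfolding B_def by simp
    have room: "length ps < E"
      using rle(2) card_D by simp
    have small: "Suc (length s) < W" "length s < 2 * E + 2" "v \<le> N" "v < Suc N" "f < 2 * E + 2"
      "p < W" "v < 2 * E + 2" "oo rt < E"
      using dc v f p N_le W_E oo_rt by auto
    have v_tgt: "A1 aTgt f = v" "A1 aInOff v = io v" "A1 (Suc 0) v = io v"
      using staticD[OF s] f v by (simp_all add: v_def)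
    let ?post = "\<lambda>R' A' t'. \<exists>k' < k. I k' R' A' t'"
    let ?R = "R1(rTop := length s, rF := f, rV := v, rX := p, rY := io v)"
    \<comment> \<open>Common end of the sink case and of the secondary edges: in both, the piece of
      \<open>f\<close> is a single run.\<close>
    have emitted: "\<exists>k' < k. I k' R' A' t'"
      if *: "static R' A'" "\<And>r. r \<notin> {rX, rY, rD, rOut, rRuns} \<Longrightarrow> R' r = R2 r"
        "\<And>k. k \<noteq> aOut \<Longrightarrow> A' k = A1 k" "R' rOut = 2 * length (add_run ps c m)"
        "R' rRuns = length (add_run ps c m)" "stores_runs (A' aOut) (add_run ps c m)"
        "R2 rTop = length s" "R2 rFin = oo rt" "piece f = replicate m c" "0 < m" "t' \<le> t1 + 120"
      for R' A' t' R2 c m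
    proof -
      have "I (E - Suc (card D)) R' A' t'"
        unfolding I_def
      proof (intro exI[of _ s] exI[of _ "insert f D"] exI[of _ "add_run ps c m"] conjI)
        show "tables A'"
          using tab tables_cong[of A' A1] *(3) by simp
        show "expand (add_run ps c m) @ concat (map piece (rev s)) = B"
          using total *(9) by (simp add: expand_add_run)
        show "length (add_run ps c m) \<le> card (insert f D)"
          using length_add_run[of ps c m] rle(2) card_D by simp
        show "is_rle (add_run ps c m)"
          by (rule is_rle_add_run[OF rle(1) *(10)])
        show "t' \<le> t + 50 + 150 * card (insert f D) + 20 * (card (insert f D) + length s)"
          using t *(11) card_D s' by simp
      qed (use * top dfs_pop[OF d'] card_D in auto)
      then show ?thesis
        using k card_D by (intro exI[of _ "E - Suc (card D)"]) simp
    qed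
    show "wp W len ?body ?post R1 A1 (t1 + 2)"
    proof (cases "io v = p")
      case True
      show ?thesis
      proof (cases "v = sk")
        case sink: True
        have piece: "piece f = replicate 1 fin"
          using piece_sink[OF p(1)] p(2) True sink by (simp add: v_def)
        have "wp W len emit_run ?post
          (?R(rSym := fin, rCnt := 1)) A1 t2" if "t2 \<le> t1 + 50" for t2
        proof (rule emit_run_correct[where ps = ps and c = fin and k = 1])
          fix R' A' t' assume "static R' A'" "\<And>r. r \<notin> {rX, rY, rD, rOut, rRuns} \<Longrightarrow> R' r = (?R(rSym := fin, rCnt := 1)) r"
            "\<And>k. k \<noteq> aOut \<Longrightarrow> A' k = A1 k" "R' rOut = 2 * length (add_run ps fin 1)"
            "R' rRuns = length (add_run ps fin 1)" "stores_runs (A' aOut) (add_run ps fin 1)" "t' \<le> t2 + 40"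
          then show "\<exists>k' < k. I k' R' A' t'"
            using piece that rfin
            by (intro emitted[where c = fin and m = 1 and ?R2.0 = "?R(rSym := fin, rCnt := 1)"]) auto
        qed (use s out room bound piece in auto)
        then show ?thesis
          using small True sink W_E oo_rt f(1)
          by (simp add: staticD[OF s] v_tgt len len_1 len_work top p rfin fin[symmetric])
      next
        case v_sk: False
        have "dfs (s @ rev [oo v..<oo (Suc v)]) (insert f D)"
          using dfs_expand[OF d' _ _ v(1)] True p pv by simp
        note d2 = this dfs_card[OF this]
        have piece: "piece f = concat (map piece [oo v..<oo (Suc v)])"
          using piece_primary[OF p(1), of v] p(2) True v_sk by (simp add: v_def)
        have "wp W len push_out_edges ?post ?R A1 t2"
          if t2: "t2 \<le> t1 + 50" for t2
        proof (rule push_out_edges_correct[where v = v and s = s])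
          fix R' A' t' s2 assume *: "static R' A'" "\<And>r. r \<notin> {rP, rI, rTop} \<Longrightarrow> R' r = ?R r"
            "\<And>k. k \<noteq> aStack \<Longrightarrow> A' k = A1 k" "s2 = s @ rev [oo v..<oo (Suc v)]"
            "R' rTop = length s2" "\<forall>i < length s2. A' aStack i = s2 ! i"
            "t' \<le> t2 + 20 * (oo (Suc v) - oo v) + 20"
          have "I (E - Suc (card D)) R' A' t'"
            unfolding I_def
          proof (intro exI[of _ s2] exI[of _ "insert f D"] exI[of _ ps] conjI)
            show "tables A'"
              using tab tables_cong[of A' A1] *(3) by simp
            show "expand ps @ concat (map piece (rev s2)) = B"
              using total piece *(4) by simp
            show "t' \<le> t + 50 + 150 * card (insert f D) + 20 * (card (insert f D) + length s2)"
              using t *(4,7) t2 card_D s' by simp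
          qed (use * d2 card_D rle rfin out in auto)
          then show "\<exists>k' < k. I k' R' A' t'"
            using k card_D by (intro exI[of _ "E - Suc (card D)"]) simp
        qed (use s v top d2 in auto)
        then show ?thesis
          using small True v_sk W_E f(1)
          by (simp add: staticD[OF s] v_tgt len len_1 len_work top p)
      qed
    next
      case False
      define g where "g = ins (p - 1)"
      define c where "c = (if src g = rt then hdf g else fsym (src g))"
      have g: "p - 1 < E" "g < E" "0 < p"
        using p pv False ins_lt[of "p - 1"] by (auto simp: g_def)
      have piece: "piece f = replicate (cnt v) c"
        using piece_secondary[OF p(1), of v g] p(2) False by (simp add: v_def g_def c_def)
      let ?R' = "?R(rX := p - 1, rF := g, rCnt := cnt v)"
      let ?R2 = "?R'(rU := src g, rSym := c)"
      have emit: "wp W len emit_run ?post ?R2 A1 t2"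
        if "t2 \<le> t1 + 70" for t2
      proof (rule emit_run_correct[where ps = ps and c = c and k = "cnt v"])
        fix R' A' t' assume "static R' A'" "\<And>r. r \<notin> {rX, rY, rD, rOut, rRuns} \<Longrightarrow> R' r = ?R2 r"
          "\<And>k. k \<noteq> aOut \<Longrightarrow> A' k = A1 k" "R' rOut = 2 * length (add_run ps c (cnt v))"
          "R' rRuns = length (add_run ps c (cnt v))" "stores_runs (A' aOut) (add_run ps c (cnt v))" "t' \<le> t2 + 40"
        then show "\<exists>k' < k. I k' R' A' t'"
          using piece that rfin cnt_pos[OF v(1)]
          by (intro emitted[where c = c and m = "cnt v" and ?R2.0 = ?R2]) auto
      qed (use s out room bound piece in auto)
      have "wp W len edge_first_symbol (wp W len emit_run ?post) ?R' A1 t2"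
        if t2: "t2 \<le> t1 + 60" for t2
      proof (rule edge_first_symbol_correct[where f = g])
        show "A1 aSym (src g) = fsym (src g)" if "src g \<noteq> rt"
          using tab src[OF g(2)] that by (simp add: tables_def)
        fix t' assume "t' \<le> t2 + 10"
        then show "wp W len emit_run ?post
          (?R'(rU := src g, rSym := if src g = rt then hdf g else fsym (src g))) A1 t'"
          using emit[of t'] t2 by (simp add: c_def)
      qed (use s g in simp_all)
      moreover have "A1 aCnt v = cnt v"
        using tab v by (simp add: tables_def)
      moreover have "p \<noteq> io v" "Suc 0 \<le> p" "p - Suc 0 < E" "A1 aIns (p - Suc 0) = g"
        using False g staticD(14)[OF s g(1)] by (auto simp: g_def)
      ultimately show ?thesis
        using small W_E
        by (simp add: staticD(1-10,13)[OF s] v_tgt len len_1 len_work top p f)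
    qed
  next
    fix k R1 A1 t1 assume I: "I k R1 A1 t1" "\<not> R1 rZero < R1 rTop"
    then obtain D ps where *: "static R1 A1" "dfs [] D" "R1 rRuns = length ps" "stores_runs (A1 aOut) ps"
      "is_rle ps" "length ps \<le> card D" "expand ps = B" "t1 \<le> t + 50 + 150 * card D + 20 * card D"
      using staticD(5)[of R1 A1] unfolding I_def by auto
    then have "ps = run_length_encode B" "card D \<le> E"
      using run_length_encode_expand[of ps] dfs_card[of "[]" D] by auto
    then show "Q R1 A1 (t1 + 2)"
      using * by (intro Q[of _ _ ps]) auto
  qed
  have push: "wp W len push_out_edges (wp W len (While_less rZero rTop ?body) Q)
    (R(rFin := oo rt, rTop := 0, rOut := 0, rRuns := 0, rV := rt)) A t1" if t1: "t1 \<le> t + 10" for t1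
  proof (rule push_out_edges_correct[where v = rt and s = "[]"])
    show "length [] + (oo (Suc rt) - oo rt) \<le> E"
      using oo_le[of "Suc rt"] by simp
    fix R' A' t' s' assume *: "static R' A'" "\<And>r. r \<notin> {rP, rI, rTop} \<Longrightarrow>
        R' r = (R(rFin := oo rt, rTop := 0, rOut := 0, rRuns := 0, rV := rt)) r"
      "\<And>k. k \<noteq> aStack \<Longrightarrow> A' k = A k" "s' = [] @ rev [oo rt..<oo (Suc rt)]"
      "R' rTop = length s'" "\<forall>i < length s'. A' aStack i = s' ! i"
      "t' \<le> t1 + 20 * (oo (Suc rt) - oo rt) + 20"
    have "I E R' A' t'"
      unfolding I_def
    proof (intro exI[of _ s'] exI[of _ "{}"] exI[of _ "[]"] conjI)
      show "tables A'"
        using tab tables_cong[of A' A] *(3) by simp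
      show "dfs s' {}"
        using dfs_init *(4) by simp
      show "expand [] @ concat (map piece (rev s')) = B"
        using *(4) by (simp add: expand_def B_def)
    qed (use * t1 in \<open>auto simp: stores_runs_def is_rle_def\<close>)
    then show "wp W len (While_less rZero rTop ?body) Q R' A' t'"
      by (rule loop)
  qed (use s0 rt in simp_all)
  have "rt < Suc N" "rt < W" "0 < W" "rt \<le> N"
    using rt N_le W_E by auto
  then show ?thesis
    unfolding output_runs_def using push[of "9 + t"] push[of "t + 9"] push[of "8 + t"] push[of "t + 8"]
    by (simp add: staticD[OF s0] len)
qed

end

section \<open>Number of runs\<close>

definition rlbwt_main :: com where
  "rlbwt_main = init_degrees ;; count_paths ;; first_symbols ;; edge_positions ;; output_runs"

lemma (in rlbwt_algorithm) rlbwt_main_correct: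
  assumes s: "static R A"
    and Q: "\<And>R' A' t' ps. static R' A' \<Longrightarrow> ps = run_length_encode B \<Longrightarrow> R' rRuns = length ps \<Longrightarrow>
      stores_runs (A' aOut) ps \<Longrightarrow> length ps \<le> E \<Longrightarrow> t' \<le> t + 130 * N + 270 * E + 150 \<Longrightarrow> Q R' A' t'"
  shows "wp W len rlbwt_main Q R A t"
  unfolding rlbwt_main_def wp_Seq
proof (rule init_degrees_correct[OF s])
  fix R1 A1 t1
  assume 1: "static R1 A1" "\<And>u. u < N \<Longrightarrow> A1 aDeg u = oo (Suc u) - oo u \<and> A1 aCnt u = 0"
    "t1 \<le> t + 30 * N + 10"
  show "wp W len count_paths (wp W len first_symbols (wp W len edge_positions (wp W len output_runs Q))) R1 A1 t1"
  proof (rule count_paths_correct[OF 1(1,2)])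
    fix R2 A2 t2 q
    assume 2: "static R2 A2" "distinct q" "set q = {..<N}" "length q = N" "\<forall>i < N. A2 aQueue i = q ! i"
      "\<forall>i < N. \<forall>f < E. src f = q ! i \<longrightarrow> tgt f \<in> set (take i q)" "\<forall>u < N. A2 aCnt u = cnt u"
      "t2 \<le> t1 + 50 * N + 50 * E + 20"
    show "wp W len first_symbols (wp W len edge_positions (wp W len output_runs Q)) R2 A2 t2"
    proof (rule first_symbols_correct[OF 2(1-6)])
      fix R3 A3 t3
      assume 3: "static R3 A3" "A3 aCnt = A2 aCnt" "\<forall>u < N. u \<noteq> rt \<longrightarrow> A3 aSym u = fsym u"
        "t3 \<le> t2 + 50 * N + 10"
      show "wp W len edge_positions (wp W len output_runs Q) R3 A3 t3"
      proof (rule edge_positions_correct[OF 3(1)])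
        fix R4 A4 t4
        assume 4: "static R4 A4" "A4 aCnt = A3 aCnt" "A4 aSym = A3 aSym" "\<forall>p < E. A4 aPos (ins p) = p"
          "t4 \<le> t3 + 20 * E + 10"
        have tab: "tables A4"
          using 2(7) 3(2,3) 4(2-4) by (simp add: tables_def)
        show "wp W len output_runs Q R4 A4 t4"
          by (rule output_runs_correct[OF 4(1) tab], rule Q) (use 1(3) 2(8) 3(4) 4(5) in auto)
      qed
    qed
  qed simp
qed

text \<open>Running the traversal on an idealised machine bounds the number of runs it emits.\<close>

lemma (in edge_graph) runs_le_edges:
  "length (run_length_encode (concat (map piece [oo rt..<oo (Suc rt)]))) \<le> E"
proof -
  define W where "W = n + 2 * E + 3"
  define len where "len k = (if k < 2 then Suc N else if k < 6 then E else 2 * E + 2)" for k :: nat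
  interpret rlbwt_algorithm N E rt sk n fin src hdf tgt oo io ins cnt fsym rank piece W len
    by unfold_locales (auto simp: W_def len_def)
  \<comment> \<open>The defaults matter: 1 is the content of \<open>rOne\<close>, and in
    \<open>A\<close> the inverse of \<open>ins\<close> is the table \<open>aPos\<close>. The counts
    and first symbols are supplied ready-made, so only the traversal has to run.\<close>
  define R :: regs where "R r = (if r = rN then N else if r = rE then E else if r = rRoot then rt
    else if r = rSink then sk else if r = rZero then 0 else 1)" for r
  define A :: arrays where "A k = (if k = aOutOff then oo else if k = aInOff then io
    else if k = aSrc then src else if k = aSymbol then hdf else if k = aTgt then tgt
    else if k = aIns then ins else if k = aCnt then cnt else if k = aSym then fsym
    else inv_into {..<E} ins)" for k
  have "static R A"
    by (simp add: static_def R_def A_def)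
  moreover have "tables A"
    using ins_bij by (simp add: tables_def A_def bij_betw_def inv_into_f_f)
  ultimately have "wp W len output_runs (\<lambda>R' A' t'. length (run_length_encode B) \<le> E) R A 0"
    by (rule output_runs_correct) simp
  then show ?thesis
    by (simp add: wp_def B_def)
qed

section \<open>Existence of a self-index\<close>

lemma sorted_enumeration:
  fixes key :: "'a \<Rightarrow> 'b :: linorder"
  assumes "finite S" "inj_on key S"
  obtains xs where "distinct xs" "set xs = S" "sorted_wrt (\<lambda>x y. key x < key y) xs"
proof -
  obtain ys where ys: "set ys = S" "distinct ys"
    using finite_distinct_list[OF assms(1)] by blast
  let ?xs = "sort_key key ys"
  have "sorted_wrt (<) (map key ?xs)"
    using ys assms(2) by (simp add: strict_sorted_iff distinct_map)
  then show ?thesis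
    using that[of ?xs] ys by (simp add: sorted_wrt_map)
qed

text \<open>Both sort orders of an index are strict, so they can be met only because their keys are
  injective: leaving edges by determinism of the first symbols, entering edges by
  \<open>cdawg_in_edge_length_inj\<close>.\<close>

lemma (in terminated_text) self_index_exists: "\<exists>ns rt sk es ins. self_index T ns rt sk es ins"
proof -
  obtain ns where ns: "set ns = cdawg_nodes T" "distinct ns"
    using finite_distinct_list[OF cdawg_nodes_finite] by blast
  have T: "T \<in> st_nodes T"
    using T_nonempty by (simp add: st_nodes_def)
  have "cdawg_root T \<in> set ns" "cdawg_sink T \<in> set ns"
    unfolding ns cdawg_root_def cdawg_sink_def using st_iso_class Nil_node T by auto
  then obtain rt sk where rt: "rt < length ns" "ns ! rt = cdawg_root T"
    and sk: "sk < length ns" "ns ! sk = cdawg_sink T"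
    by (auto simp: in_set_conv_nth)
  have ns_inj: "i = j" if "i < length ns" "j < length ns" "ns ! i = ns ! j" for i j
    using that ns(2) by (simp add: nth_eq_iff_index_eq)
  define S where "S = {(i, l, j). i < length ns \<and> j < length ns \<and> (ns ! i, l, ns ! j) \<in> cdawg_edges T}"
  have "inj_on (\<lambda>(i, l, j). (ns ! i, l, ns ! j)) S"
    using ns_inj by (auto simp: inj_on_def S_def)
  moreover have "(\<lambda>(i, l, j). (ns ! i, l, ns ! j)) ` S \<subseteq> cdawg_edges T"
    by (auto simp: S_def)
  ultimately have "finite S"
    using cdawg_edges_finite by (meson finite_imageD finite_subset)
  moreover have "inj_on (\<lambda>(i, l, j). [i, hd l]) S"
    using cdawg_edge_det ns_inj by (auto simp: inj_on_def S_def)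
  ultimately obtain es where es: "distinct es" "set es = S"
    "sorted_wrt (\<lambda>x y. (case x of (i, l, j) \<Rightarrow> [i, hd l]) < (case y of (i, l, j) \<Rightarrow> [i, hd l])) es"
    by (rule sorted_enumeration)
  \<comment> \<open>Lists of length two carry the lexicographic order of pairs; integers are used so
    that negation can turn decreasing lengths into increasing keys.\<close>
  define key where "key f = (case es ! f of (i, l, j) \<Rightarrow>
    [int j, - int (node_length (ns ! i) + length l)])" for f
  have "inj_on key {..<length es}"
  proof (rule inj_onI)
    fix f g assume fg: "f \<in> {..<length es}" "g \<in> {..<length es}" "key f = key g"
    obtain i l j i' l' j' where e: "es ! f = (i, l, j)" "es ! g = (i', l', j')"
      by (metis surj_pair)
    have "(i, l, j) \<in> S" "(i', l', j') \<in> S"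
      using fg e es(2) nth_mem by (metis lessThan_iff)+
    then have S: "i < length ns" "i' < length ns" "(ns ! i, l, ns ! j) \<in> cdawg_edges T"
      "(ns ! i', l', ns ! j') \<in> cdawg_edges T"
      by (auto simp: S_def)
    have "j = j'" "node_length (ns ! i) + length l = node_length (ns ! i') + length l'"
      using fg(3) e by (simp_all add: key_def)
    moreover from this have "length (longest (ns ! i) @ l) = length (longest (ns ! i') @ l')"
      using node_length_longest[of "ns ! i"] node_length_longest[of "ns ! i'"]
        cdawg_edge_nodes[OF S(3)] cdawg_edge_nodes[OF S(4)] by simp
    ultimately have "ns ! i = ns ! i' \<and> l = l'"
      using cdawg_in_edge_length_inj S by blast
    then have "es ! f = es ! g"
      using e S ns_inj \<open>j = j'\<close> by auto
    then show "f = g"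
      using fg es(1) by (simp add: nth_eq_iff_index_eq)
  qed
  then obtain ins where ins: "distinct ins" "set ins = {..<length es}" "sorted_wrt (\<lambda>f g. key f < key g) ins"
    using sorted_enumeration[of "{..<length es}" key] by blast
  have "self_index T ns rt sk es ins"
  proof
    show "sorted_wrt (\<lambda>(i, l, j) (i', l', j'). i < i' \<or> i = i' \<and> hd l < hd l') es"
      by (rule sorted_wrt_mono_rel[OF _ es(3)]) auto
    show "sorted_wrt (\<lambda>f g. case (es ! f, es ! g) of ((i, l, j), (i', l', j')) \<Rightarrow>
        j < j' \<or>
        j = j' \<and> node_length (ns ! i) + length l > node_length (ns ! i') + length l') ins"
      by (rule sorted_wrt_mono_rel[OF _ ins(3)]) (auto simp: key_def split: prod.splits)
  qed (use ns rt sk es ins in \<open>auto simp: S_def\<close>)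
  then show ?thesis
    by blast
qed

lemma (in self_index) length_es_le: "length es \<le> cdawg_size T"
proof -
  have "length es = card (set es)"
    using es_distinct by (simp add: distinct_card)
  also have "\<dots> \<le> card (cdawg_edges T)"
  proof (rule card_inj_on_le[of "\<lambda>(i, l, j). (ns ! i, l, ns ! j)"])
    show "inj_on (\<lambda>(i, l, j). (ns ! i, l, ns ! j)) (set es)"
      using node_inj by (auto simp: inj_on_def es_set)
  qed (auto simp: es_set cdawg_edges_finite)
  finally show ?thesis
    by (simp add: cdawg_size_def)
qed

lemma bwt_runs_le_cdawg_size:
  assumes "terminated T"
  shows "bwt_runs T \<le> cdawg_size T"
proof -
  interpret terminated_text T
    by unfold_locales (rule assms)
  obtain ns rt sk es ins where "self_index T ns rt sk es ins"
    using self_index_exists by blast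
  then interpret self_index T ns rt sk es ins .
  have "bwt_runs T \<le> length es"
    using runs_le_edges by (simp add: bwt_runs_def rlbwt_def bwt_pieces)
  then show ?thesis
    using length_es_le by simp
qed

section \<open>The program\<close>

text \<open>Base addresses live in registers outside the range of the structured language. The code
  that sets them up is therefore written directly, as straight-line code whose overflow conditions
  are collected here.\<close>

fun exec_line :: "nat \<Rightarrow> instr list \<Rightarrow> regs \<Rightarrow> nat list \<Rightarrow> regs \<Rightarrow> bool" where
  "exec_line w [] R M R' \<longleftrightarrow> R' = R"
| "exec_line w (Const d k # is) R M R' \<longleftrightarrow> k < 2 ^ w \<and> exec_line w is (R(d := k)) M R'"
| "exec_line w (Op Add d a b # is) R M R' \<longleftrightarrow>
     R a + R b < 2 ^ w \<and> exec_line w is (R(d := R a + R b)) M R'"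
| "exec_line w (Op Mul d a b # is) R M R' \<longleftrightarrow>
     R a * R b < 2 ^ w \<and> exec_line w is (R(d := R a * R b)) M R'"
| "exec_line w (Load d a # is) R M R' \<longleftrightarrow> R a < length M \<and> exec_line w is (R(d := M ! R a)) M R'"
| "exec_line w (_ # is) R M R' \<longleftrightarrow> False"

lemma steps_exec_line:
  assumes "exec_line w is R M R'" "code_at P pc is"
  shows "steps w P (length is) (pc, R, M) = Some (pc + length is, R', M)"
  using assms by (induction w "is" R M R' arbitrary: pc rule: exec_line.induct) (auto simp: code_at_Cons)

section \<open>Memory layout and the complete program\<close>

definition array_base :: "nat \<Rightarrow> nat \<Rightarrow> nat \<Rightarrow> nat" where
  \<comment> \<open>The input consists of 4 header words, \<open>N\<close> suffix links, two tables
    of \<open>N + 1\<close> words, \<open>E\<close> records of 4 words and \<open>ins\<close>.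
    Source, first symbol and target are the fields 0, 1 and 3 of a record. The seven work arrays
    follow.\<close>
  "array_base N E k =
     (if k = aOutOff then 4 + N else if k = aInOff then 5 + 2 * N
      else if k = aSrc then 6 + 3 * N else if k = aSymbol then 7 + 3 * N else if k = aTgt then 9 + 3 * N
      else if k = aIns then 6 + 3 * N + 4 * E
      else 6 + 3 * N + 5 * E + (k - 6) * (2 * E + 2))"

definition array_stride :: "nat \<Rightarrow> nat" where
  "array_stride k = (if k \<in> {aSrc, aSymbol, aTgt} then 4 else 1)"

definition array_len :: "nat \<Rightarrow> nat \<Rightarrow> nat \<Rightarrow> nat" where
  "array_len N E k = (if k < 2 then Suc N else if k < 6 then E else 2 * E + 2)"

text \<open>Register 0 is counted up to 4, which then serves as the size of the header and as the
  size of an edge record. Registers 0 and 1 are free for this because the output convention needs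
  them only at the end.\<close>

definition prologue :: "instr list" where
  "prologue =
     [Const rZero 0, Const rOne 1, Load rN rZero, Load rE rOne,
      Op Add 0 rOne rOne, Load rRoot 0, Op Add 0 0 rOne, Load rSink 0, Op Add 0 0 rOne,
      Op Add 100 0 rN, Op Add 101 100 rN, Op Add 101 101 rOne, Op Add 102 101 rN, Op Add 102 102 rOne,
      Op Add 103 102 rOne, Op Add 104 103 rOne, Op Add 104 104 rOne,
      Op Mul 1 0 rE, Op Add 105 102 1, Op Add 106 105 rE,
      Op Add 1 rE rE, Op Add 1 1 rOne, Op Add 1 1 rOne,
      Op Add 107 106 1, Op Add 108 107 1, Op Add 109 108 1, Op Add 110 109 1, Op Add 111 110 1,
      Op Add 112 111 1]"

definition epilogue :: "instr list" where
  "epilogue = [Op Add 0 112 rZero, Op Add 1 rRuns rZero]"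

definition rlbwt_program :: "instr list" where
  "rlbwt_program = prologue @ compile array_stride (length prologue) rlbwt_main @ epilogue @ [Halt]"

lemma prologue_correct:
  assumes bound: "6 + 3 * N + 5 * E + 7 * (2 * E + 2) < (2::nat) ^ w"
    and M: "4 \<le> length M" "M ! 0 = N" "M ! 1 = E" "M ! 2 = r" "M ! 3 = s"
  obtains R where "exec_line w prologue (\<lambda>_. 0) M R" "R rN = N" "R rE = E" "R rRoot = r" "R rSink = s"
    "R rZero = 0" "R rOne = 1" "\<And>k. k < 13 \<Longrightarrow> R (100 + k) = array_base N E k"
proof -
  \<comment> \<open>The number is one side of \<open>bound\<close>, multiplied out; no intermediate
    address exceeds it.\<close>
  have less: "x < 2 ^ w" if "x \<le> 3 * N + 19 * E + 20" for x
    using bound that by simp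
  have M': "M \<noteq> []" "M ! Suc 0 = E" "M ! Suc (Suc 0) = r" "M ! Suc (Suc (Suc 0)) = s"
    using M by (auto simp: numeral_2_eq_2 numeral_3_eq_3)
  have "\<exists>R. exec_line w prologue (\<lambda>_. 0) M R \<and> R rN = N \<and> R rE = E \<and> R rRoot = r \<and> R rSink = s \<and>
    R rZero = 0 \<and> R rOne = 1 \<and>
    R 100 = 4 + N \<and> R 101 = 5 + 2 * N \<and> R 102 = 6 + 3 * N \<and> R 103 = 7 + 3 * N \<and> R 104 = 9 + 3 * N \<and>
    R 105 = 6 + 3 * N + 4 * E \<and> R 106 = 6 + 3 * N + 5 * E \<and> R 107 = 8 + 3 * N + 7 * E \<and>
    R 108 = 10 + 3 * N + 9 * E \<and> R 109 = 12 + 3 * N + 11 * E \<and> R 110 = 14 + 3 * N + 13 * E \<and>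
    R 111 = 16 + 3 * N + 15 * E \<and> R 112 = 18 + 3 * N + 17 * E"
    using M M' by (simp add: prologue_def less)
  then obtain R where R: "exec_line w prologue (\<lambda>_. 0) M R" "R rN = N" "R rE = E" "R rRoot = r" "R rSink = s"
    "R rZero = 0" "R rOne = 1" and base:
    "R 100 = 4 + N" "R 101 = 5 + 2 * N" "R 102 = 6 + 3 * N" "R 103 = 7 + 3 * N" "R 104 = 9 + 3 * N"
    "R 105 = 6 + 3 * N + 4 * E" "R 106 = 6 + 3 * N + 5 * E" "R 107 = 8 + 3 * N + 7 * E"
    "R 108 = 10 + 3 * N + 9 * E" "R 109 = 12 + 3 * N + 11 * E" "R 110 = 14 + 3 * N + 13 * E"
    "R 111 = 16 + 3 * N + 15 * E" "R 112 = 18 + 3 * N + 17 * E"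
    by blast
  have "R (100 + k) = array_base N E k" if "k < 13" for k
  proof -
    have "k \<in> {0, 1, 2, 3, 4, 5, 6, 7, 8, 9, 10, 11, 12}"
      using that by simp arith
    then show ?thesis
      by (elim insertE emptyE) (simp_all add: array_base_def base)
  qed
  then show ?thesis
    using that R by blast
qed

lemma array_layout:
  assumes m: "6 + 3 * N + 5 * E + 7 * (2 * E + 2) \<le> m" "m \<le> 2 ^ w"
  shows "memory_layout w m {..<13} {6..<13} (array_base N E) array_stride (array_len N E)"
proof
  define d where "d = 2 * E + 2"
  have work: "array_base N E k + array_stride k * i = 6 + 3 * N + 5 * E + ((k - 6) * d + i)"
    if "6 \<le> k" for k i
    using that by (simp add: array_base_def array_stride_def d_def)
  have input: "array_base N E k + array_stride k * i < 6 + 3 * N + 5 * E"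
    if "k < 6" "i < array_len N E k" for k i
  proof -
    have "k = 0 \<or> k = 1 \<or> k = 2 \<or> k = 3 \<or> k = 4 \<or> k = 5"
      using that(1) by arith
    then show ?thesis
      using that(2) by (elim disjE) (simp_all add: array_base_def array_stride_def array_len_def)
  qed
  show "array_base N E k + array_stride k * i < m" if "k \<in> {..<13}" "i < array_len N E k" for k i
  proof (cases "k < 6")
    case True
    then show ?thesis
      using input[OF True that(2)] m by simp
  next
    case False
    have "(k - 6) * d \<le> 6 * d"
      using that by (intro mult_le_mono1) simp
    moreover have "i < d"
      using that False by (simp add: array_len_def d_def)
    moreover have "6 \<le> k"
      using False by simp
    ultimately show ?thesis
      unfolding work[OF \<open>6 \<le> k\<close>] using m(1)[folded d_def] by linarith
  qed
  show "k = k' \<and> i = i'"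
    if k: "k \<in> {6..<13}" "k' \<in> {..<13}" "i < array_len N E k" "i' < array_len N E k'"
      "array_base N E k + array_stride k * i = array_base N E k' + array_stride k' * i'" for k k' i i'
  proof (cases "k' < 6")
    case True
    then show ?thesis
      using input[OF True k(4)] work[of k i] k by simp
  next
    case False
    have i: "i < d" "i' < d"
      using k False by (auto simp: array_len_def d_def)
    have eq: "(k - 6) * d + i = (k' - 6) * d + i'"
      using k False work[of k i] work[of k' i'] by simp
    \<comment> \<open>Relative to the first work array, an address is a number with the digits
      \<open>k - 6\<close> and \<open>i\<close> in base \<open>d\<close>, and digits are
      unique.\<close>
    have "(a * d + j) div d = a" if "j < d" for a d j :: nat
      using that by simp
    from this[OF i(1), of "k - 6"] this[OF i(2), of "k' - 6"] have "k - 6 = k' - 6"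
      using eq by simp
    then show ?thesis
      using eq k(1) False by auto
  qed
  show "0 < array_stride k" "array_stride k < 2 ^ w" for k
    using m by (auto simp: array_stride_def)
  show "m \<le> 2 ^ w" "{6..<13} \<subseteq> {..<13}"
    using m by auto
qed

lemma well_formed_main: "well_formed {..<13} {6..<13} rlbwt_main"
  by (simp add: rlbwt_main_def init_degrees_def count_paths_def process_in_edges_def first_symbols_def
      edge_first_symbol_def edge_positions_def output_runs_def push_out_edges_def emit_run_def append_run_def)

lemma stores_runs_concat:
  "stores_runs a ps \<Longrightarrow> map a [0..<2 * length ps] = concat (map (\<lambda>(c, k). [c, k]) ps)"
proof (induction ps rule: rev_induct)
  case (snoc p ps)
  have "stores_runs a ps" "a (2 * length ps) = fst p" "a (Suc (2 * length ps)) = snd p"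
    using snoc.prems by (auto simp: stores_runs_def nth_append less_Suc_eq)
  then show ?case
    using snoc.IH by (simp add: case_prod_beta)
qed simp

lemma take_drop_nth: "b + k \<le> length M \<Longrightarrow> take k (drop b M) = map (\<lambda>i. M ! (b + i)) [0..<k]"
  by (rule nth_equalityI) auto

lemma nth_append_middle: "length as = a \<Longrightarrow> i < length bs \<Longrightarrow> (as @ bs @ cs) ! (a + i) = bs ! i"
  by (auto simp: nth_append)

lemma nth_concat_blocks:
  assumes "\<And>x. length (g x) = d" "f < length xs" "j < d"
  shows "concat (map g xs) ! (d * f + j) = g (xs ! f) ! j"
  using assms(2)
proof (induction xs arbitrary: f)
  case (Cons x xs)
  then show ?case
    using assms by (cases f) (auto simp: nth_append)
qed simp

lemma length_concat_blocks: "(\<And>x. length (g x) = d) \<Longrightarrow> length (concat (map g xs)) = d * length xs"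
  by (induction xs) auto


text \<open>The constant 1000 is generous. Root and sink differ, so \<open>E\<close> is at least 1,
  and \<open>N\<close> is at most \<open>E + 1\<close>. The work arrays then take
  \<open>14 * E + 14\<close>, at most \<open>28 * E\<close> words, and the time
  \<open>130 * N + 270 * E + 150\<close> plus the 31 instructions around the main part is at most
  \<open>711 * E\<close>.\<close>

lemma (in self_index) rlbwt_program_correct:
  assumes sl: "length sl = length ns"
    and xs: "xs = [length ns, length es, rt, sk] @ sl
        @ map (\<lambda>k. length (filter (\<lambda>(i, l, j). i < k) es)) [0..<Suc (length ns)]
        @ map (\<lambda>k. length (filter (\<lambda>(i, l, j). j < k) es)) [0..<Suc (length ns)]
        @ concat (map (\<lambda>(i, l, j). [i, hd l, length l, j]) es)
        @ ins"
    and w: "word_size_ok w T xs (1000 * cdawg_size T)"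
  shows "ram_computes w rlbwt_program xs (rlbwt T) (1000 * cdawg_size T) (1000 * cdawg_size T)"
  unfolding ram_computes_def
proof (intro allI impI)
  fix work :: "nat list" assume work: "length work = 1000 * cdawg_size T \<and> (\<forall>x \<in> set work. x < 2 ^ w)"
  define N E where "N = length ns" and "E = length es"
  define M where "M = xs @ work"
  define m where "m = length M"
  let ?base = "array_base N E" and ?len = "array_len N E"
  let ?blocks = "concat (map (\<lambda>(i, l, j). [i, hd l, length l, j]) es)"
  have E: "1 \<le> E" "E \<le> cdawg_size T" "N \<le> Suc E"
    using out_edge[OF rt(1)] rt_sk oo_le[of "Suc rt"] length_es_le N_le by (auto simp: N_def E_def)
  have len_blocks: "length ?blocks = 4 * E"
    using length_concat_blocks[of "\<lambda>(i, l, j). [i, hd l, length l, j]" 4 es] by (auto simp: E_def)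
  have len_xs: "length xs = 6 + 3 * N + 5 * E"
    using len_blocks by (simp add: xs sl N_def E_def length_ins)
  have m: "m = length xs + 1000 * cdawg_size T" "m \<le> 2 ^ w"
    using w work by (auto simp: m_def M_def word_size_ok_def)
  have layout: "6 + 3 * N + 5 * E + 7 * (2 * E + 2) < m"
    using len_xs m(1) E by simp
  interpret memory_layout w m "{..<13}" "{6..<13}" ?base array_stride ?len
    using layout m by (intro array_layout) auto
  interpret alg: rlbwt_algorithm "length ns" "length es" rt sk "length T" "last T"
    src "\<lambda>f. hd (lab f)" tgt oo io "\<lambda>p. ins ! p" cnt fsym "\<lambda>k. node_length (ns ! k)" piece
    "2 ^ w" ?len
  proof
    show "length T < 2 ^ w"
      using w by (simp add: word_size_ok_def)
    show "2 * length es + 2 < 2 ^ w"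
      using layout m by (simp add: E_def)
  qed (auto simp: array_len_def N_def E_def)
  have M4: "4 \<le> length M" "M ! 0 = N" "M ! 1 = E" "M ! 2 = rt" "M ! 3 = sk"
    by (simp_all add: M_def xs N_def E_def)
  obtain R where R: "exec_line w prologue (\<lambda>_. 0) M R" "R rN = N" "R rE = E" "R rRoot = rt" "R rSink = sk"
    "R rZero = 0" "R rOne = 1" "\<And>k. k < 13 \<Longrightarrow> R (100 + k) = ?base k"
    using prologue_correct[OF _ M4, of w] layout m by auto
  define A where "A k i = M ! (?base k + array_stride k * i)" for k i
  have rep: "represents R M R A"
    unfolding represents_def A_def using R(8) m_def by auto
  have split: "M = ([N, E, rt, sk] @ sl) @ map oo [0..<Suc N] @ map io [0..<Suc N] @ ?blocks @ ins @ work"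
    unfolding M_def xs N_def E_def oo_def[abs_def] io_def[abs_def]
    by (simp only: append_assoc append_Cons append_Nil)
  have out_off: "M ! (4 + N + i) = oo i" if "i \<le> N" for i
  proof -
    have "M ! (4 + N + i) = map oo [0..<Suc N] ! i"
      unfolding split by (rule nth_append_middle) (use that sl in \<open>simp_all add: N_def\<close>)
    then show ?thesis
      using that by (simp del: upt_Suc)
  qed
  have in_off: "M ! (5 + 2 * N + i) = io i" if "i \<le> N" for i
  proof -
    have M_eq: "M = ([N, E, rt, sk] @ sl @ map oo [0..<Suc N]) @ map io [0..<Suc N] @ (?blocks @ ins @ work)"
      unfolding split by (simp only: append_assoc)
    have "M ! (5 + 2 * N + i) = map io [0..<Suc N] ! i"
      unfolding M_eq by (rule nth_append_middle) (use that sl in \<open>simp_all add: N_def\<close>)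
    then show ?thesis
      using that by (simp del: upt_Suc)
  qed
  have blocks: "M ! (6 + 3 * N + (4 * f + j)) = [src f, hd (lab f), length (lab f), tgt f] ! j"
    if "f < E" "j < 4" for f j
  proof -
    have M_eq: "M = ([N, E, rt, sk] @ sl @ map oo [0..<Suc N] @ map io [0..<Suc N]) @ ?blocks @ (ins @ work)"
      unfolding split by (simp only: append_assoc)
    have "M ! (6 + 3 * N + (4 * f + j)) = ?blocks ! (4 * f + j)"
      unfolding M_eq by (rule nth_append_middle) (use that sl len_blocks in \<open>simp_all add: N_def\<close>)
    also have "\<dots> = (case es ! f of (i, l, j) \<Rightarrow> [i, hd l, length l, j]) ! j"
      by (rule nth_concat_blocks) (use that in \<open>auto simp: E_def\<close>)
    finally show ?thesis
      by (simp add: es_nth)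
  qed
  have ins_M: "M ! (6 + 3 * N + 4 * E + p) = ins ! p" if "p < E" for p
  proof -
    have M_eq: "M = ([N, E, rt, sk] @ sl @ map oo [0..<Suc N] @ map io [0..<Suc N] @ ?blocks) @ ins @ work"
      unfolding split by (simp only: append_assoc)
    show ?thesis
      unfolding M_eq by (rule nth_append_middle) (use that sl len_blocks length_ins in \<open>simp_all add: N_def E_def\<close>)
  qed
  have A: "A k i = M ! a" if "array_base N E k + array_stride k * i = a" for k i a
    using that by (simp add: A_def)
  have addr: "array_base N E aOutOff + array_stride aOutOff * i = 4 + N + i"
    "array_base N E aInOff + array_stride aInOff * i = 5 + 2 * N + i"
    "array_base N E aSrc + array_stride aSrc * i = 6 + 3 * N + (4 * i + 0)"
    "array_base N E aSymbol + array_stride aSymbol * i = 6 + 3 * N + (4 * i + 1)"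
    "array_base N E aTgt + array_stride aTgt * i = 6 + 3 * N + (4 * i + 3)"
    "array_base N E aIns + array_stride aIns * i = 6 + 3 * N + 4 * E + i" for i
    by (simp_all add: array_base_def array_stride_def)
  have "A aOutOff i = oo i" "A aInOff i = io i" if "i \<le> N" for i
    unfolding A[OF addr(1)] A[OF addr(2)] by (rule out_off[OF that], rule in_off[OF that])
  moreover have "A aSrc f = src f" "A aSymbol f = hd (lab f)" "A aTgt f = tgt f" if "f < E" for f
    by (subst A[OF addr(3)], subst blocks[OF that], simp, simp)
      (subst A[OF addr(4)], subst blocks[OF that], simp, simp,
       subst A[OF addr(5)], subst blocks[OF that], simp, simp)
  moreover have "A aIns p = ins ! p" if "p < E" for p
    unfolding A[OF addr(6)] by (rule ins_M[OF that])
  ultimately have static: "alg.static R A"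
    using R(2-7) unfolding alg.static_def unfolding N_def[symmetric] E_def[symmetric] by blast
  have "wp (2 ^ w) ?len rlbwt_main (\<lambda>R' A' t'. alg.static R' A' \<and> R' rRuns = length (rlbwt T) \<and>
      stores_runs (A' aOut) (rlbwt T) \<and> length (rlbwt T) \<le> E \<and> t' \<le> 130 * N + 270 * E + 150) R A 0"
    by (rule alg.rlbwt_main_correct[OF static])
      (auto simp: alg.B_def bwt_pieces[symmetric] rlbwt_def N_def E_def)
  then obtain t R1 A1 where exec: "exec (2 ^ w) ?len rlbwt_main R A t R1 A1"
    and post: "alg.static R1 A1" "R1 rRuns = length (rlbwt T)" "stores_runs (A1 aOut) (rlbwt T)"
      "length (rlbwt T) \<le> E" "t \<le> 130 * N + 270 * E + 150"
    by (auto simp: wp_def)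
  have "code_at rlbwt_program 0 (prologue @ compile array_stride (length prologue) rlbwt_main @ epilogue @ [Halt])"
    unfolding code_at_def rlbwt_program_def by (intro exI[of _ "[]"]) simp
  then have code: "code_at rlbwt_program 0 prologue"
    "code_at rlbwt_program (length prologue) (compile array_stride (length prologue) rlbwt_main)"
    "code_at rlbwt_program (length prologue + code_size rlbwt_main) (epilogue @ [Halt])"
    by (simp_all add: code_at_append)
  let ?pc = "length prologue + code_size rlbwt_main"
  obtain R1' M1 where run: "steps w rlbwt_program t (length prologue, R, M) = Some (?pc, R1', M1)"
    and rep1: "represents R1' M1 R1 A1"
    using compile_correct[OF exec well_formed_main rep code(2)] by blast
  define R2 where "R2 = R1'(0 := ?base 12, 1 := length (rlbwt T))"
  have base12: "?base 12 < m" "?base 12 + (2 * E + 2) \<le> m"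
    using layout by (simp_all add: array_base_def)
  have regs: "R1' 112 = ?base 12" "R1' rZero = 0" "R1' rRuns = length (rlbwt T)"
    using representsD(2)[OF rep1, of 12] representsD(1)[OF rep1, of rZero] representsD(1)[OF rep1, of rRuns]
      alg.staticD(5)[OF post(1)] post(2) by simp_all
  have "exec_line w epilogue R1' M1 R2"
    using regs base12 m post(4) layout by (simp add: epilogue_def R2_def)
  then have fin: "steps w rlbwt_program (length epilogue) (?pc, R1', M1) = Some (?pc + length epilogue, R2, M1)"
    using code(3) by (intro steps_exec_line) (auto simp: code_at_append)
  have "steps w rlbwt_program (length prologue) (0, \<lambda>_. 0, M) = Some (0 + length prologue, R, M)"
    by (rule steps_exec_line[OF R(1) code(1)])
  then have "steps w rlbwt_program (length prologue + t + length epilogue) (0, \<lambda>_. 0, M) =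
      Some (?pc + length epilogue, R2, M1)"
    using steps_addI[OF steps_addI[OF _ run] fin] by simp
  moreover have "?pc + length epilogue < length rlbwt_program \<and> rlbwt_program ! (?pc + length epilogue) = Halt"
    using code(3) by (simp add: code_at_append code_at_Cons)
  ultimately have "halts_in w rlbwt_program (length prologue + t + length epilogue) (xs @ work) R2 M1"
    unfolding halts_in_def M_def[symmetric] by blast
  moreover have "length prologue + t + length epilogue \<le> 1000 * cdawg_size T"
    using post(5) E by (simp add: prologue_def epilogue_def)
  moreover have "outputs_pairs R2 M1 (rlbwt T)"
  proof -
    have "take (2 * length (rlbwt T)) (drop (?base 12) M1) =
        map (\<lambda>i. M1 ! (?base 12 + i)) [0..<2 * length (rlbwt T)]"
      using base12 post(4) representsD(3)[OF rep1] by (intro take_drop_nth) simp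
    also have "\<dots> = map (A1 aOut) [0..<2 * length (rlbwt T)]"
      using post(4) representsD(4)[OF rep1, of 12]
      by (intro map_cong) (auto simp: array_stride_def array_len_def)
    also have "\<dots> = concat (map (\<lambda>(c, k). [c, k]) (rlbwt T))"
      by (rule stores_runs_concat[OF post(3)])
    finally show ?thesis
      by (simp add: outputs_pairs_def R2_def)
  qed
  ultimately show "\<exists>t' \<le> 1000 * cdawg_size T. \<exists>R' M'. halts_in w rlbwt_program t' (xs @ work) R' M' \<and>
      outputs_pairs R' M' (rlbwt T)"
    by blast
qed

theorem theorem1:
  shows "(\<forall>T. terminated T \<longrightarrow> bwt_runs T \<le> cdawg_size T) \<and>
    (\<exists>P C. \<forall>T xs w. terminated T \<longrightarrow> cdawg_self_index T xs \<longrightarrow>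
       word_size_ok w T xs (C * cdawg_size T) \<longrightarrow>
       ram_computes w P xs (rlbwt T) (C * cdawg_size T) (C * cdawg_size T))"
proof (intro conjI exI[of _ rlbwt_program] exI[of _ 1000] allI impI)
  show "bwt_runs T \<le> cdawg_size T" if "terminated T" for T
    by (rule bwt_runs_le_cdawg_size[OF that])
  fix T xs w
  assume T: "terminated T" and index: "cdawg_self_index T xs"
    and w: "word_size_ok w T xs (1000 * cdawg_size T)"
  from index show "ram_computes w rlbwt_program xs (rlbwt T) (1000 * cdawg_size T) (1000 * cdawg_size T)"
    unfolding cdawg_self_index_def
  proof (elim exE conjE, goal_cases)
    case (1 ns rt sk sl es ins)
    interpret self_index T ns rt sk es ins
      by unfold_locales (fact T 1)+
    show ?case
      by (rule rlbwt_program_correct[OF _ _ w]) (fact 1)+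
  qed
qed

end
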